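(* Let $\mathbf{p}\in\Bbbk^{\mathtt{I}}$ and let $\mathtt{J}_{\mathbf{p}}$ be the set of all $i\in\mathtt{I}$ such that $p_i\in\mathbb{Z}$. If $\mathtt{J}_{\mathbf{p}}\neq\varnothing$, then the category $\mathfrak{W}_{\mathbf{p}}$ is equivalent to the category of modules over $C_{\mathtt{J}_{\mathbf{p}}}$.
   Context: Let $\Bbbk$ be an algebraically closed field of characteristic zero and $\mathtt{I}$ an infinite set with $|\mathtt{I}|<|\Bbbk|$. Let $B$ be the polynomial $\Bbbk$-algebra in the variables $x_i$, $i\in\mathtt{I}$. The infinite Weyl algebra $A$ is the subalgebra of $\mathrm{End}_{\Bbbk}(B)$ generated by all $X_i$ (multiplication by $x_i$) and all $Y_i$ (partial derivative $\partial_i$ with respect to $x_i$), $i\in\mathtt{I}$. Put $t_i:=X_iY_i$. Let $\Bbbk^{\mathtt{I}}$ be the additive group of all vectors $\mathbf{v}=(v_i)_{i\in\mathtt{I}}$ with coefficients in $\Bbbk$, and $\mathbb{Z}_f^{\mathtt{I}}\subset\Bbbk^{\mathtt{I}}$ the subgroup of integral vectors with at most finitely many nonzero coefficients. Modules are left modules. An $A$-module $M$ is a weight module if $M=\bigoplus_{\mathbf{p}\in\Bbbk^{\mathtt{I}}}M_{\mathbf{p}}$, where $M_{\mathbf{p}}=\{x\in M: t_i\cdot x=p_i x\ \forall i\in\mathtt{I}\}$. The support $\mathrm{supp}(M)$ of a weight module $M$ is the set of all $\mathbf{p}$ with $M_{\mathbf{p}}\neq0$. $\mathfrak{W}$ is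 the full subcategory of the category of all $A$-modules consisting of all weight modules, and $\mathfrak{W}_{\mathbf{p}}$ is the full subcategory of $\mathfrak{W}$ consisting of all $M$ with $\mathrm{supp}(M)\subset\mathbf{p}+\mathbb{Z}_f^{\mathtt{I}}$. For a nonempty set $E$ the quiver $Q_E$ is defined as follows. The vertices are all finite subsets of $E$; for vertices $U,W$ there is one arrow from $U$ to $W$ if and only if the symmetric difference $U\triangle W$ is a singleton (and no arrow otherwise). Impose the following relations: if there are arrows $\alpha:U\to W$ and $\beta:W\to U$, then $\alpha\beta=\beta\alpha=0$; if $U,W,U',W'$ are different subsets such that there are arrows $\alpha:U\to W$, $\beta:W\to W'$, $\alpha':U\to U'$, $\beta':U'\to W'$, then $\beta\alpha=\beta'\alpha'$. The $\Bbbk$-linear path category of $Q_E$ with these relations is denoted $C_E$. A module over $C_E$ is a $\Bbbk$-linear functor from $C_E$ to $\Bbbk$-vector spaces (equivalently, a representation of $Q_E$ over $\Bbbk$ satisfying the relations). *)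

theory Defs
  imports
    "HOL-Algebra.Module"
    "HOL-Library.Poly_Mapping"
    "HOL-Library.Equipollence"
    "HOL-Computational_Algebra.Polynomial"
begin

section \<open>Categories, functors and equivalences\<close>

text \<open>
  Arrows do not determine their domain and codomain, so composition takes the three objects as
  arguments: \<open>Comp C X Y Z g f\<close> is \<open>g \<circ> f\<close> for \<open>f : X \<rightarrow> Y\<close> and \<open>g : Y \<rightarrow> Z\<close>. Likewise a functor
  receives the two end points of the arrow it is applied to.
\<close>

record ('o, 'a) category =
  Obj :: "'o set"
  Hom :: "'o \<Rightarrow> 'o \<Rightarrow> 'a set"
  Ident :: "'o \<Rightarrow> 'a"
  Comp :: "'o \<Rightarrow> 'o \<Rightarrow> 'o \<Rightarrow> 'a \<Rightarrow> 'a \<Rightarrow> 'a"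

record ('o1, 'a1, 'o2, 'a2) cat_functor =
  fobj :: "'o1 \<Rightarrow> 'o2"
  fmap :: "'o1 \<Rightarrow> 'o1 \<Rightarrow> 'a1 \<Rightarrow> 'a2"

definition is_category :: "('o, 'a, 'z) category_scheme \<Rightarrow> bool" where
  "is_category C \<longleftrightarrow>
     (\<forall>X\<in>Obj C. Ident C X \<in> Hom C X X) \<and>
     (\<forall>X\<in>Obj C. \<forall>Y\<in>Obj C. \<forall>Z\<in>Obj C. \<forall>f\<in>Hom C X Y. \<forall>g\<in>Hom C Y Z.
        Comp C X Y Z g f \<in> Hom C X Z) \<and>
     (\<forall>X\<in>Obj C. \<forall>Y\<in>Obj C. \<forall>f\<in>Hom C X Y.
        Comp C X X Y f (Ident C X) = f \<and> Comp C X Y Y (Ident C Y) f = f) \<and>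
     (\<forall>X\<in>Obj C. \<forall>Y\<in>Obj C. \<forall>Z\<in>Obj C. \<forall>W\<in>Obj C.
        \<forall>f\<in>Hom C X Y. \<forall>g\<in>Hom C Y Z. \<forall>h\<in>Hom C Z W.
          Comp C X Z W h (Comp C X Y Z g f) = Comp C X Y W (Comp C Y Z W h g) f)"

definition is_functor ::
  "('o1, 'a1, 'z1) category_scheme \<Rightarrow> ('o2, 'a2, 'z2) category_scheme
    \<Rightarrow> ('o1, 'a1, 'o2, 'a2) cat_functor \<Rightarrow> bool" where
  "is_functor C D F \<longleftrightarrow>
     (\<forall>X\<in>Obj C. fobj F X \<in> Obj D) \<and>
     (\<forall>X\<in>Obj C. \<forall>Y\<in>Obj C. \<forall>f\<in>Hom C X Y. fmap F X Y f \<in> Hom D (fobj F X) (fobj F Y)) \<and>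
     (\<forall>X\<in>Obj C. fmap F X X (Ident C X) = Ident D (fobj F X)) \<and>
     (\<forall>X\<in>Obj C. \<forall>Y\<in>Obj C. \<forall>Z\<in>Obj C. \<forall>f\<in>Hom C X Y. \<forall>g\<in>Hom C Y Z.
        fmap F X Z (Comp C X Y Z g f)
          = Comp D (fobj F X) (fobj F Y) (fobj F Z) (fmap F Y Z g) (fmap F X Y f))"

definition id_functor :: "('o, 'a, 'o, 'a) cat_functor" where
  "id_functor = \<lparr>fobj = (\<lambda>X. X), fmap = (\<lambda>X Y f. f)\<rparr>"

definition comp_functor ::
  "('o2, 'a2, 'o3, 'a3) cat_functor \<Rightarrow> ('o1, 'a1, 'o2, 'a2) cat_functor
    \<Rightarrow> ('o1, 'a1, 'o3, 'a3) cat_functor" where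
  "comp_functor G F =
     \<lparr>fobj = (\<lambda>X. fobj G (fobj F X)),
      fmap = (\<lambda>X Y f. fmap G (fobj F X) (fobj F Y) (fmap F X Y f))\<rparr>"

definition is_nat_trans ::
  "('o1, 'a1, 'z1) category_scheme \<Rightarrow> ('o2, 'a2, 'z2) category_scheme
    \<Rightarrow> ('o1, 'a1, 'o2, 'a2) cat_functor \<Rightarrow> ('o1, 'a1, 'o2, 'a2) cat_functor
    \<Rightarrow> ('o1 \<Rightarrow> 'a2) \<Rightarrow> bool" where
  "is_nat_trans C D F G \<eta> \<longleftrightarrow>
     (\<forall>X\<in>Obj C. \<eta> X \<in> Hom D (fobj F X) (fobj G X)) \<and>
     (\<forall>X\<in>Obj C. \<forall>Y\<in>Obj C. \<forall>f\<in>Hom C X Y.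
        Comp D (fobj F X) (fobj F Y) (fobj G Y) (\<eta> Y) (fmap F X Y f)
          = Comp D (fobj F X) (fobj G X) (fobj G Y) (fmap G X Y f) (\<eta> X))"

definition is_iso :: "('o, 'a, 'z) category_scheme \<Rightarrow> 'o \<Rightarrow> 'o \<Rightarrow> 'a \<Rightarrow> bool" where
  "is_iso C X Y f \<longleftrightarrow>
     f \<in> Hom C X Y \<and>
     (\<exists>g\<in>Hom C Y X. Comp C X Y X g f = Ident C X \<and> Comp C Y X Y f g = Ident C Y)"

definition naturally_isomorphic ::
  "('o1, 'a1, 'z1) category_scheme \<Rightarrow> ('o2, 'a2, 'z2) category_scheme
    \<Rightarrow> ('o1, 'a1, 'o2, 'a2) cat_functor \<Rightarrow> ('o1, 'a1, 'o2, 'a2) cat_functor \<Rightarrow> bool" where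
  "naturally_isomorphic C D F G \<longleftrightarrow>
     (\<exists>\<eta>. is_nat_trans C D F G \<eta> \<and> (\<forall>X\<in>Obj C. is_iso D (fobj F X) (fobj G X) (\<eta> X)))"

definition equivalent_categories ::
  "('o1, 'a1, 'z1) category_scheme \<Rightarrow> ('o2, 'a2, 'z2) category_scheme \<Rightarrow> bool" where
  "equivalent_categories C D \<longleftrightarrow>
     is_category C \<and> is_category D \<and>
     (\<exists>F G. is_functor C D F \<and> is_functor D C G \<and>
        naturally_isomorphic C C (comp_functor G F) id_functor \<and>
        naturally_isomorphic D D (comp_functor F G) id_functor)"

definition full_subcategory ::
  "('o, 'a, 'z) category_scheme \<Rightarrow> ('o \<Rightarrow> bool) \<Rightarrow> ('o, 'a, 'z) category_scheme" where
  "full_subcategory C P = C\<lparr>Obj := {X \<in> Obj C. P X}\<rparr>"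


section \<open>Linear categories and linear functors\<close>

record ('o, 'a, 'k) lin_category = "('o, 'a) category" +
  HAdd :: "'o \<Rightarrow> 'o \<Rightarrow> 'a \<Rightarrow> 'a \<Rightarrow> 'a"
  HScale :: "'o \<Rightarrow> 'o \<Rightarrow> 'k \<Rightarrow> 'a \<Rightarrow> 'a"

definition is_lin_functor ::
  "('o1, 'a1, 'k, 'z1) lin_category_scheme \<Rightarrow> ('o2, 'a2, 'k, 'z2) lin_category_scheme
    \<Rightarrow> ('o1, 'a1, 'o2, 'a2) cat_functor \<Rightarrow> bool" where
  "is_lin_functor C D F \<longleftrightarrow>
     is_functor C D F \<and>
     (\<forall>X\<in>Obj C. \<forall>Y\<in>Obj C. \<forall>f\<in>Hom C X Y. \<forall>g\<in>Hom C X Y.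
        fmap F X Y (HAdd C X Y f g)
          = HAdd D (fobj F X) (fobj F Y) (fmap F X Y f) (fmap F X Y g)) \<and>
     (\<forall>X\<in>Obj C. \<forall>Y\<in>Obj C. \<forall>c. \<forall>f\<in>Hom C X Y.
        fmap F X Y (HScale C X Y c f) = HScale D (fobj F X) (fobj F Y) c (fmap F X Y f))"

text \<open>
  Natural transformations are families indexed by the objects of \<open>C\<close>; being extensional there makes
  equality of arrows of the functor category the right one.
\<close>

definition lin_functor_category ::
  "('o1, 'a1, 'k, 'z1) lin_category_scheme \<Rightarrow> ('o2, 'a2, 'k, 'z2) lin_category_scheme
    \<Rightarrow> (('o1, 'a1, 'o2, 'a2) cat_functor, 'o1 \<Rightarrow> 'a2) category" where
  "lin_functor_category C D =
     \<lparr>Obj = {F. is_lin_functor C D F},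
      Hom = (\<lambda>F G. {\<eta> \<in> extensional (Obj C). is_nat_trans C D F G \<eta>}),
      Ident = (\<lambda>F. \<lambda>X\<in>Obj C. Ident D (fobj F X)),
      Comp = (\<lambda>F G H \<theta> \<eta>. \<lambda>X\<in>Obj C. Comp D (fobj F X) (fobj G X) (fobj H X) (\<theta> X) (\<eta> X))\<rparr>"


section \<open>Left modules and vector spaces\<close>

text \<open>
  The library's \<open>module\<close> locale requires a commutative ring. The record type is reused; its fields
  \<open>mult\<close> and \<open>one\<close>, and the values of the operations outside the carrier, carry no information, so
  that modules differing only there are distinct but isomorphic objects.
\<close>

locale left_module = R?: ring R + M?: abelian_group M for R (structure) and M (structure) +
  assumes smult_closed:
      "\<lbrakk>a \<in> carrier R; x \<in> carrier M\<rbrakk> \<Longrightarrow> a \<odot>\<^bsub>M\<^esub> x \<in> carrier M"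
    and smult_l_distr:
      "\<lbrakk>a \<in> carrier R; b \<in> carrier R; x \<in> carrier M\<rbrakk> \<Longrightarrow>
        (a \<oplus>\<^bsub>R\<^esub> b) \<odot>\<^bsub>M\<^esub> x = a \<odot>\<^bsub>M\<^esub> x \<oplus>\<^bsub>M\<^esub> b \<odot>\<^bsub>M\<^esub> x"
    and smult_r_distr:
      "\<lbrakk>a \<in> carrier R; x \<in> carrier M; y \<in> carrier M\<rbrakk> \<Longrightarrow>
        a \<odot>\<^bsub>M\<^esub> (x \<oplus>\<^bsub>M\<^esub> y) = a \<odot>\<^bsub>M\<^esub> x \<oplus>\<^bsub>M\<^esub> a \<odot>\<^bsub>M\<^esub> y"
    and smult_assoc:
      "\<lbrakk>a \<in> carrier R; b \<in> carrier R; x \<in> carrier M\<rbrakk> \<Longrightarrow>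
        (a \<otimes>\<^bsub>R\<^esub> b) \<odot>\<^bsub>M\<^esub> x = a \<odot>\<^bsub>M\<^esub> (b \<odot>\<^bsub>M\<^esub> x)"
    and smult_one:
      "x \<in> carrier M \<Longrightarrow> \<one>\<^bsub>R\<^esub> \<odot>\<^bsub>M\<^esub> x = x"

definition lmod_hom ::
  "('r, 'z) ring_scheme \<Rightarrow> ('r, 'm) module \<Rightarrow> ('r, 'm) module \<Rightarrow> ('m \<Rightarrow> 'm) set" where
  "lmod_hom R M N =
     {f \<in> carrier M \<rightarrow>\<^sub>E carrier N.
        (\<forall>x\<in>carrier M. \<forall>y\<in>carrier M. f (x \<oplus>\<^bsub>M\<^esub> y) = f x \<oplus>\<^bsub>N\<^esub> f y) \<and>
        (\<forall>a\<in>carrier R. \<forall>x\<in>carrier M. f (a \<odot>\<^bsub>M\<^esub> x) = a \<odot>\<^bsub>N\<^esub> f x)}"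

text \<open>
  All left \<open>R\<close>-modules whose underlying set is contained in the type \<open>'m\<close>, which plays the role of
  the universe.
\<close>

definition lmod_category ::
  "('r, 'z) ring_scheme \<Rightarrow> (('r, 'm) module, 'm \<Rightarrow> 'm) category" where
  "lmod_category R =
     \<lparr>Obj = {M. left_module R M},
      Hom = lmod_hom R,
      Ident = (\<lambda>M. \<lambda>x\<in>carrier M. x),
      Comp = (\<lambda>M N P g f. compose (carrier M) g f)\<rparr>"

definition scalar_ring :: "'k::field ring" where
  "scalar_ring = \<lparr>carrier = UNIV, monoid.mult = (*), one = 1, zero = 0, add = (+)\<rparr>"

definition vect_category :: "(('k::field, 'm) module, 'm \<Rightarrow> 'm, 'k) lin_category" where
  "vect_category =
     \<lparr>Obj = {V. Module.module scalar_ring V},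
      Hom = lmod_hom scalar_ring,
      Ident = (\<lambda>V. \<lambda>x\<in>carrier V. x),
      Comp = (\<lambda>V W Z g f. compose (carrier V) g f),
      HAdd = (\<lambda>V W f g. \<lambda>x\<in>carrier V. f x \<oplus>\<^bsub>W\<^esub> g x),
      HScale = (\<lambda>V W c f. \<lambda>x\<in>carrier V. c \<odot>\<^bsub>W\<^esub> f x)\<rparr>"


section \<open>The Weyl algebra\<close>

type_synonym ('i, 'k) polys = "('i \<Rightarrow>\<^sub>0 nat) \<Rightarrow>\<^sub>0 'k"

definition const_poly :: "'k::comm_ring_1 \<Rightarrow> ('i, 'k) polys" where
  "const_poly c = Poly_Mapping.single 0 c"

definition var_poly :: "'i \<Rightarrow> ('i, 'k::comm_ring_1) polys" where
  "var_poly i = Poly_Mapping.single (Poly_Mapping.single i 1) 1"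

text \<open>
  Subtraction of exponents is truncated, but where it truncates the coefficient is zero.
\<close>

definition partial_deriv :: "'i \<Rightarrow> ('i, 'k::comm_ring_1) polys \<Rightarrow> ('i, 'k) polys" where
  "partial_deriv i u =
     (\<Sum>m\<in>Poly_Mapping.keys u.
        Poly_Mapping.single (m - Poly_Mapping.single i 1)
          (of_nat (Poly_Mapping.lookup m i) * Poly_Mapping.lookup u m))"

definition weyl_X :: "'i \<Rightarrow> ('i, 'k::comm_ring_1) polys \<Rightarrow> ('i, 'k) polys" where
  "weyl_X i = (\<lambda>u. var_poly i * u)"

definition weyl_Y :: "'i \<Rightarrow> ('i, 'k::comm_ring_1) polys \<Rightarrow> ('i, 'k) polys" where
  "weyl_Y i = partial_deriv i"

inductive_set weyl_carrier :: "(('i, 'k::comm_ring_1) polys \<Rightarrow> ('i, 'k) polys) set" where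
  X: "weyl_X i \<in> weyl_carrier"
| Y: "weyl_Y i \<in> weyl_carrier"
| one: "id \<in> weyl_carrier"
| add: "a \<in> weyl_carrier \<Longrightarrow> b \<in> weyl_carrier \<Longrightarrow> (\<lambda>u. a u + b u) \<in> weyl_carrier"
| scale: "a \<in> weyl_carrier \<Longrightarrow> (\<lambda>u. const_poly c * a u) \<in> weyl_carrier"
| comp: "a \<in> weyl_carrier \<Longrightarrow> b \<in> weyl_carrier \<Longrightarrow> a \<circ> b \<in> weyl_carrier"

definition weyl_algebra :: "(('i, 'k::comm_ring_1) polys \<Rightarrow> ('i, 'k) polys) ring" where
  "weyl_algebra =
     \<lparr>carrier = weyl_carrier, monoid.mult = (\<circ>), one = id, zero = (\<lambda>_. 0), add = (\<lambda>a b u. a u + b u)\<rparr>"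

definition weyl_scalar :: "'k::comm_ring_1 \<Rightarrow> ('i, 'k) polys \<Rightarrow> ('i, 'k) polys" where
  "weyl_scalar c = (\<lambda>u. const_poly c * u)"

definition weyl_t :: "'i \<Rightarrow> ('i, 'k::comm_ring_1) polys \<Rightarrow> ('i, 'k) polys" where
  "weyl_t i = weyl_X i \<circ> weyl_Y i"


section \<open>Weight modules\<close>

type_synonym ('i, 'k, 'm) weyl_module = "(('i, 'k) polys \<Rightarrow> ('i, 'k) polys, 'm) module"

definition weight_space ::
  "('i, 'k::comm_ring_1, 'm) weyl_module \<Rightarrow> ('i \<Rightarrow> 'k) \<Rightarrow> 'm set" where
  "weight_space M q =
     {x \<in> carrier M. \<forall>i. weyl_t i \<odot>\<^bsub>M\<^esub> x = weyl_scalar (q i) \<odot>\<^bsub>M\<^esub> x}"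

text \<open>
  \<open>M\<close> is the internal direct sum of its weight spaces: every element is in a unique way a finite sum
  of components, one from each weight space, almost all of them zero.
\<close>

definition is_weight_module :: "('i, 'k::comm_ring_1, 'm) weyl_module \<Rightarrow> bool" where
  "is_weight_module M \<longleftrightarrow>
     (\<forall>x\<in>carrier M. \<exists>!f. (\<forall>q. f q \<in> weight_space M q) \<and> finite {q. f q \<noteq> \<zero>\<^bsub>M\<^esub>} \<and>
        x = finsum M f {q. f q \<noteq> \<zero>\<^bsub>M\<^esub>})"

definition weight_supp :: "('i, 'k::comm_ring_1, 'm) weyl_module \<Rightarrow> ('i \<Rightarrow> 'k) set" where
  "weight_supp M = {q. weight_space M q \<noteq> {\<zero>\<^bsub>M\<^esub>}}"

definition finite_integral_vectors :: "('i \<Rightarrow> 'k::ring_1) set" where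
  "finite_integral_vectors = {v. (\<forall>i. v i \<in> \<int>) \<and> finite {i. v i \<noteq> 0}}"

definition weight_category ::
  "(('i, 'k::comm_ring_1, 'm) weyl_module, 'm \<Rightarrow> 'm) category" where
  "weight_category = full_subcategory (lmod_category weyl_algebra) is_weight_module"

definition weight_category_at ::
  "('i \<Rightarrow> 'k::comm_ring_1) \<Rightarrow> (('i, 'k, 'm) weyl_module, 'm \<Rightarrow> 'm) category" where
  "weight_category_at p =
     full_subcategory weight_category
       (\<lambda>M. weight_supp M \<subseteq> {\<lambda>i. p i + v i |v. v \<in> finite_integral_vectors})"

definition integral_indices :: "('i \<Rightarrow> 'k::ring_1) \<Rightarrow> 'i set" where
  "integral_indices p = {i. p i \<in> \<int>}"


section \<open>The quiver of finite subsets and its path category\<close>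

text \<open>
  There is at most one arrow between two vertices, so a path is determined by the nonempty list of
  the vertices it visits, in the order of traversal; \<open>[U]\<close> is the trivial path at \<open>U\<close>.
\<close>

definition quiver_arrow :: "'i set \<Rightarrow> 'i set \<Rightarrow> 'i set \<Rightarrow> bool" where
  "quiver_arrow E U W \<longleftrightarrow> U \<in> Fpow E \<and> W \<in> Fpow E \<and> is_singleton (sym_diff U W)"

definition quiver_paths :: "'i set \<Rightarrow> 'i set \<Rightarrow> 'i set \<Rightarrow> 'i set list set" where
  "quiver_paths E U W =
     {us. us \<noteq> [] \<and> set us \<subseteq> Fpow E \<and> hd us = U \<and> last us = W \<and> successively (quiver_arrow E) us}"

text \<open>
  Linear combinations of paths; \<open>path_comp g f\<close> is \<open>g\<close> after \<open>f\<close>.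
\<close>

definition path_space :: "'i set \<Rightarrow> 'i set \<Rightarrow> 'i set \<Rightarrow> ('i set list \<Rightarrow>\<^sub>0 'k::zero) set" where
  "path_space E U W = {f. Poly_Mapping.keys f \<subseteq> quiver_paths E U W}"

definition path_scale :: "'k::comm_ring_1 \<Rightarrow> ('i set list \<Rightarrow>\<^sub>0 'k) \<Rightarrow> ('i set list \<Rightarrow>\<^sub>0 'k)" where
  "path_scale c f = Poly_Mapping.map ((*) c) f"

definition path_comp ::
  "('i set list \<Rightarrow>\<^sub>0 'k::comm_ring_1) \<Rightarrow> ('i set list \<Rightarrow>\<^sub>0 'k) \<Rightarrow> ('i set list \<Rightarrow>\<^sub>0 'k)" where
  "path_comp g f =
     (\<Sum>us\<in>Poly_Mapping.keys f. \<Sum>ws\<in>Poly_Mapping.keys g.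
        Poly_Mapping.single (us @ tl ws) (Poly_Mapping.lookup g ws * Poly_Mapping.lookup f us))"

text \<open>
  \<open>rel_ideal E U W f\<close>: the combination \<open>f\<close> of paths from \<open>U\<close> to \<open>W\<close> lies in the ideal generated by
  the relations. Exchanging \<open>U\<close> and \<open>W\<close> in \<open>loop\<close> gives the other of the two vanishing composites.
\<close>

inductive rel_ideal ::
  "'i set \<Rightarrow> 'i set \<Rightarrow> 'i set \<Rightarrow> ('i set list \<Rightarrow>\<^sub>0 'k::comm_ring_1) \<Rightarrow> bool"
  for E :: "'i set" where
  loop: "quiver_arrow E U W \<Longrightarrow> quiver_arrow E W U \<Longrightarrow>
    rel_ideal E U U (Poly_Mapping.single [U, W, U] 1)"
| square: "distinct [U, W, U', W'] \<Longrightarrow> quiver_arrow E U W \<Longrightarrow> quiver_arrow E W W' \<Longrightarrow>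
    quiver_arrow E U U' \<Longrightarrow> quiver_arrow E U' W' \<Longrightarrow>
    rel_ideal E U W' (Poly_Mapping.single [U, W, W'] 1 - Poly_Mapping.single [U, U', W'] 1)"
| zero: "U \<in> Fpow E \<Longrightarrow> W \<in> Fpow E \<Longrightarrow> rel_ideal E U W 0"
| add: "rel_ideal E U W f \<Longrightarrow> rel_ideal E U W g \<Longrightarrow> rel_ideal E U W (f + g)"
| scale: "rel_ideal E U W f \<Longrightarrow> rel_ideal E U W (path_scale c f)"
| comp_left: "rel_ideal E U W f \<Longrightarrow> Z \<in> Fpow E \<Longrightarrow> g \<in> path_space E W Z \<Longrightarrow>
    rel_ideal E U Z (path_comp g f)"
| comp_right: "rel_ideal E W Z g \<Longrightarrow> U \<in> Fpow E \<Longrightarrow> f \<in> path_space E U W \<Longrightarrow>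
    rel_ideal E U Z (path_comp g f)"

definition path_class ::
  "'i set \<Rightarrow> 'i set \<Rightarrow> 'i set \<Rightarrow> ('i set list \<Rightarrow>\<^sub>0 'k::comm_ring_1) \<Rightarrow> ('i set list \<Rightarrow>\<^sub>0 'k) set"
  where "path_class E U W f = {g. rel_ideal E U W (g - f)}"

text \<open>
  Arrows are cosets modulo the ideal. Each union below is over representatives, all of which yield
  the same coset.
\<close>

definition path_category ::
  "'i set \<Rightarrow> ('i set, ('i set list \<Rightarrow>\<^sub>0 'k::comm_ring_1) set, 'k) lin_category" where
  "path_category E =
     \<lparr>Obj = Fpow E,
      Hom = (\<lambda>U W. path_class E U W ` path_space E U W),
      Ident = (\<lambda>U. path_class E U U (Poly_Mapping.single [U] 1)),
      Comp = (\<lambda>U W Z b a. \<Union>f\<in>a. \<Union>g\<in>b. path_class E U Z (path_comp g f)),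
      HAdd = (\<lambda>U W a b. \<Union>f\<in>a. \<Union>g\<in>b. path_class E U W (f + g)),
      HScale = (\<lambda>U W c a. \<Union>f\<in>a. path_class E U W (path_scale c f))\<rparr>"

definition path_module_category ::
  "'i set \<Rightarrow> (('i set, ('i set list \<Rightarrow>\<^sub>0 'k::field) set, ('k, 'm) module, 'm \<Rightarrow> 'm) cat_functor,
      'i set \<Rightarrow> 'm \<Rightarrow> 'm) category" where
  "path_module_category E = lin_functor_category (path_category E) vect_category"

end

theory Submission
  imports Defs "HOL-Algebra.Free_Abelian_Groups"
begin

text \<open>
  On a weight module with support in \<open>p + \<int>\<^sub>f\<close> the products \<open>X\<^sup>\<alpha> Y\<^sup>\<beta>\<close> give for all weights \<open>v\<close>, \<open>w\<close> a
  shift \<open>S\<^sub>v\<^sub>w\<close> between the weight spaces, and \<open>S\<^sub>w\<^sub>u S\<^sub>v\<^sub>w = c(v, w, u) S\<^sub>v\<^sub>u\<close>, where the cocycle \<open>c\<close> is the product of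
  \<open>p\<^sub>i + n + 1\<close> over the walls between \<open>n\<close> and \<open>n + 1\<close> in direction \<open>i\<close> that are crossed back and forth. A wall
  has weight zero for exactly one \<open>n\<close> for each \<open>i\<close> with \<open>p\<^sub>i\<close> integral, so the finite set of zero walls
  separating \<open>v\<close> from \<open>0\<close> is a vertex of the quiver, and weight spaces over the same vertex are
  isomorphic by shifts. Choosing one weight over each vertex suitably, \<open>c\<close> takes only the values \<open>0\<close> and
  \<open>1\<close> on the chosen weights. On the other side, modulo the relations any two shortest paths
  between two vertices agree and all other paths vanish, which is the same composition law; hence
  restriction to the chosen weight spaces is a functor to the modules over the path category.

  It is fully faithful because the weight spaces and the action are recovered from the chosen ones by shifts. It is
  essentially surjective because a path module, spread over all weights, carries operators \<open>X\<^sub>i\<close> and \<open>Y\<^sub>i\<close>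
  satisfying the Weyl relations, and these define a module over the Weyl algebra as the
  operators \<open>X\<^sup>\<alpha> Y\<^sup>\<beta>\<close> on polynomials are linearly independent. The hypothesis on cardinalities is what
  makes room for this direct sum in the universe \<open>'m\<close>.
\<close>

section \<open>Equivalences of categories\<close>

text \<open>The Weyl algebra is a set of concrete operators, not an algebra given by generators and
  relations. Hence operators satisfying the Weyl relations do not yet define an action: the image of
  an element must be shown independent of the way in which the element is built up. Independence of
  the ordered monomials, which rests on characteristic zero, settles this.

  The scalars \<open>backtrack\<close> form a 2-cocycle whose nonzero values are arbitrary, whereas
  the relations of the quiver know only 0 and 1. The corners are weights at which the cocycle is
  already normalised; \<open>base_factor\<close> and \<open>transport_factor\<close> compare any
  weight with the corner over its vertex, and computing with them means applying the cocycle
  identity.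

  Room in the universe comes from the path module itself. If one of its spaces is nonzero, the
  universe contains a copy of the field, so it is infinite and at least as large as the index set,
  and finitely supported families over the weights are no more numerous than its elements. If all
  spaces vanish, the sum has one element.\<close>

lemma is_categoryD:
  assumes "is_category C"
  shows Ident_Hom: "X \<in> Obj C \<Longrightarrow> Ident C X \<in> Hom C X X"
    and Comp_Hom: "\<lbrakk>f \<in> Hom C X Y; g \<in> Hom C Y Z; X \<in> Obj C; Y \<in> Obj C; Z \<in> Obj C\<rbrakk>
      \<Longrightarrow> Comp C X Y Z g f \<in> Hom C X Z"
    and Comp_Ident_right: "\<lbrakk>f \<in> Hom C X Y; X \<in> Obj C; Y \<in> Obj C\<rbrakk> \<Longrightarrow> Comp C X X Y f (Ident C X) = f"
    and Comp_Ident_left: "\<lbrakk>f \<in> Hom C X Y; X \<in> Obj C; Y \<in> Obj C\<rbrakk> \<Longrightarrow> Comp C X Y Y (Ident C Y) f = f"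
    and Comp_assoc: "\<lbrakk>f \<in> Hom C X Y; g \<in> Hom C Y Z; h \<in> Hom C Z W;
        X \<in> Obj C; Y \<in> Obj C; Z \<in> Obj C; W \<in> Obj C\<rbrakk>
      \<Longrightarrow> Comp C X Z W h (Comp C X Y Z g f) = Comp C X Y W (Comp C Y Z W h g) f"
  using assms unfolding is_category_def by blast+

lemma is_functorD:
  assumes "is_functor C D F"
  shows fobj_Obj: "X \<in> Obj C \<Longrightarrow> fobj F X \<in> Obj D"
    and fmap_Hom: "\<lbrakk>f \<in> Hom C X Y; X \<in> Obj C; Y \<in> Obj C\<rbrakk> \<Longrightarrow> fmap F X Y f \<in> Hom D (fobj F X) (fobj F Y)"
    and fmap_Ident: "X \<in> Obj C \<Longrightarrow> fmap F X X (Ident C X) = Ident D (fobj F X)"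
    and fmap_Comp: "\<lbrakk>f \<in> Hom C X Y; g \<in> Hom C Y Z; X \<in> Obj C; Y \<in> Obj C; Z \<in> Obj C\<rbrakk>
      \<Longrightarrow> fmap F X Z (Comp C X Y Z g f)
        = Comp D (fobj F X) (fobj F Y) (fobj F Z) (fmap F Y Z g) (fmap F X Y f)"
  using assms unfolding is_functor_def by blast+

text \<open>A quasi-inverse is built by choice: \<open>G0 Y\<close> comes with an isomorphism
  \<open>e Y\<close> from its image to \<open>Y\<close>, and an arrow goes to the unique preimage of
  its conjugate by these isomorphisms. This leaves three properties of one explicit functor to be
  checked.\<close>

lemma equivalent_categoriesI:
  assumes C: "is_category C" and D: "is_category D" and F: "is_functor C D F"
    and faithful: "\<And>X Y f g. \<lbrakk>X \<in> Obj C; Y \<in> Obj C; f \<in> Hom C X Y; g \<in> Hom C X Y;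
        fmap F X Y f = fmap F X Y g\<rbrakk> \<Longrightarrow> f = g"
    and full: "\<And>X Y h. \<lbrakk>X \<in> Obj C; Y \<in> Obj C; h \<in> Hom D (fobj F X) (fobj F Y)\<rbrakk>
        \<Longrightarrow> \<exists>f\<in>Hom C X Y. fmap F X Y f = h"
    and ess: "\<And>Y. Y \<in> Obj D \<Longrightarrow> \<exists>X\<in>Obj C. \<exists>f. is_iso D (fobj F X) Y f"
  shows "equivalent_categories C D"
proof -
  note cat = Ident_Hom[OF C] Comp_Hom[OF C] Ident_Hom[OF D] Comp_Hom[OF D]
    fobj_Obj[OF F] fmap_Hom[OF F]
  have "\<forall>Y\<in>Obj D. \<exists>X e e'. X \<in> Obj C \<and> e \<in> Hom D (fobj F X) Y \<and> e' \<in> Hom D Y (fobj F X) \<and>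
      Comp D (fobj F X) Y (fobj F X) e' e = Ident D (fobj F X) \<and>
      Comp D Y (fobj F X) Y e e' = Ident D Y"
    using ess unfolding is_iso_def by blast
  then obtain G0 e e' where G0: "\<And>Y. Y \<in> Obj D \<Longrightarrow> G0 Y \<in> Obj C"
    and e: "\<And>Y. Y \<in> Obj D \<Longrightarrow> e Y \<in> Hom D (fobj F (G0 Y)) Y"
    and e': "\<And>Y. Y \<in> Obj D \<Longrightarrow> e' Y \<in> Hom D Y (fobj F (G0 Y))"
    and e'e: "\<And>Y. Y \<in> Obj D \<Longrightarrow> Comp D (fobj F (G0 Y)) Y (fobj F (G0 Y)) (e' Y) (e Y)
        = Ident D (fobj F (G0 Y))"
    and ee': "\<And>Y. Y \<in> Obj D \<Longrightarrow> Comp D Y (fobj F (G0 Y)) Y (e Y) (e' Y) = Ident D Y"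
    by metis
  have "\<forall>X\<in>Obj C. \<forall>Y\<in>Obj C. \<forall>h\<in>Hom D (fobj F X) (fobj F Y). \<exists>f\<in>Hom C X Y. fmap F X Y f = h"
    using full by blast
  then obtain pre where pre: "\<And>X Y h. \<lbrakk>h \<in> Hom D (fobj F X) (fobj F Y); X \<in> Obj C; Y \<in> Obj C\<rbrakk> \<Longrightarrow>
       pre X Y h \<in> Hom C X Y"
     and fpre: "\<And>X Y h. \<lbrakk>h \<in> Hom D (fobj F X) (fobj F Y); X \<in> Obj C; Y \<in> Obj C\<rbrakk> \<Longrightarrow>
       fmap F X Y (pre X Y h) = h"
    by metis
  define conj where "conj Y Z h = Comp D (fobj F (G0 Y)) Z (fobj F (G0 Z)) (e' Z)
      (Comp D (fobj F (G0 Y)) Y Z h (e Y))" for Y Z h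
  have conj: "conj Y Z h \<in> Hom D (fobj F (G0 Y)) (fobj F (G0 Z))"
    if "h \<in> Hom D Y Z" "Y \<in> Obj D" "Z \<in> Obj D" for Y Z h
    unfolding conj_def using that by (intro cat) (auto intro!: cat G0 e e')
  have e_conj: "Comp D (fobj F (G0 Y)) (fobj F (G0 Z)) Z (e Z) (conj Y Z h)
      = Comp D (fobj F (G0 Y)) Y Z h (e Y)"
    if h: "h \<in> Hom D Y Z" and Y: "Y \<in> Obj D" and Z: "Z \<in> Obj D" for Y Z h
  proof -
    have he: "Comp D (fobj F (G0 Y)) Y Z h (e Y) \<in> Hom D (fobj F (G0 Y)) Z"
      using that by (intro cat) (auto intro!: cat G0 e e')
    have "Comp D (fobj F (G0 Y)) (fobj F (G0 Z)) Z (e Z) (conj Y Z h)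
      = Comp D (fobj F (G0 Y)) Z Z (Comp D Z (fobj F (G0 Z)) Z (e Z) (e' Z))
         (Comp D (fobj F (G0 Y)) Y Z h (e Y))"
      unfolding conj_def by (rule Comp_assoc[OF D he e' e]) (use Y Z in \<open>auto intro!: cat G0\<close>)
    then show ?thesis
      using Comp_Ident_left[OF D he] Y Z by (simp add: ee' cat G0)
  qed
  \<comment> \<open>\<open>e Z\<close> has a left inverse, so equations between arrows into the
    image of \<open>G0 Z\<close> may be checked after composing with \<open>e Z\<close>.\<close>
  have cancel: "h = h'" if "h \<in> Hom D X (fobj F (G0 Z))" "h' \<in> Hom D X (fobj F (G0 Z))"
      "X \<in> Obj D" "Z \<in> Obj D"
      "Comp D X (fobj F (G0 Z)) Z (e Z) h = Comp D X (fobj F (G0 Z)) Z (e Z) h'" for X Z h h'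
  proof -
    have FZ: "fobj F (G0 Z) \<in> Obj D" using that by (auto intro!: cat G0)
    have *: "Comp D X Z (fobj F (G0 Z)) (e' Z) (Comp D X (fobj F (G0 Z)) Z (e Z) k) = k"
      if k: "k \<in> Hom D X (fobj F (G0 Z))" for k
      using Comp_assoc[OF D k e e' \<open>X \<in> Obj D\<close> FZ \<open>Z \<in> Obj D\<close> FZ] \<open>Z \<in> Obj D\<close>
        Comp_Ident_left[OF D k \<open>X \<in> Obj D\<close> FZ]
      by (simp add: e'e)
    show ?thesis using * that by metis
  qed
  define G where "G = \<lparr>fobj = G0, fmap = (\<lambda>Y Z h. pre (G0 Y) (G0 Z) (conj Y Z h))\<rparr>"
  have FG: "fmap F (G0 Y) (G0 Z) (fmap G Y Z h) = conj Y Z h"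
    if "h \<in> Hom D Y Z" "Y \<in> Obj D" "Z \<in> Obj D" for Y Z h
    using that by (simp add: G_def fpre conj G0)
  have GHom: "fmap G Y Z h \<in> Hom C (G0 Y) (G0 Z)"
    if "h \<in> Hom D Y Z" "Y \<in> Obj D" "Z \<in> Obj D" for Y Z h
    using that by (simp add: G_def pre conj G0)
  have conj_Ident: "conj Y Y (Ident D Y) = Ident D (fobj F (G0 Y))" if "Y \<in> Obj D" for Y
    unfolding conj_def using that Comp_Ident_left[OF D e] by (simp add: cat G0 e'e)
  have conj_Comp: "conj X Z (Comp D X Y Z h f) =
      Comp D (fobj F (G0 X)) (fobj F (G0 Y)) (fobj F (G0 Z)) (conj Y Z h) (conj X Y f)"
    if f: "f \<in> Hom D X Y" and h: "h \<in> Hom D Y Z" and X: "X \<in> Obj D" and Y: "Y \<in> Obj D"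
      and Z: "Z \<in> Obj D" for X Y Z f h
  proof (rule cancel[OF _ _ _ Z])
    note FX = fobj_Obj[OF F G0, OF X] and FY = fobj_Obj[OF F G0, OF Y]
      and FZ = fobj_Obj[OF F G0, OF Z]
    show "Comp D (fobj F (G0 X)) (fobj F (G0 Z)) Z (e Z) (conj X Z (Comp D X Y Z h f)) =
      Comp D (fobj F (G0 X)) (fobj F (G0 Z)) Z (e Z)
        (Comp D (fobj F (G0 X)) (fobj F (G0 Y)) (fobj F (G0 Z)) (conj Y Z h) (conj X Y f))"
      using Comp_assoc[OF D conj[OF f X Y] conj[OF h Y Z] e[OF Z] FX FY FZ Z]
        Comp_assoc[OF D conj[OF f X Y] e[OF Y] h FX FY Y Z]
        Comp_assoc[OF D e[OF X] f h FX X Y Z]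
      by (simp add: e_conj cat f h X Y Z)
  qed (auto intro!: conj cat G0 X Y Z f h)
  have G: "is_functor D C G"
    unfolding is_functor_def
  proof (intro conjI ballI)
    fix X assume X: "X \<in> Obj D"
    show "fobj G X \<in> Obj C" using X by (simp add: G_def G0)
    show "fmap G X X (Ident D X) = Ident C (fobj G X)"
      by (rule faithful[OF G0[OF X] G0[OF X]])
        (use X in \<open>auto simp: conj_Ident cat fmap_Ident[OF F] G0 GHom G_def pre fpre\<close>)
    fix Y f assume Y: "Y \<in> Obj D" and f: "f \<in> Hom D X Y"
    show "fmap G X Y f \<in> Hom C (fobj G X) (fobj G Y)"
      using GHom[OF f X Y] by (simp add: G_def)
    fix Z h assume Z: "Z \<in> Obj D" and h: "h \<in> Hom D Y Z"
    have Gf: "fmap G X Z (Comp D X Y Z h f) = Comp C (G0 X) (G0 Y) (G0 Z) (fmap G Y Z h) (fmap G X Y f)"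
    proof (rule faithful[OF G0[OF X] G0[OF Z]])
      show "fmap F (G0 X) (G0 Z) (fmap G X Z (Comp D X Y Z h f)) =
        fmap F (G0 X) (G0 Z) (Comp C (G0 X) (G0 Y) (G0 Z) (fmap G Y Z h) (fmap G X Y f))"
        using fmap_Comp[OF F GHom[OF f X Y] GHom[OF h Y Z]]
        by (simp add: FG X Y Z f h cat conj_Comp G0)
    qed (use X Y Z f h in \<open>auto intro!: GHom cat G0\<close>)
    then show "fmap G X Z (Comp D X Y Z h f) =
      Comp C (fobj G X) (fobj G Y) (fobj G Z) (fmap G Y Z h) (fmap G X Y f)"
      by (simp add: G_def)
  qed
  have isoD: "is_iso D (fobj F (G0 Y)) Y (e Y)" if "Y \<in> Obj D" for Y
    using that e e' e'e ee' unfolding is_iso_def by blast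
  have "naturally_isomorphic D D (comp_functor F G) id_functor"
    unfolding naturally_isomorphic_def is_nat_trans_def
    by (rule exI[of _ e]) (use isoD e_conj FG e in
      \<open>auto simp: comp_functor_def id_functor_def G_def\<close>)
  moreover have "naturally_isomorphic C C (comp_functor G F) id_functor"
  proof -
    \<comment> \<open>Fullness lifts \<open>e (fobj F X)\<close> and its inverse to
      \<open>C\<close>; faithfulness lets every identity for the lifts be tested after applying
      \<open>F\<close>.\<close>
    define \<eta> where "\<eta> X = pre (G0 (fobj F X)) X (e (fobj F X))" for X
    have \<eta>: "\<eta> X \<in> Hom C (G0 (fobj F X)) X"
      and F\<eta>: "fmap F (G0 (fobj F X)) X (\<eta> X) = e (fobj F X)" if "X \<in> Obj C" for X
      using that by (auto simp: \<eta>_def intro!: pre fpre e G0 cat)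
    define \<theta> where "\<theta> X = pre X (G0 (fobj F X)) (e' (fobj F X))" for X
    have \<theta>: "\<theta> X \<in> Hom C X (G0 (fobj F X))"
      and F\<theta>: "fmap F X (G0 (fobj F X)) (\<theta> X) = e' (fobj F X)" if "X \<in> Obj C" for X
      using that by (auto simp: \<theta>_def intro!: pre fpre e' G0 cat)
    have 1: "Comp C (G0 (fobj F X)) X (G0 (fobj F X)) (\<theta> X) (\<eta> X) = Ident C (G0 (fobj F X))"
      if X: "X \<in> Obj C" for X
    proof (rule faithful)
      show "fmap F (G0 (fobj F X)) (G0 (fobj F X)) (Comp C (G0 (fobj F X)) X (G0 (fobj F X)) (\<theta> X) (\<eta> X))
        = fmap F (G0 (fobj F X)) (G0 (fobj F X)) (Ident C (G0 (fobj F X)))"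
        using fmap_Comp[OF F \<eta>[OF X] \<theta>[OF X]] X
        by (simp add: F\<eta> F\<theta> G0 cat e'e fmap_Ident[OF F])
    qed (use X in \<open>auto intro!: cat \<eta> \<theta> G0\<close>)
    have 2: "Comp C X (G0 (fobj F X)) X (\<eta> X) (\<theta> X) = Ident C X"
      if X: "X \<in> Obj C" for X
    proof (rule faithful)
      show "fmap F X X (Comp C X (G0 (fobj F X)) X (\<eta> X) (\<theta> X)) = fmap F X X (Ident C X)"
        using fmap_Comp[OF F \<theta>[OF X] \<eta>[OF X]] X
        by (simp add: F\<eta> F\<theta> G0 cat ee' fmap_Ident[OF F])
    qed (use X in \<open>auto intro!: cat \<eta> \<theta> G0\<close>)
    have 3: "Comp C (G0 (fobj F X)) (G0 (fobj F Y)) Y (\<eta> Y) (fmap G (fobj F X) (fobj F Y) (fmap F X Y f)) =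
          Comp C (G0 (fobj F X)) X Y f (\<eta> X)"
      if X: "X \<in> Obj C" and Y: "Y \<in> Obj C" and f: "f \<in> Hom C X Y" for X Y f
    proof (rule faithful[of "G0 (fobj F X)" Y])
      let ?f = "fmap F X Y f"
      note Ff = fmap_Hom[OF F f X Y] and FX = fobj_Obj[OF F X] and FY = fobj_Obj[OF F Y]
      show "fmap F (G0 (fobj F X)) Y (Comp C (G0 (fobj F X)) (G0 (fobj F Y)) Y (\<eta> Y)
          (fmap G (fobj F X) (fobj F Y) ?f)) =
        fmap F (G0 (fobj F X)) Y (Comp C (G0 (fobj F X)) X Y f (\<eta> X))"
        using fmap_Comp[OF F GHom[OF Ff FX FY] \<eta>[OF Y]] fmap_Comp[OF F \<eta>[OF X] f]
        by (simp add: F\<eta> G0 X Y FX FY FG[OF Ff FX FY] e_conj[OF Ff FX FY])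
      show "Comp C (G0 (fobj F X)) (G0 (fobj F Y)) Y (\<eta> Y) (fmap G (fobj F X) (fobj F Y) ?f)
          \<in> Hom C (G0 (fobj F X)) Y"
        by (rule Comp_Hom[OF C GHom[OF Ff FX FY] \<eta>[OF Y]]) (auto intro!: G0 FX FY Y)
      show "Comp C (G0 (fobj F X)) X Y f (\<eta> X) \<in> Hom C (G0 (fobj F X)) Y"
        by (rule Comp_Hom[OF C \<eta>[OF X] f]) (auto intro!: G0 FX X Y)
    qed (auto intro!: G0 cat X Y)
    show ?thesis
      unfolding naturally_isomorphic_def is_nat_trans_def is_iso_def
      apply (rule exI[of _ \<eta>])
      using \<eta> \<theta> 1 2 3 apply (simp add: comp_functor_def id_functor_def G_def)
      by blast
  qed
  ultimately show ?thesis
    unfolding equivalent_categories_def using C D F G by blast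
qed

section \<open>The Weyl algebra as a ring\<close>

text \<open>A finitely supported function is built up by adding one term at a fresh key, so additive
  operators may be compared on single terms. The commutation rules of the Weyl algebra that involve
  derivatives are obtained in this way.\<close>

lemma additive_eqI:
  fixes F G :: "('a \<Rightarrow>\<^sub>0 'b::ab_group_add) \<Rightarrow> 'c::ab_group_add"
  assumes "\<And>u v. F (u + v) = F u + F v" and "\<And>u v. G (u + v) = G u + G v"
    and "\<And>m b. F (Poly_Mapping.single m b) = G (Poly_Mapping.single m b)"
  shows "F u = G u"
proof (induction u rule: update_induct)
  case const
  have "F 0 + F 0 = F 0" "G 0 + G 0 = G 0" using assms(1,2)[of 0 0] by simp_all
  then show ?case by simp
next
  case (update f a b)
  have "Poly_Mapping.update a b f = f + Poly_Mapping.single a b"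
    using update(1) by (intro poly_mapping_eqI) (auto simp: lookup_update lookup_add lookup_single in_keys_iff when_def)
  then show ?case using assms update by simp
qed

lemma const_poly_times_single [simp]:
  "const_poly c * Poly_Mapping.single m b = Poly_Mapping.single m (c * b)"
  by (simp add: const_poly_def mult_single)

lemma lookup_const_poly_times [simp]:
  "Poly_Mapping.lookup (const_poly c * u) m = c * Poly_Mapping.lookup u m"
  unfolding const_poly_def mult_map_scale_conv_mult[symmetric] by (simp add: Poly_Mapping.map.rep_eq when_def)

lemma const_poly_arith:
  "const_poly 0 = 0" "const_poly 1 = 1" "const_poly (a + b) = const_poly a + const_poly b"
  "const_poly (a * b) = const_poly a * const_poly b"
  by (simp_all add: const_poly_def single_add mult_single)

text \<open>Coefficients can cancel, so the keys of a sum need not be the union of the keys; summing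
  over a common finite superset makes additivity a termwise matter. The other lemmas ending in
  \<open>superset\<close> serve the same purpose.\<close>

lemma partial_deriv_superset:
  assumes "finite S" and "Poly_Mapping.keys u \<subseteq> S"
  shows "partial_deriv i u = (\<Sum>m\<in>S. Poly_Mapping.single (m - Poly_Mapping.single i 1)
          (of_nat (Poly_Mapping.lookup m i) * Poly_Mapping.lookup u m))"
  unfolding partial_deriv_def
  by (rule sum.mono_neutral_left) (use assms in \<open>auto simp: in_keys_iff\<close>)

lemma partial_deriv_add: "partial_deriv i (u + v) = partial_deriv i u + partial_deriv i v"
proof -
  let ?S = "Poly_Mapping.keys u \<union> Poly_Mapping.keys v"
  have "Poly_Mapping.keys (u + v) \<subseteq> ?S" by (rule Poly_Mapping.keys_add)
  then show ?thesis
    by (simp add: partial_deriv_superset[of ?S] lookup_add algebra_simps single_add sum.distrib)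
qed

lemma partial_deriv_single:
  "partial_deriv i (Poly_Mapping.single m b) =
    Poly_Mapping.single (m - Poly_Mapping.single i 1) (of_nat (Poly_Mapping.lookup m i) * b)"
  by (subst partial_deriv_superset[of "{m}"]) auto

lemma partial_deriv_const: "partial_deriv i (const_poly c * u) = const_poly c * partial_deriv i u"
  by (rule additive_eqI[where F = "\<lambda>u. partial_deriv i (const_poly c * u)"])
    (simp_all add: partial_deriv_add partial_deriv_single algebra_simps)

lemma var_poly_times_single:
  "var_poly i * Poly_Mapping.single m b = Poly_Mapping.single (m + Poly_Mapping.single i 1) b"
  by (simp add: var_poly_def mult_single add.commute)

lemma poly_mapping_nat_diff_add:
  fixes m :: "'i \<Rightarrow>\<^sub>0 nat"
  assumes "Poly_Mapping.lookup m i \<noteq> 0"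
  shows "m - Poly_Mapping.single i 1 + Poly_Mapping.single i 1 = m"
  using assms by (intro poly_mapping_eqI) (auto simp: lookup_add lookup_minus lookup_single when_def)

lemma poly_mapping_nat_diff_add2:
  fixes m :: "'i \<Rightarrow>\<^sub>0 nat"
  assumes "Poly_Mapping.lookup m i \<noteq> 0 \<or> i \<noteq> j"
  shows "m + Poly_Mapping.single j 1 - Poly_Mapping.single i 1 =
    (m - Poly_Mapping.single i 1) + Poly_Mapping.single j 1"
  using assms by (intro poly_mapping_eqI) (auto simp: lookup_add lookup_minus lookup_single when_def)

lemma weyl_YX: "weyl_Y i (weyl_X i u) = weyl_X i (weyl_Y i u) + u"
  unfolding weyl_X_def weyl_Y_def
proof (rule additive_eqI[where F = "\<lambda>u. partial_deriv i (var_poly i * u)"])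
  fix m :: "'a \<Rightarrow>\<^sub>0 nat" and b :: 'b
  have [simp]: "m + Poly_Mapping.single i (Suc 0) - Poly_Mapping.single i (Suc 0) = m"
    by (intro poly_mapping_eqI) (simp add: lookup_add lookup_minus)
  show "partial_deriv i (var_poly i * Poly_Mapping.single m b) =
      var_poly i * partial_deriv i (Poly_Mapping.single m b) + Poly_Mapping.single m b"
    \<comment> \<open>At exponent 0 the truncated subtraction cannot be undone, but then the
      derivative has coefficient 0; otherwise this is the product rule on one term.\<close>
    using poly_mapping_nat_diff_add[of m i]
    by (cases "Poly_Mapping.lookup m i = 0")
      (simp_all add: var_poly_times_single partial_deriv_single lookup_add algebra_simps single_add)
qed (simp_all add: partial_deriv_add algebra_simps)

lemma weyl_XY_commute:
  assumes "i \<noteq> j"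
  shows "weyl_X i (weyl_Y j u) = weyl_Y j (weyl_X i u)"
  unfolding weyl_X_def weyl_Y_def
  by (rule additive_eqI[where F = "\<lambda>u. var_poly i * partial_deriv j u"])
    (use assms poly_mapping_nat_diff_add2[of _ j i] in \<open>auto simp: var_poly_times_single partial_deriv_single partial_deriv_add
        algebra_simps lookup_add lookup_single_not_eq\<close>)

lemma weyl_XX_commute: "weyl_X i (weyl_X j u) = weyl_X j (weyl_X i u)"
  by (simp add: weyl_X_def algebra_simps)

lemma weyl_YY_commute: "weyl_Y i (weyl_Y j u) = weyl_Y j (weyl_Y i u)"
  unfolding weyl_Y_def
proof (rule additive_eqI[where F = "\<lambda>u. partial_deriv i (partial_deriv j u)"])
  fix m :: "'a \<Rightarrow>\<^sub>0 nat" and b :: 'b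
  have "m - Poly_Mapping.single j 1 - Poly_Mapping.single i 1 =
    m - Poly_Mapping.single i 1 - Poly_Mapping.single j 1"
    by (intro poly_mapping_eqI) (simp add: lookup_minus)
  then show "partial_deriv i (partial_deriv j (Poly_Mapping.single m b)) =
           partial_deriv j (partial_deriv i (Poly_Mapping.single m b))"
    by (cases "i = j") (auto simp: partial_deriv_single lookup_minus lookup_single_not_eq algebra_simps)
qed (simp_all add: partial_deriv_add)

lemma weyl_X_add: "weyl_X i (u + v) = weyl_X i u + weyl_X i v"
  and weyl_Y_add: "weyl_Y i (u + v) = weyl_Y i u + weyl_Y i v"
  and weyl_X_const: "weyl_X i (const_poly c * u) = const_poly c * weyl_X i u"
  and weyl_Y_const: "weyl_Y i (const_poly c * u) = const_poly c * weyl_Y i u"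
  by (simp_all add: weyl_X_def weyl_Y_def partial_deriv_add partial_deriv_const distrib_left mult.left_commute)

text \<open>Supplies the one ring axiom that fails for arbitrary maps under composition:
  distributivity over a sum in the inner argument.\<close>

lemma weyl_carrier_additive: "a \<in> weyl_carrier \<Longrightarrow> a (u + v) = a u + a v"
  by (induction a arbitrary: u v rule: weyl_carrier.induct)
    (simp_all add: weyl_X_add weyl_Y_add algebra_simps)

lemma weyl_zero_closed: "(\<lambda>_. 0) \<in> weyl_carrier"
  using weyl_carrier.scale[OF weyl_carrier.one, of 0] by (simp add: const_poly_arith)

lemma weyl_scalar_closed: "weyl_scalar c \<in> weyl_carrier"
  using weyl_carrier.scale[OF weyl_carrier.one, of c] by (simp add: weyl_scalar_def)

lemma weyl_algebra_simps [simp]: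
  "carrier weyl_algebra = weyl_carrier"
  "a \<otimes>\<^bsub>weyl_algebra\<^esub> b = a \<circ> b"
  "\<one>\<^bsub>weyl_algebra\<^esub> = id"
  "\<zero>\<^bsub>weyl_algebra\<^esub> = (\<lambda>_. 0)"
  "a \<oplus>\<^bsub>weyl_algebra\<^esub> b = (\<lambda>u. a u + b u)"
  by (simp_all add: weyl_algebra_def)

lemma ring_weyl_algebra: "ring (weyl_algebra :: (('i,'k::comm_ring_1) polys \<Rightarrow> ('i,'k) polys) ring)"
proof (rule ringI)
  show "abelian_group (weyl_algebra :: (('i,'k) polys \<Rightarrow> ('i,'k) polys) ring)"
  proof (rule abelian_groupI)
    fix a :: "('i,'k) polys \<Rightarrow> ('i,'k) polys" assume "a \<in> carrier weyl_algebra"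
    then have "(\<lambda>u. const_poly (-1) * a u) \<in> weyl_carrier" by (auto intro: weyl_carrier.scale)
    moreover have "const_poly (-1) * v + v = 0" for v :: "('i,'k) polys"
      by (intro poly_mapping_eqI) (simp add: lookup_add)
    ultimately show "\<exists>y\<in>carrier weyl_algebra. y \<oplus>\<^bsub>weyl_algebra\<^esub> a = \<zero>\<^bsub>weyl_algebra\<^esub>"
      by (intro bexI[of _ "\<lambda>u. const_poly (-1) * a u"]) auto
  qed (auto intro: weyl_carrier.intros weyl_zero_closed simp: algebra_simps)
  show "Group.monoid (weyl_algebra :: (('i,'k) polys \<Rightarrow> ('i,'k) polys) ring)"
    by (rule monoidI) (auto intro: weyl_carrier.intros simp: comp_assoc)
qed (auto simp: fun_eq_iff weyl_carrier_additive)

section \<open>Normal forms in the Weyl algebra\<close>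

lemma scalar_ring_simps [simp]:
  "carrier scalar_ring = UNIV"
  "a \<otimes>\<^bsub>scalar_ring\<^esub> b = a * b"
  "\<one>\<^bsub>scalar_ring\<^esub> = 1"
  "\<zero>\<^bsub>scalar_ring\<^esub> = 0"
  "a \<oplus>\<^bsub>scalar_ring\<^esub> b = a + b"
  by (simp_all add: scalar_ring_def)

lemma cring_scalar_ring: "cring (scalar_ring :: 'k::field ring)"
proof (rule cringI)
  show "abelian_group (scalar_ring :: 'k ring)"
    by (rule abelian_groupI) (auto simp: algebra_simps intro: exI[of _ "- x" for x])
  show "Group.comm_monoid (scalar_ring :: 'k ring)"
    by (rule Group.comm_monoidI) (auto simp: algebra_simps)
qed (auto simp: algebra_simps)

text \<open>Commuting operators may be applied in any order; the proof finds the head of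
  \<open>l\<close> inside \<open>l'\<close> and commutes it past the letters before it. The set
  \<open>A\<close> is there because the operators of a module commute only on its carrier.\<close>

lemma foldr_cong_mset:
  assumes closed: "\<And>i f. f \<in> A \<Longrightarrow> h i f \<in> A"
    and comm: "\<And>i j f. f \<in> A \<Longrightarrow> h i (h j f) = h j (h i f)"
    and "mset l = mset l'" and "f \<in> A"
  shows "foldr h l f = foldr h l' f"
  using assms(3)
proof (induction l arbitrary: l')
  case Nil
  then show ?case by simp
next
  case (Cons a l)
  have cl: "foldr h l f \<in> A" for l by (induction l) (auto simp: closed assms(4))
  from Cons.prems have "a \<in> set l'" by (metis list.set_intros(1) mset_eq_setD)
  then obtain u w where l': "l' = u @ a # w" by (meson split_list)
  with Cons.prems have "mset l = mset (u @ w)" by simp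
  from Cons.IH[OF this] have IH: "foldr h l f = foldr h (u @ w) f" .
  have "foldr h u (h a g) = h a (foldr h u g)" if "g \<in> A" for g
    using that
  proof (induction u)
    case (Cons b u)
    have "foldr h u g \<in> A" using \<open>g \<in> A\<close> by (induction u) (auto simp: closed)
    then show ?case using Cons comm by simp
  qed simp
  then show ?case using IH cl by (simp add: l')
qed

text \<open>A word spelling a multi-index. Its order is an arbitrary choice, harmless because the
  word is only fed to pairwise commuting operators.\<close>

definition exponent_list :: "('i \<Rightarrow>\<^sub>0 nat) \<Rightarrow> 'i list" where
  "exponent_list \<alpha> = (SOME l. \<forall>i. count (mset l) i = Poly_Mapping.lookup \<alpha> i)"

lemma count_exponent_list [simp]:
  "count (mset (exponent_list \<alpha>)) i = Poly_Mapping.lookup \<alpha> i"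
proof -
  have "finite {i. 0 < Poly_Mapping.lookup \<alpha> i}" by simp
  then have "count (Abs_multiset (Poly_Mapping.lookup \<alpha>)) = Poly_Mapping.lookup \<alpha>"
    by (rule count_Abs_multiset)
  moreover obtain l where "mset l = Abs_multiset (Poly_Mapping.lookup \<alpha>)"
    using ex_mset by blast
  ultimately have "\<exists>l. \<forall>i. count (mset l) i = Poly_Mapping.lookup \<alpha> i" by metis
  then show ?thesis unfolding exponent_list_def by (rule someI2_ex) simp
qed

lemma exponent_list_0 [simp]: "exponent_list 0 = []"
proof -
  have "mset (exponent_list (0 :: 'a \<Rightarrow>\<^sub>0 nat)) = {#}" by (intro multiset_eqI) simp
  then show ?thesis by simp
qed

text \<open>Normal ordering, with all \<open>y\<close> applied before all \<open>x\<close>. The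
  families are parameters so that the same monomial can be formed on polynomials and in any space on
  which the generators act.\<close>

definition ordered_monomial ::
  "('i \<Rightarrow> 'm \<Rightarrow> 'm) \<Rightarrow> ('i \<Rightarrow> 'm \<Rightarrow> 'm) \<Rightarrow> ('i \<Rightarrow>\<^sub>0 nat) \<Rightarrow> ('i \<Rightarrow>\<^sub>0 nat) \<Rightarrow> 'm \<Rightarrow> 'm" where
  "ordered_monomial x y \<alpha> \<beta> f = foldr x (exponent_list \<alpha>) (foldr y (exponent_list \<beta>) f)"

text \<open>Operators satisfying the Weyl relations, with no algebra acting yet. The instances are
  the polynomials, the generators acting on a Weyl module, and the direct sum built from a path
  module.\<close>

locale weyl_rep = Module.module scalar_ring M for M :: "('k::field, 'm) module" +
  fixes x y :: "'i \<Rightarrow> 'm \<Rightarrow> 'm"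
  assumes x_closed: "f \<in> carrier M \<Longrightarrow> x i f \<in> carrier M"
    and y_closed: "f \<in> carrier M \<Longrightarrow> y i f \<in> carrier M"
    and x_add: "\<lbrakk>f \<in> carrier M; g \<in> carrier M\<rbrakk> \<Longrightarrow> x i (f \<oplus>\<^bsub>M\<^esub> g) = x i f \<oplus>\<^bsub>M\<^esub> x i g"
    and y_add: "\<lbrakk>f \<in> carrier M; g \<in> carrier M\<rbrakk> \<Longrightarrow> y i (f \<oplus>\<^bsub>M\<^esub> g) = y i f \<oplus>\<^bsub>M\<^esub> y i g"
    and x_smult: "f \<in> carrier M \<Longrightarrow> x i (c \<odot>\<^bsub>M\<^esub> f) = c \<odot>\<^bsub>M\<^esub> x i f"
    and y_smult: "f \<in> carrier M \<Longrightarrow> y i (c \<odot>\<^bsub>M\<^esub> f) = c \<odot>\<^bsub>M\<^esub> y i f"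
    and xx: "f \<in> carrier M \<Longrightarrow> x i (x j f) = x j (x i f)"
    and yy: "f \<in> carrier M \<Longrightarrow> y i (y j f) = y j (y i f)"
    and xy: "\<lbrakk>f \<in> carrier M; i \<noteq> j\<rbrakk> \<Longrightarrow> x i (y j f) = y j (x i f)"
    and yx: "f \<in> carrier M \<Longrightarrow> y i (x i f) = x i (y i f) \<oplus>\<^bsub>M\<^esub> f"
begin

abbreviation mon where "mon \<equiv> ordered_monomial x y"

lemma smult_closed' [simp]: "f \<in> carrier M \<Longrightarrow> c \<odot>\<^bsub>M\<^esub> f \<in> carrier M"
  by (rule smult_closed) simp_all

lemma smult_0_left: "f \<in> carrier M \<Longrightarrow> 0 \<odot>\<^bsub>M\<^esub> f = \<zero>\<^bsub>M\<^esub>"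
  using smult_l_null by simp

lemma smult_0_right: "c \<odot>\<^bsub>M\<^esub> \<zero>\<^bsub>M\<^esub> = \<zero>\<^bsub>M\<^esub>"
  using smult_r_null by simp

lemma smult_add_left: "f \<in> carrier M \<Longrightarrow> (a + b) \<odot>\<^bsub>M\<^esub> f = a \<odot>\<^bsub>M\<^esub> f \<oplus>\<^bsub>M\<^esub> b \<odot>\<^bsub>M\<^esub> f"
  using smult_l_distr[of a b] by simp

lemma smult_add_right: "\<lbrakk>f \<in> carrier M; g \<in> carrier M\<rbrakk> \<Longrightarrow> a \<odot>\<^bsub>M\<^esub> (f \<oplus>\<^bsub>M\<^esub> g) = a \<odot>\<^bsub>M\<^esub> f \<oplus>\<^bsub>M\<^esub> a \<odot>\<^bsub>M\<^esub> g"
  using smult_r_distr[of a] by simp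

lemma smult_smult: "f \<in> carrier M \<Longrightarrow> a \<odot>\<^bsub>M\<^esub> (b \<odot>\<^bsub>M\<^esub> f) = (a * b) \<odot>\<^bsub>M\<^esub> f"
  using smult_assoc1[of a b] by simp

lemma smult_1: "f \<in> carrier M \<Longrightarrow> 1 \<odot>\<^bsub>M\<^esub> f = f"
  using smult_one by simp

lemma foldr_x_closed: "f \<in> carrier M \<Longrightarrow> foldr x l f \<in> carrier M"
  by (induction l) (auto simp: x_closed)

lemma foldr_y_closed: "f \<in> carrier M \<Longrightarrow> foldr y l f \<in> carrier M"
  by (induction l) (auto simp: y_closed)

lemma mon_closed [simp]: "f \<in> carrier M \<Longrightarrow> mon \<alpha> \<beta> f \<in> carrier M"
  by (simp add: ordered_monomial_def foldr_x_closed foldr_y_closed)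

lemma foldr_x_mset: "f \<in> carrier M \<Longrightarrow> mset l = mset l' \<Longrightarrow> foldr x l f = foldr x l' f"
  by (rule foldr_cong_mset[where A = "carrier M"]) (auto simp: x_closed xx)

lemma foldr_y_mset: "f \<in> carrier M \<Longrightarrow> mset l = mset l' \<Longrightarrow> foldr y l f = foldr y l' f"
  by (rule foldr_cong_mset[where A = "carrier M"]) (auto simp: y_closed yy)

lemma mon_0_0: "mon 0 0 f = f"
  by (simp add: ordered_monomial_def)

lemma x_mon:
  assumes "f \<in> carrier M"
  shows "x i (mon \<alpha> \<beta> f) = mon (\<alpha> + Poly_Mapping.single i 1) \<beta> f"
proof -
  have "mset (i # exponent_list \<alpha>) = mset (exponent_list (\<alpha> + Poly_Mapping.single i 1))"
    by (intro multiset_eqI) (simp add: lookup_add lookup_single when_def)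
  from foldr_x_mset[OF foldr_y_closed this, OF assms] show ?thesis
    by (simp add: ordered_monomial_def)
qed

text \<open>Leibniz rule: moving \<open>y i\<close> past the word \<open>l\<close> leaves, for each
  occurrence of \<open>i\<close>, one copy of the word with that letter deleted. Since the
  \<open>x\<close> commute, all these copies agree.\<close>

lemma y_foldr_x:
  assumes "g \<in> carrier M"
  shows "y i (foldr x l g) =
    foldr x l (y i g) \<oplus>\<^bsub>M\<^esub> of_nat (count (mset l) i) \<odot>\<^bsub>M\<^esub> foldr x (remove1 i l) g"
proof (induction l)
  case Nil
  then show ?case using assms by (simp add: y_closed smult_0_left)
next
  case (Cons a l)
  show ?case
  proof (cases "a = i")
    case False
    then show ?thesis using Cons assms
      by (simp add: xy[symmetric] x_add x_smult foldr_x_closed y_closed)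
  next
    case True
    \<comment> \<open>Multiplying by the deleted letter restores the word if the letter occurs; if
      it does not, the coefficient is 0 and both sides vanish.\<close>
    have *: "of_nat (count (mset l) i) \<odot>\<^bsub>M\<^esub> x i (foldr x (remove1 i l) g)
      = of_nat (count (mset l) i) \<odot>\<^bsub>M\<^esub> foldr x l g"
    proof (cases "i \<in> set l")
      case True
      then have "mset (i # remove1 i l) = mset l" by simp
      from foldr_x_mset[OF assms this] show ?thesis by simp
    next
      case False
      then have "count (mset l) i = 0" by (simp add: count_eq_zero_iff)
      then have "of_nat (count (mset l) i) = (0 :: 'k)" by (metis of_nat_0)
      then show ?thesis using assms by (simp add: smult_0_left foldr_x_closed x_closed del: of_nat_eq_0_iff)
    qed
    have "y i (foldr x (a # l) g) = x i (y i (foldr x l g)) \<oplus>\<^bsub>M\<^esub> foldr x l g"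
      using True assms by (simp add: yx foldr_x_closed)
    also have "\<dots> = (x i (foldr x l (y i g)) \<oplus>\<^bsub>M\<^esub> of_nat (count (mset l) i) \<odot>\<^bsub>M\<^esub> foldr x l g) \<oplus>\<^bsub>M\<^esub> foldr x l g"
      using assms by (simp add: Cons x_add x_smult foldr_x_closed y_closed *)
    also have "\<dots> = x i (foldr x l (y i g)) \<oplus>\<^bsub>M\<^esub> (of_nat (count (mset l) i) + 1) \<odot>\<^bsub>M\<^esub> foldr x l g"
      using assms by (simp only: smult_add_left smult_1 foldr_x_closed)
        (simp add: foldr_x_closed x_closed y_closed M.a_assoc)
    finally show ?thesis using True by (simp add: add.commute)
  qed
qed

text \<open>With \<open>x_mon\<close> this shows that left multiplication by a generator keeps
  combinations of ordered monomials, so no other products ever arise.\<close>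

lemma y_mon:
  assumes "f \<in> carrier M"
  shows "y i (mon \<alpha> \<beta> f) = mon \<alpha> (\<beta> + Poly_Mapping.single i 1) f
    \<oplus>\<^bsub>M\<^esub> of_nat (Poly_Mapping.lookup \<alpha> i) \<odot>\<^bsub>M\<^esub> mon (\<alpha> - Poly_Mapping.single i 1) \<beta> f"
proof -
  have "mset (i # exponent_list \<beta>) = mset (exponent_list (\<beta> + Poly_Mapping.single i 1))"
    by (intro multiset_eqI) (simp add: lookup_add lookup_single when_def)
  from foldr_y_mset[OF _ this, OF assms]
  have 1: "y i (foldr y (exponent_list \<beta>) f) = foldr y (exponent_list (\<beta> + Poly_Mapping.single i 1)) f"
    by simp
  have "mset (remove1 i (exponent_list \<alpha>)) = mset (exponent_list (\<alpha> - Poly_Mapping.single i 1))"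
    by (intro multiset_eqI) (simp add: lookup_minus lookup_single when_def)
  from foldr_x_mset[OF foldr_y_closed this, OF assms]
  show ?thesis
    using y_foldr_x[OF foldr_y_closed, OF assms]
    by (simp add: ordered_monomial_def 1)
qed

end

section \<open>Linear independence of the ordered monomials on polynomials\<close>

definition poly_module :: "('k::field, ('i, 'k) polys) module" where
  "poly_module = \<lparr>carrier = UNIV, monoid.mult = (*), one = 1, ring.zero = 0, add = (+),
     module.smult = (\<lambda>c u. const_poly c * u)\<rparr>"

lemma poly_module_simps [simp]:
  "carrier poly_module = UNIV" "\<zero>\<^bsub>poly_module\<^esub> = 0"
  "u \<oplus>\<^bsub>poly_module\<^esub> v = u + v" "c \<odot>\<^bsub>poly_module\<^esub> u = const_poly c * u"
  by (simp_all add: poly_module_def)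

lemma weyl_rep_polys: "weyl_rep (poly_module :: ('k::field, ('i, 'k) polys) module) weyl_X weyl_Y"
proof -
  have "Module.module scalar_ring (poly_module :: ('k::field, ('i, 'k) polys) module)"
  proof (rule moduleI[OF cring_scalar_ring])
    have "\<exists>v. v + u = 0" for u :: "('i,'k) polys" by (rule exI[of _ "-u"]) simp
    then show "abelian_group (poly_module :: ('k::field, ('i, 'k) polys) module)"
      by (intro abelian_groupI) (auto simp: algebra_simps)
  qed (auto simp: const_poly_arith algebra_simps)
  then show ?thesis
    by (intro weyl_rep.intro weyl_rep_axioms.intro)
      (auto simp: weyl_X_add weyl_Y_add weyl_X_const weyl_Y_const weyl_YX
        weyl_XX_commute weyl_YY_commute weyl_XY_commute)
qed

text \<open>The coefficient is a product of falling factorials; in characteristic zero it vanishes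
  only if some variable is differentiated more often than its exponent permits.\<close>

lemma foldr_weyl_Y_single:
  "\<exists>c m'. foldr weyl_Y l (Poly_Mapping.single m 1 :: ('i,'k::field_char_0) polys) = Poly_Mapping.single m' c \<and>
    (c \<noteq> 0 \<longleftrightarrow> (\<forall>i. count (mset l) i \<le> Poly_Mapping.lookup m i)) \<and>
    (c \<noteq> 0 \<longrightarrow> (\<forall>i. Poly_Mapping.lookup m' i = Poly_Mapping.lookup m i - count (mset l) i))"
proof (induction l)
  case Nil
  then show ?case by (intro exI[of _ 1] exI[of _ m]) simp
next
  case (Cons a l)
  then obtain c m' where IH: "foldr weyl_Y l (Poly_Mapping.single m 1 :: ('i,'k) polys) = Poly_Mapping.single m' c"
    "(c \<noteq> 0 \<longleftrightarrow> (\<forall>i. count (mset l) i \<le> Poly_Mapping.lookup m i))"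
    "(c \<noteq> 0 \<longrightarrow> (\<forall>i. Poly_Mapping.lookup m' i = Poly_Mapping.lookup m i - count (mset l) i))" by blast
  let ?c = "of_nat (Poly_Mapping.lookup m' a) * c"
  have "?c \<noteq> 0 \<longleftrightarrow> c \<noteq> 0 \<and> count (mset l) a < Poly_Mapping.lookup m a"
    using IH(3) by auto
  also have "\<dots> \<longleftrightarrow> (\<forall>i. count (mset (a # l)) i \<le> Poly_Mapping.lookup m i)"
  proof -
    have "(\<forall>i. count (mset (a # l)) i \<le> Poly_Mapping.lookup m i) \<longleftrightarrow>
      (\<forall>i. count (mset l) i \<le> Poly_Mapping.lookup m i \<and> (i = a \<longrightarrow> count (mset l) a < Poly_Mapping.lookup m a))"
      by (rule iff_allI) auto
    then show ?thesis unfolding IH(2) by blast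
  qed
  finally have "?c \<noteq> 0 \<longleftrightarrow> (\<forall>i. count (mset (a # l)) i \<le> Poly_Mapping.lookup m i)" .
  moreover have "foldr weyl_Y (a # l) (Poly_Mapping.single m 1 :: ('i,'k) polys) =
      Poly_Mapping.single (m' - Poly_Mapping.single a 1) ?c"
    using IH(1) by (simp add: weyl_Y_def partial_deriv_single)
  moreover have "\<forall>i. Poly_Mapping.lookup (m' - Poly_Mapping.single a 1) i =
      Poly_Mapping.lookup m i - count (mset (a # l)) i" if "?c \<noteq> 0"
    using that IH(3) by (simp add: lookup_minus lookup_single when_def)
  ultimately show ?case by blast
qed

lemma weyl_X_single: "weyl_X i (Poly_Mapping.single m c) = Poly_Mapping.single (m + Poly_Mapping.single i 1) c"
  by (simp add: weyl_X_def var_poly_times_single)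

lemma foldr_weyl_X_single:
  "\<exists>m'. foldr weyl_X l (Poly_Mapping.single m c :: ('i,'k::comm_ring_1) polys) = Poly_Mapping.single m' c \<and>
     (\<forall>i. Poly_Mapping.lookup m' i = Poly_Mapping.lookup m i + count (mset l) i)"
proof (induction l)
  case (Cons a l)
  then obtain m' where IH: "foldr weyl_X l (Poly_Mapping.single m c :: ('i,'k) polys) = Poly_Mapping.single m' c"
     "\<forall>i. Poly_Mapping.lookup m' i = Poly_Mapping.lookup m i + count (mset l) i" by blast
  then show ?case
    by (intro exI[of _ "m' + Poly_Mapping.single a 1"])
      (auto simp: weyl_X_single lookup_add lookup_single when_def)
qed auto

text \<open>
  Evaluating at \<open>x\<^sup>\<beta>\<close> with \<open>\<beta>\<close> of least degree kills all other derivatives occurring in the sum.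
\<close>

lemma ordered_monomials_independent:
  fixes w :: "(('i \<Rightarrow>\<^sub>0 nat) \<times> ('i \<Rightarrow>\<^sub>0 nat)) \<Rightarrow>\<^sub>0 'k::field_char_0"
  assumes "\<And>u. (\<Sum>k\<in>Poly_Mapping.keys w. const_poly (Poly_Mapping.lookup w k) *
      ordered_monomial weyl_X weyl_Y (fst k) (snd k) u) = 0"
  shows "w = 0"
proof (rule ccontr)
  assume "w \<noteq> 0"
  then have "Poly_Mapping.keys w \<noteq> {}" by simp
  then obtain k where k: "k \<in> Poly_Mapping.keys w"
    and min: "\<And>k'. k' \<in> Poly_Mapping.keys w \<Longrightarrow>
      length (exponent_list (snd k)) \<le> length (exponent_list (snd k'))"
    using ex_has_least_nat[of "\<lambda>k. k \<in> Poly_Mapping.keys w" _ "\<lambda>k. length (exponent_list (snd k))"] by blast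
  obtain \<alpha> \<beta> where ab: "k = (\<alpha>, \<beta>)" by fastforce
  define T where "T k' = (const_poly (Poly_Mapping.lookup w k') *
      ordered_monomial weyl_X weyl_Y (fst k') (snd k') (Poly_Mapping.single \<beta> 1))" for k'
  have val: "\<exists>c. (c \<noteq> 0 \<longleftrightarrow> snd k' = \<beta>) \<and> T k' = Poly_Mapping.single (fst k') c"
    if k': "k' \<in> Poly_Mapping.keys w" for k'
  proof -
    obtain \<alpha>' \<beta>' where ab': "k' = (\<alpha>', \<beta>')" by fastforce
    from foldr_weyl_Y_single[of "exponent_list \<beta>'" \<beta>, where 'k = 'k]
    obtain c m' where Y: "foldr weyl_Y (exponent_list \<beta>') (Poly_Mapping.single \<beta> 1 :: ('i,'k) polys) = Poly_Mapping.single m' c"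
      and c: "c \<noteq> 0 \<longleftrightarrow> (\<forall>i. Poly_Mapping.lookup \<beta>' i \<le> Poly_Mapping.lookup \<beta> i)"
      and m': "c \<noteq> 0 \<longrightarrow> (\<forall>i. Poly_Mapping.lookup m' i = Poly_Mapping.lookup \<beta> i - Poly_Mapping.lookup \<beta>' i)"
      by auto
    from foldr_weyl_X_single[of "exponent_list \<alpha>'" m' c]
    obtain m'' where X: "foldr weyl_X (exponent_list \<alpha>') (Poly_Mapping.single m' c :: ('i,'k) polys) = Poly_Mapping.single m'' c"
      and m'': "\<forall>i. Poly_Mapping.lookup m'' i = Poly_Mapping.lookup m' i + Poly_Mapping.lookup \<alpha>' i"
      by auto
    \<comment> \<open>Nonvanishing forces \<open>\<beta>'\<close> below \<open>\<beta>\<close> in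
      every coordinate, while the degree of \<open>\<beta>\<close> is least; hence they
      agree.\<close>
    have eq: "\<beta>' = \<beta>" if "c \<noteq> 0"
    proof -
      from that c have "mset (exponent_list \<beta>') \<subseteq># mset (exponent_list \<beta>)"
        by (simp add: subseteq_mset_def)
      moreover have "size (mset (exponent_list \<beta>)) \<le> size (mset (exponent_list \<beta>'))"
        using min[OF k'] by (simp add: ab ab')
      ultimately have "mset (exponent_list \<beta>') = mset (exponent_list \<beta>)"
        by (metis mset_subset_size not_le subset_mset.le_imp_less_or_eq)
      then show ?thesis by (metis count_exponent_list poly_mapping_eqI)
    qed
    then have cb: "c \<noteq> 0 \<longleftrightarrow> \<beta>' = \<beta>" using c by auto
    have "Poly_Mapping.single m'' c = Poly_Mapping.single \<alpha>' c"
    proof (cases "c = 0")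
      case False
      with m' m'' eq have "m'' = \<alpha>'" by (intro poly_mapping_eqI) auto
      then show ?thesis by simp
    qed simp
    then have "T k' = Poly_Mapping.single \<alpha>' (Poly_Mapping.lookup w k' * c)"
      by (simp add: T_def ab' ordered_monomial_def X Y)
    moreover have "Poly_Mapping.lookup w k' * c \<noteq> 0 \<longleftrightarrow> \<beta>' = \<beta>"
      using cb k' by (auto simp: in_keys_iff)
    ultimately show ?thesis using ab' by (intro exI[of _ "Poly_Mapping.lookup w k' * c"]) auto
  qed
  have "0 = Poly_Mapping.lookup (\<Sum>k'\<in>Poly_Mapping.keys w. T k') \<alpha>"
    using assms[of "Poly_Mapping.single \<beta> 1"] by (simp add: T_def)
  also have "\<dots> = (\<Sum>k'\<in>Poly_Mapping.keys w. Poly_Mapping.lookup (T k') \<alpha>)"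
    by (rule lookup_sum)
  \<comment> \<open>Any other key that survives has second entry \<open>\<beta>\<close>, hence a
    first entry different from \<open>\<alpha>\<close>, and contributes nothing at the exponent
    \<open>\<alpha>\<close>.\<close>
  also have "\<dots> = (\<Sum>k'\<in>{k}. Poly_Mapping.lookup (T k') \<alpha>)"
  proof (rule sum.mono_neutral_right)
    show "\<forall>k'\<in>Poly_Mapping.keys w - {k}. Poly_Mapping.lookup (T k') \<alpha> = 0"
    proof
      fix k' assume "k' \<in> Poly_Mapping.keys w - {k}"
      with val[of k'] show "Poly_Mapping.lookup (T k') \<alpha> = 0"
        by (cases k') (auto simp: ab lookup_single when_def)
    qed
  qed (use k in auto)
  also have "\<dots> \<noteq> 0" using val[OF k] by (auto simp: ab)
  finally show False by simp
qed

text \<open>Elements of the algebra are operators without a recorded expression, so an assignment on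
  the generators extends at first only to a relation: \<open>T\<close> arises from some way of
  writing \<open>a\<close>. That \<open>a\<close> determines \<open>T\<close> on the carrier is
  proved afterwards through normal forms.\<close>

inductive weyl_related ::
  "('k::field, 'm) module \<Rightarrow> ('i \<Rightarrow> 'm \<Rightarrow> 'm) \<Rightarrow> ('i \<Rightarrow> 'm \<Rightarrow> 'm)
    \<Rightarrow> (('i, 'k) polys \<Rightarrow> ('i, 'k) polys) \<Rightarrow> ('m \<Rightarrow> 'm) \<Rightarrow> bool"
  for M x y where
  X: "weyl_related M x y (weyl_X i) (x i)"
| Y: "weyl_related M x y (weyl_Y i) (y i)"
| one: "weyl_related M x y id id"
| add: "weyl_related M x y a T \<Longrightarrow> weyl_related M x y b S \<Longrightarrow>
    weyl_related M x y (\<lambda>u. a u + b u) (\<lambda>f. T f \<oplus>\<^bsub>M\<^esub> S f)"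
| scale: "weyl_related M x y a T \<Longrightarrow> weyl_related M x y (\<lambda>u. const_poly c * a u) (\<lambda>f. c \<odot>\<^bsub>M\<^esub> T f)"
| comp: "weyl_related M x y a T \<Longrightarrow> weyl_related M x y b S \<Longrightarrow> weyl_related M x y (a \<circ> b) (T \<circ> S)"

lemma weyl_related_carrier: "weyl_related M x y a T \<Longrightarrow> a \<in> weyl_carrier"
  by (induction rule: weyl_related.induct) (blast intro: weyl_carrier.intros)+

lemma weyl_related_total: "a \<in> weyl_carrier \<Longrightarrow> \<exists>T. weyl_related M x y a T"
  by (induction rule: weyl_carrier.induct) (blast intro: weyl_related.intros)+

text \<open>The same linear combination of ordered monomials is carried along on polynomials and in
  the representation. On the module side only the values on the carrier are prescribed.\<close>

inductive normal_form ::
  "('k::field, 'm) module \<Rightarrow> ('i \<Rightarrow> 'm \<Rightarrow> 'm) \<Rightarrow> ('i \<Rightarrow> 'm \<Rightarrow> 'm)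
    \<Rightarrow> (('i, 'k) polys \<Rightarrow> ('i, 'k) polys) \<Rightarrow> ('m \<Rightarrow> 'm) \<Rightarrow> bool"
  for M x y where
  zero: "(\<And>f. f \<in> carrier M \<Longrightarrow> T f = \<zero>\<^bsub>M\<^esub>) \<Longrightarrow> normal_form M x y (\<lambda>_. 0) T"
| step: "normal_form M x y a T \<Longrightarrow>
    (\<And>f. f \<in> carrier M \<Longrightarrow> T' f = T f \<oplus>\<^bsub>M\<^esub> c \<odot>\<^bsub>M\<^esub> ordered_monomial x y \<alpha> \<beta> f) \<Longrightarrow>
    normal_form M x y (\<lambda>u. a u + const_poly c * ordered_monomial weyl_X weyl_Y \<alpha> \<beta> u) T'"

context weyl_rep
begin

interpretation P: weyl_rep "poly_module :: ('k, ('i, 'k) polys) module" weyl_X weyl_Y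
  by (rule weyl_rep_polys)

lemma weyl_related_closed:
  "weyl_related M x y a T \<Longrightarrow> f \<in> carrier M \<Longrightarrow> T f \<in> carrier M"
  by (induction arbitrary: f rule: weyl_related.induct) (auto simp: x_closed y_closed)

lemma normal_form_closed: "normal_form M x y a T \<Longrightarrow> f \<in> carrier M \<Longrightarrow> T f \<in> carrier M"
  by (induction arbitrary: f rule: normal_form.induct) auto

lemma normal_form_cong:
  "normal_form M x y a T \<Longrightarrow> (\<And>f. f \<in> carrier M \<Longrightarrow> T' f = T f) \<Longrightarrow> normal_form M x y a T'"
  by (erule normal_form.cases) (auto intro!: normal_form.intros)

lemma normal_form_add:
  assumes "normal_form M x y b S" and "normal_form M x y a T"
  shows "normal_form M x y (\<lambda>u. a u + b u) (\<lambda>f. T f \<oplus>\<^bsub>M\<^esub> S f)"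
  using assms
proof (induction rule: normal_form.induct)
  case (zero S)
  then show ?case by (auto intro!: normal_form_cong[of a T] simp: normal_form_closed)
next
  case (step b S S' c \<alpha> \<beta>)
  have "normal_form M x y (\<lambda>u. (a u + b u) + const_poly c * ordered_monomial weyl_X weyl_Y \<alpha> \<beta> u)
      (\<lambda>f. T f \<oplus>\<^bsub>M\<^esub> S' f)"
    by (rule normal_form.step[where T = "\<lambda>f. T f \<oplus>\<^bsub>M\<^esub> S f"])
      (use step normal_form_closed in \<open>auto simp: M.a_assoc\<close>)
  then show ?case by (simp add: add.assoc)
qed

lemma normal_form_scale:
  assumes "normal_form M x y a T"
  shows "normal_form M x y (\<lambda>u. const_poly d * a u) (\<lambda>f. d \<odot>\<^bsub>M\<^esub> T f)"
  using assms
proof (induction rule: normal_form.induct)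
  case (zero S)
  then show ?case by (auto intro!: normal_form.zero simp: smult_0_right)
next
  case (step b S S' c \<alpha> \<beta>)
  have "normal_form M x y (\<lambda>u. const_poly d * b u + const_poly (d * c) * ordered_monomial weyl_X weyl_Y \<alpha> \<beta> u)
      (\<lambda>f. d \<odot>\<^bsub>M\<^esub> S' f)"
    by (rule normal_form.step)
      (use step normal_form_closed in \<open>auto simp: smult_add_right smult_smult\<close>)
  then show ?case by (simp add: const_poly_arith algebra_simps)
qed

lemma normal_form_mon: "normal_form M x y (P.mon \<alpha> \<beta>) (mon \<alpha> \<beta>)"
  using normal_form.step[OF normal_form.zero, of M "\<lambda>_. \<zero>\<^bsub>M\<^esub>" "mon \<alpha> \<beta>" 1 x y \<alpha> \<beta>]
  by (simp add: smult_1 const_poly_arith)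

lemma normal_form_x:
  assumes "normal_form M x y a T"
  shows "normal_form M x y (weyl_X i \<circ> a) (x i \<circ> T)"
  using assms
proof (induction rule: normal_form.induct)
  case (zero S)
  have "x i \<zero>\<^bsub>M\<^esub> = \<zero>\<^bsub>M\<^esub>" using x_smult[of "\<zero>\<^bsub>M\<^esub>" i 0] by (simp add: smult_0_left x_closed)
  moreover have "weyl_X i (0 :: ('i,'k) polys) = 0" by (simp add: weyl_X_def)
  ultimately show ?case using zero by (auto intro!: normal_form.zero simp: o_def)
next
  case (step b S S' c \<alpha> \<beta>)
  have "normal_form M x y (\<lambda>u. (weyl_X i \<circ> b) u +
      const_poly c * ordered_monomial weyl_X weyl_Y (\<alpha> + Poly_Mapping.single i 1) \<beta> u) (x i \<circ> S')"
    by (rule normal_form.step[OF step.IH])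
      (use step normal_form_closed in \<open>auto simp: x_add x_smult x_mon\<close>)
  then show ?case using P.x_mon by (simp add: o_def weyl_X_add weyl_X_const)
qed

lemma normal_form_y:
  assumes "normal_form M x y a T"
  shows "normal_form M x y (weyl_Y i \<circ> a) (y i \<circ> T)"
  using assms
proof (induction rule: normal_form.induct)
  case (zero S)
  have "y i \<zero>\<^bsub>M\<^esub> = \<zero>\<^bsub>M\<^esub>" using y_smult[of "\<zero>\<^bsub>M\<^esub>" i 0] by (simp add: smult_0_left y_closed)
  moreover have "weyl_Y i (0 :: ('i,'k) polys) = 0" by (simp add: weyl_Y_def partial_deriv_def)
  ultimately show ?case using zero by (auto intro!: normal_form.zero simp: o_def)
next
  case (step b S S' c \<alpha> \<beta>)
  let ?n = "of_nat (Poly_Mapping.lookup \<alpha> i) :: 'k"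
  let ?\<alpha> = "\<alpha> - Poly_Mapping.single i 1" and ?\<beta> = "\<beta> + Poly_Mapping.single i 1"
  have "normal_form M x y (\<lambda>u. (weyl_Y i \<circ> b) u + const_poly c * (P.mon \<alpha> ?\<beta> u + const_poly ?n * P.mon ?\<alpha> \<beta> u))
    (\<lambda>f. (y i \<circ> S) f \<oplus>\<^bsub>M\<^esub> c \<odot>\<^bsub>M\<^esub> (mon \<alpha> ?\<beta> f \<oplus>\<^bsub>M\<^esub> ?n \<odot>\<^bsub>M\<^esub> mon ?\<alpha> \<beta> f))"
    by (intro normal_form_add normal_form_scale normal_form_mon step.IH)
  then have *: "normal_form M x y (\<lambda>u. weyl_Y i (b u) + const_poly c * weyl_Y i (P.mon \<alpha> \<beta> u))
    (\<lambda>f. (y i \<circ> S) f \<oplus>\<^bsub>M\<^esub> c \<odot>\<^bsub>M\<^esub> (mon \<alpha> ?\<beta> f \<oplus>\<^bsub>M\<^esub> ?n \<odot>\<^bsub>M\<^esub> mon ?\<alpha> \<beta> f))"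
    using P.y_mon by simp
  have "normal_form M x y (\<lambda>u. weyl_Y i (b u) + const_poly c * weyl_Y i (P.mon \<alpha> \<beta> u)) (y i \<circ> S')"
    by (rule normal_form_cong[OF *])
      (use step normal_form_closed y_mon in \<open>auto simp: y_add y_smult\<close>)
  then show ?case by (simp add: o_def weyl_Y_add weyl_Y_const)
qed

text \<open>Formulated for left multiplication of an arbitrary normal form, so that a composition is
  treated by using the induction hypotheses one after the other and a product of two general
  monomials is never expanded.\<close>

lemma weyl_related_normal_form_comp:
  "weyl_related M x y a T \<Longrightarrow> normal_form M x y b S \<Longrightarrow> normal_form M x y (a \<circ> b) (T \<circ> S)"
proof (induction arbitrary: b S rule: weyl_related.induct)
  case (add a T a' T')
  from normal_form_add[OF add.IH(2) add.IH(1), OF add.prems add.prems]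
  show ?case by (simp add: o_def)
next
  case (scale a T c)
  from normal_form_scale[OF scale.IH, OF scale.prems, of c]
  show ?case by (simp add: o_def)
next
  case (comp a T a' T')
  from comp.IH(1)[OF comp.IH(2)[OF comp.prems]]
  show ?case by (simp add: comp_assoc)
qed (auto intro: normal_form_x normal_form_y)

lemma weyl_related_normal_form:
  assumes "weyl_related M x y a T"
  shows "normal_form M x y a T"
proof -
  have "P.mon 0 0 = id" "mon 0 0 = id" by (auto simp: mon_0_0 P.mon_0_0)
  with normal_form_mon[of 0 0] have "normal_form M x y id id" by simp
  from weyl_related_normal_form_comp[OF assms this] show ?thesis by simp
qed

text \<open>Collects a normal form into a finitely supported coefficient function, so that two
  normal forms of one element can be subtracted.\<close>

definition combine :: "((('i \<Rightarrow>\<^sub>0 nat) \<times> ('i \<Rightarrow>\<^sub>0 nat)) \<Rightarrow>\<^sub>0 'k) \<Rightarrow> 'm \<Rightarrow> 'm" where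
  "combine w f = (\<Oplus>\<^bsub>M\<^esub>k\<in>Poly_Mapping.keys w. Poly_Mapping.lookup w k \<odot>\<^bsub>M\<^esub> mon (fst k) (snd k) f)"

lemma combine_superset:
  assumes "finite S" "Poly_Mapping.keys w \<subseteq> S" "f \<in> carrier M"
  shows "combine w f = (\<Oplus>\<^bsub>M\<^esub>k\<in>S. Poly_Mapping.lookup w k \<odot>\<^bsub>M\<^esub> mon (fst k) (snd k) f)"
  unfolding combine_def
  by (rule M.add.finprod_mono_neutral_cong_left) (use assms in \<open>auto simp: in_keys_iff smult_0_left\<close>)

lemma combine_add:
  assumes "f \<in> carrier M"
  shows "combine (w + w') f = combine w f \<oplus>\<^bsub>M\<^esub> combine w' f"
proof -
  let ?S = "Poly_Mapping.keys w \<union> Poly_Mapping.keys w'"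
  have "Poly_Mapping.keys (w + w') \<subseteq> ?S" by (rule Poly_Mapping.keys_add)
  then show ?thesis using assms
    by (simp add: combine_superset[of ?S] lookup_add smult_add_left M.finsum_addf Pi_def)
qed

lemma combine_single:
  assumes "f \<in> carrier M"
  shows "combine (Poly_Mapping.single k c) f = c \<odot>\<^bsub>M\<^esub> mon (fst k) (snd k) f"
  using assms by (subst combine_superset[of "{k}"]) auto

end

context weyl_rep
begin

interpretation P: weyl_rep "poly_module :: ('k, ('i, 'k) polys) module" weyl_X weyl_Y
  by (rule weyl_rep_polys)

lemma normal_form_combine:
  "normal_form M x y a T \<Longrightarrow> \<exists>w. a = P.combine w \<and> (\<forall>f\<in>carrier M. T f = combine w f)"
proof (induction rule: normal_form.induct)
  case (zero T)
  then show ?case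
    by (intro exI[of _ 0]) (auto simp: combine_def P.combine_def)
next
  case (step a T T' c \<alpha> \<beta>)
  then obtain w where w: "a = P.combine w" "\<forall>f\<in>carrier M. T f = combine w f" by blast
  then show ?case
    by (intro exI[of _ "w + Poly_Mapping.single (\<alpha>, \<beta>) c"])
      (use step in \<open>auto simp: combine_add combine_single P.combine_add P.combine_single\<close>)
qed

lemma combine_polys: "P.combine w u = (\<Sum>k\<in>Poly_Mapping.keys w. const_poly (Poly_Mapping.lookup w k) *
      ordered_monomial weyl_X weyl_Y (fst k) (snd k) u)"
proof -
  have "finsum poly_module g S = sum g S" if "finite S"
    for g :: "('i \<Rightarrow>\<^sub>0 nat) \<times> ('i \<Rightarrow>\<^sub>0 nat) \<Rightarrow> ('i,'k) polys" and S
    using that by (induction S) auto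
  then show ?thesis by (simp add: P.combine_def)
qed

end

locale weyl_rep_char_0 = weyl_rep M x y
  for M :: "('k::field_char_0, 'm) module" and x y :: "'i \<Rightarrow> 'm \<Rightarrow> 'm"
begin

interpretation P: weyl_rep "poly_module :: ('k, ('i, 'k) polys) module" weyl_X weyl_Y
  by (rule weyl_rep_polys)

text \<open>Both images are given by coefficient functions \<open>w\<close> and \<open>v\<close>
  which define the same operator on polynomials; independence of the ordered monomials yields
  \<open>w = v\<close>.\<close>

lemma weyl_related_unique:
  assumes "weyl_related M x y a T" and "weyl_related M x y a S" and "f \<in> carrier M"
  shows "T f = S f"
proof -
  obtain w where w: "a = P.combine w" "\<forall>f\<in>carrier M. T f = combine w f"
    using normal_form_combine[OF weyl_related_normal_form[OF assms(1)]] by blast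
  obtain v where v: "a = P.combine v" "\<forall>f\<in>carrier M. S f = combine v f"
    using normal_form_combine[OF weyl_related_normal_form[OF assms(2)]] by blast
  have "P.combine (w - v) u = 0" for u
  proof -
    have "P.combine w u = P.combine (w - v) u + P.combine v u"
      using P.combine_add[of u "w - v" v] by simp
    then show ?thesis using w v by simp
  qed
  then have "w - v = 0"
    by (intro ordered_monomials_independent) (simp add: combine_polys)
  then show ?thesis using w v assms(3) by simp
qed

text \<open>Any related operator will do: one exists for every element of the algebra, and all of
  them agree on the carrier.\<close>

definition act :: "(('i, 'k) polys \<Rightarrow> ('i, 'k) polys) \<Rightarrow> 'm \<Rightarrow> 'm" where
  "act a = (SOME T. weyl_related M x y a T)"

lemma act_related: "a \<in> weyl_carrier \<Longrightarrow> weyl_related M x y a (act a)"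
  unfolding act_def using weyl_related_total by (rule someI_ex)

lemma act_eq: "weyl_related M x y a T \<Longrightarrow> f \<in> carrier M \<Longrightarrow> act a f = T f"
  using weyl_related_unique act_related weyl_related_carrier by blast

lemma act_closed: "a \<in> weyl_carrier \<Longrightarrow> f \<in> carrier M \<Longrightarrow> act a f \<in> carrier M"
  using act_related weyl_related_closed by blast

lemma act_add: "\<lbrakk>a \<in> weyl_carrier; b \<in> weyl_carrier; f \<in> carrier M\<rbrakk>
  \<Longrightarrow> act (\<lambda>u. a u + b u) f = act a f \<oplus>\<^bsub>M\<^esub> act b f"
  by (rule act_eq[OF weyl_related.add[OF act_related act_related]])

lemma act_comp: "\<lbrakk>a \<in> weyl_carrier; b \<in> weyl_carrier; f \<in> carrier M\<rbrakk>
  \<Longrightarrow> act (a \<circ> b) f = act a (act b f)"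
  using act_eq[OF weyl_related.comp[OF act_related act_related]] by simp

lemma weyl_related_additive:
  "weyl_related M x y a T \<Longrightarrow> f \<in> carrier M \<Longrightarrow> g \<in> carrier M \<Longrightarrow> T (f \<oplus>\<^bsub>M\<^esub> g) = T f \<oplus>\<^bsub>M\<^esub> T g"
proof (induction arbitrary: f g rule: weyl_related.induct)
  case (add a T b S)
  then show ?case using M.add.m_ac by (simp add: weyl_related_closed)
qed (auto simp: x_add y_add smult_add_right weyl_related_closed)

lemma act_X: "f \<in> carrier M \<Longrightarrow> act (weyl_X i) f = x i f"
  and act_Y: "f \<in> carrier M \<Longrightarrow> act (weyl_Y i) f = y i f"
  and act_id: "f \<in> carrier M \<Longrightarrow> act id f = f"
  using act_eq[OF weyl_related.X] act_eq[OF weyl_related.Y] act_eq[OF weyl_related.one] by auto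

lemma act_scalar: "f \<in> carrier M \<Longrightarrow> act (weyl_scalar c) f = c \<odot>\<^bsub>M\<^esub> f"
  using act_eq[OF weyl_related.scale[OF weyl_related.one]] by (simp add: weyl_scalar_def)

definition weyl_module :: "('i, 'k, 'm) weyl_module" where
  "weyl_module = \<lparr>carrier = carrier M, monoid.mult = monoid.mult M, one = one M, ring.zero = ring.zero M, add = add M,
     module.smult = act\<rparr>"

lemma weyl_module_simps [simp]:
  "carrier weyl_module = carrier M" "\<zero>\<^bsub>weyl_module\<^esub> = \<zero>\<^bsub>M\<^esub>"
  "f \<oplus>\<^bsub>weyl_module\<^esub> g = f \<oplus>\<^bsub>M\<^esub> g" "a \<odot>\<^bsub>weyl_module\<^esub> f = act a f"
  by (simp_all add: weyl_module_def)

lemma left_module_weyl_module: "left_module weyl_algebra weyl_module"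
proof (intro left_module.intro left_module_axioms.intro ring_weyl_algebra)
  show "abelian_group weyl_module"
    by (rule abelian_groupI) (auto simp: M.add.m_ac intro: M.l_neg M.a_inv_closed)
qed (auto simp: act_closed act_add act_comp act_id weyl_related_additive[OF act_related])

end

section \<open>Walls and shifts between weight spaces\<close>

text \<open>Each side is the product of \<open>g\<close> over the elements lying in at least two of
  the three sets, every element counted once.\<close>

lemma prod_Int_cocycle:
  assumes "finite A" "finite B" "finite C"
  shows "prod g (A \<inter> B) * prod g (sym_diff A B \<inter> C) = prod g (B \<inter> C) * prod g (A \<inter> sym_diff B C)"
proof -
  have "prod g (A \<inter> B) = prod g (A \<inter> B \<inter> C) * prod g (A \<inter> B - C)"
    "prod g (B \<inter> C) = prod g (A \<inter> B \<inter> C) * prod g (B \<inter> C - A)"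
    "prod g (sym_diff A B \<inter> C) = prod g (A \<inter> C - B) * prod g (B \<inter> C - A)"
    "prod g (A \<inter> sym_diff B C) = prod g (A \<inter> B - C) * prod g (A \<inter> C - B)"
    using assms by (subst prod.union_disjoint[symmetric]; auto intro!: arg_cong[where f = "prod g"])+
  then show ?thesis by (simp add: ac_simps)
qed

text \<open>
  The pair \<open>(i, n)\<close> stands for the wall between the values \<open>n\<close> and \<open>n + 1\<close> of the \<open>i\<close>-th coordinate;
  crossing it and returning multiplies a weight vector by \<open>wall_weight p (i, n)\<close>.
\<close>

definition walls :: "('i \<Rightarrow>\<^sub>0 int) \<Rightarrow> ('i \<Rightarrow>\<^sub>0 int) \<Rightarrow> ('i \<times> int) set" where
  "walls v w = {(i, n). n < Poly_Mapping.lookup v i \<longleftrightarrow> \<not> n < Poly_Mapping.lookup w i}"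

text \<open>Origin of the \<open>+ 1\<close>: since \<open>Y X = X Y + 1\<close>, going up from
  coordinate \<open>n\<close> and back multiplies by \<open>p i + n + 1\<close>. Going down from
  \<open>n + 1\<close> and back is \<open>X Y\<close> at the weight \<open>p i + (n + 1)\<close>,
  the same scalar.\<close>

definition wall_weight :: "('i \<Rightarrow> 'k::ring_1) \<Rightarrow> 'i \<times> int \<Rightarrow> 'k" where
  "wall_weight p e = p (fst e) + of_int (snd e) + 1"

definition backtrack :: "('i \<Rightarrow> 'k::comm_ring_1) \<Rightarrow> ('i \<Rightarrow>\<^sub>0 int) \<Rightarrow> ('i \<Rightarrow>\<^sub>0 int) \<Rightarrow> ('i \<Rightarrow>\<^sub>0 int) \<Rightarrow> 'k" where
  "backtrack p u v w = prod (wall_weight p) (walls u v \<inter> walls v w)"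

lemma finite_walls: "finite (walls v w)"
proof -
  have "walls v w \<subseteq> Sigma (Poly_Mapping.keys v \<union> Poly_Mapping.keys w)
    (\<lambda>i. {min (Poly_Mapping.lookup v i) (Poly_Mapping.lookup w i)..max (Poly_Mapping.lookup v i) (Poly_Mapping.lookup w i)})"
    by (auto simp: walls_def in_keys_iff)
  then show ?thesis by (rule finite_subset) (auto intro!: finite_SigmaI)
qed

lemma walls_same [simp]: "walls v v = {}"
  by (auto simp: walls_def)

lemma walls_commute: "walls v w = walls w v"
  by (auto simp: walls_def)

lemma walls_sym_diff: "walls u w = sym_diff (walls u v) (walls v w)"
  by (auto simp: walls_def)

lemma walls_plus: "walls w (w + Poly_Mapping.single i 1) = {(i, Poly_Mapping.lookup w i)}"
  by (auto simp: walls_def lookup_add lookup_single when_def split: if_splits)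

lemma walls_minus: "walls w (w - Poly_Mapping.single i 1) = {(i, Poly_Mapping.lookup w i - 1)}"
  by (auto simp: walls_def lookup_minus lookup_single when_def split: if_splits)

text \<open>The 2-cocycle identity that associativity of three successive shifts demands, derived
  from walls alone: each side collects the walls crossed by at least two of the three legs.\<close>

lemma backtrack_cocycle:
  "backtrack p a b c * backtrack p a c d = backtrack p b c d * backtrack p a b d"
  unfolding backtrack_def walls_sym_diff[of a c b] walls_sym_diff[of b d c]
  by (rule prod_Int_cocycle) (rule finite_walls)+

lemma backtrack_same [simp]: "backtrack p v v w = 1" "backtrack p v w w = 1"
  by (simp_all add: backtrack_def)

lemma backtrack_disjoint: "walls u v \<inter> walls v w = {} \<Longrightarrow> backtrack p u v w = 1"
  by (simp add: backtrack_def)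

lemma backtrack_swap: "backtrack p v w v = backtrack p w v w"
  using backtrack_cocycle[of p v w v w] by simp

lemma backtrack_plus:
  "backtrack p v w (w + Poly_Mapping.single i 1) =
    (if Poly_Mapping.lookup w i < Poly_Mapping.lookup v i then p i + of_int (Poly_Mapping.lookup w i) + 1 else 1)"
proof -
  have "walls v w \<inter> walls w (w + Poly_Mapping.single i 1) =
     (if Poly_Mapping.lookup w i < Poly_Mapping.lookup v i then {(i, Poly_Mapping.lookup w i)} else {})"
    unfolding walls_plus by (auto simp: walls_def)
  then show ?thesis by (simp add: backtrack_def wall_weight_def)
qed

lemma backtrack_minus:
  "backtrack p v w (w - Poly_Mapping.single i 1) =
    (if Poly_Mapping.lookup v i < Poly_Mapping.lookup w i then p i + of_int (Poly_Mapping.lookup w i) else 1)"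
proof -
  have "walls v w \<inter> walls w (w - Poly_Mapping.single i 1) =
     (if Poly_Mapping.lookup v i < Poly_Mapping.lookup w i then {(i, Poly_Mapping.lookup w i - 1)} else {})"
    unfolding walls_minus by (auto simp: walls_def)
  then show ?thesis by (simp add: backtrack_def wall_weight_def)
qed

text \<open>Every weight is reached from \<open>v\<close> by unit steps that never recross a wall.
  On such steps \<open>backtrack\<close> is 1, so identities for shifts can be proved one generator
  at a time.\<close>

lemma monotone_path_induct [case_names base plus minus]:
  assumes base: "P v"
    and plus: "\<And>w i. P w \<Longrightarrow> walls v w \<inter> walls w (w + Poly_Mapping.single i 1) = {} \<Longrightarrow>
      P (w + Poly_Mapping.single i 1)"
    and minus: "\<And>w i. P w \<Longrightarrow> walls v w \<inter> walls w (w - Poly_Mapping.single i 1) = {} \<Longrightarrow>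
      P (w - Poly_Mapping.single i 1)"
  shows "P w"
proof (induction "card (walls v w)" arbitrary: w rule: less_induct)
  case less
  show ?case
  proof (cases "w = v")
    case True
    then show ?thesis using base by simp
  next
    case False
    then obtain i where i: "Poly_Mapping.lookup w i \<noteq> Poly_Mapping.lookup v i"
      by (metis poly_mapping_eqI)
    \<comment> \<open>One unit step from \<open>w\<close> towards \<open>v\<close> in a coordinate
      where they differ; it removes exactly one separating wall, which the step from
      \<open>u\<close> back to \<open>w\<close> then crosses anew.\<close>
    define u where "u = (if Poly_Mapping.lookup v i < Poly_Mapping.lookup w i
      then w - Poly_Mapping.single i 1 else w + Poly_Mapping.single i 1)"
    obtain e where e: "walls w u = {e}" "e \<in> walls v w"
    proof (cases "Poly_Mapping.lookup v i < Poly_Mapping.lookup w i")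
      case True
      then show ?thesis
        by (intro that[of "(i, Poly_Mapping.lookup w i - 1)"]) (simp_all add: u_def walls_minus, simp add: walls_def)
    next
      case False
      with i show ?thesis
        by (intro that[of "(i, Poly_Mapping.lookup w i)"]) (simp_all add: u_def walls_plus, simp add: walls_def)
    qed
    then have vu: "walls v u = walls v w - {e}" and sub: "walls v u \<inter> walls u w = {}"
      unfolding walls_sym_diff[of v u w] walls_commute[of u w] by auto
    have "walls v u \<subset> walls v w" using vu e by blast
    then have "P u" by (intro less psubset_card_mono finite_walls)
    with sub plus[of u i] minus[of u i] show ?thesis
      by (auto simp: u_def split: if_splits)
  qed
qed

context weyl_rep
begin

lemma mon_add: "\<lbrakk>f \<in> carrier M; g \<in> carrier M\<rbrakk> \<Longrightarrow> mon \<alpha> \<beta> (f \<oplus>\<^bsub>M\<^esub> g) = mon \<alpha> \<beta> f \<oplus>\<^bsub>M\<^esub> mon \<alpha> \<beta> g"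
proof -
  have y: "foldr y l (f \<oplus>\<^bsub>M\<^esub> g) = foldr y l f \<oplus>\<^bsub>M\<^esub> foldr y l g" if "f \<in> carrier M" "g \<in> carrier M" for l f g
    using that by (induction l) (auto simp: y_add foldr_y_closed)
  have x: "foldr x l (f \<oplus>\<^bsub>M\<^esub> g) = foldr x l f \<oplus>\<^bsub>M\<^esub> foldr x l g" if "f \<in> carrier M" "g \<in> carrier M" for l f g
    using that by (induction l) (auto simp: x_add foldr_x_closed)
  show "\<lbrakk>f \<in> carrier M; g \<in> carrier M\<rbrakk> \<Longrightarrow> mon \<alpha> \<beta> (f \<oplus>\<^bsub>M\<^esub> g) = mon \<alpha> \<beta> f \<oplus>\<^bsub>M\<^esub> mon \<alpha> \<beta> g"
    by (simp add: ordered_monomial_def x y foldr_y_closed)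
qed

lemma mon_smult: "f \<in> carrier M \<Longrightarrow> mon \<alpha> \<beta> (c \<odot>\<^bsub>M\<^esub> f) = c \<odot>\<^bsub>M\<^esub> mon \<alpha> \<beta> f"
proof -
  have y: "foldr y l (c \<odot>\<^bsub>M\<^esub> f) = c \<odot>\<^bsub>M\<^esub> foldr y l f" if "f \<in> carrier M" for l f
    using that by (induction l) (auto simp: y_smult foldr_y_closed)
  have x: "foldr x l (c \<odot>\<^bsub>M\<^esub> f) = c \<odot>\<^bsub>M\<^esub> foldr x l f" if "f \<in> carrier M" for l f
    using that by (induction l) (auto simp: x_smult foldr_x_closed)
  show "f \<in> carrier M \<Longrightarrow> mon \<alpha> \<beta> (c \<odot>\<^bsub>M\<^esub> f) = c \<odot>\<^bsub>M\<^esub> mon \<alpha> \<beta> f"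
    by (simp add: ordered_monomial_def x y foldr_y_closed)
qed

end

text \<open>The field acts through the multiples of the identity in the Weyl algebra; forgetting the
  rest gives the vector space that \<open>weyl_rep\<close> expects.\<close>

definition scalars :: "('i, 'k::field, 'm) weyl_module \<Rightarrow> ('k, 'm) module" where
  "scalars M = \<lparr>carrier = carrier M, monoid.mult = monoid.mult M, one = one M, ring.zero = ring.zero M, add = add M,
     module.smult = (\<lambda>c f. weyl_scalar c \<odot>\<^bsub>M\<^esub> f)\<rparr>"

lemma scalars_simps [simp]:
  "carrier (scalars M) = carrier M" "\<zero>\<^bsub>scalars M\<^esub> = \<zero>\<^bsub>M\<^esub>" "f \<oplus>\<^bsub>scalars M\<^esub> g = f \<oplus>\<^bsub>M\<^esub> g"
  by (simp_all add: scalars_def)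

lemma smult_scalars: "c \<odot>\<^bsub>scalars M\<^esub> f = weyl_scalar c \<odot>\<^bsub>M\<^esub> f"
  by (simp add: scalars_def)

lemma weyl_scalar_arith:
  "weyl_scalar (a + b) = (\<lambda>u. weyl_scalar a u + weyl_scalar b u)"
  "weyl_scalar (a * b) = weyl_scalar a \<circ> weyl_scalar b"
  "weyl_scalar 1 = id"
  "weyl_scalar c \<circ> weyl_X i = weyl_X i \<circ> weyl_scalar c"
  "weyl_scalar c \<circ> weyl_Y i = weyl_Y i \<circ> weyl_scalar c"
  by (auto simp: weyl_scalar_def const_poly_arith distrib_right mult.assoc weyl_X_const weyl_Y_const)

lemma add_monoid_cong:
  assumes "abelian_group M" and "carrier N = carrier M" and "add N = add M" and "ring.zero N = ring.zero M"
  shows "abelian_group N"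
proof (rule abelian_groupI)
  fix x y z assume *: "x \<in> carrier N" "y \<in> carrier N" "z \<in> carrier N"
  show "x \<oplus>\<^bsub>N\<^esub> y \<oplus>\<^bsub>N\<^esub> z = x \<oplus>\<^bsub>N\<^esub> (y \<oplus>\<^bsub>N\<^esub> z)"
    using * assms abelian_groupE(3)[OF assms(1)] by simp
qed (use assms abelian_groupE[OF assms(1)] in auto)

section \<open>Weight vectors under the generators and the shifts\<close>

locale weyl_left_module = left_module weyl_algebra M for M :: "('i, 'k::field_char_0, 'm) weyl_module"
begin

lemma smult_comp:
  "\<lbrakk>a \<in> weyl_carrier; b \<in> weyl_carrier; f \<in> carrier M\<rbrakk> \<Longrightarrow> a \<odot>\<^bsub>M\<^esub> (b \<odot>\<^bsub>M\<^esub> f) = (a \<circ> b) \<odot>\<^bsub>M\<^esub> f"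
  using smult_assoc[of a b f] by simp

lemma smult_sum:
  "\<lbrakk>a \<in> weyl_carrier; b \<in> weyl_carrier; f \<in> carrier M\<rbrakk> \<Longrightarrow> (\<lambda>u. a u + b u) \<odot>\<^bsub>M\<^esub> f = a \<odot>\<^bsub>M\<^esub> f \<oplus>\<^bsub>M\<^esub> b \<odot>\<^bsub>M\<^esub> f"
  using smult_l_distr[of a b f] by simp

sublocale rep: weyl_rep "scalars M" "\<lambda>i f. weyl_X i \<odot>\<^bsub>M\<^esub> f" "\<lambda>i f. weyl_Y i \<odot>\<^bsub>M\<^esub> f"
proof -
  note cl = weyl_carrier.intros weyl_scalar_closed
  have mod: "Module.module scalar_ring (scalars M)"
  proof (rule moduleI[OF cring_scalar_ring])
    show "abelian_group (scalars M)"
      by (rule add_monoid_cong[of M]) (auto simp: scalars_def M.abelian_group_axioms)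
  qed (use smult_one in \<open>auto simp: smult_scalars weyl_scalar_arith smult_sum smult_comp cl
        intro!: smult_closed smult_r_distr\<close>)
  have eqs: "weyl_X i \<circ> weyl_X j = weyl_X j \<circ> weyl_X i"
     "weyl_Y i \<circ> weyl_Y j = weyl_Y j \<circ> weyl_Y i"
     "i \<noteq> j \<Longrightarrow> weyl_X i \<circ> weyl_Y j = weyl_Y j \<circ> weyl_X i"
     "weyl_Y i \<circ> weyl_X i = (\<lambda>u. (weyl_X i \<circ> weyl_Y i) u + id u)"
     for i j :: 'i
    by (auto simp: weyl_XX_commute weyl_YY_commute weyl_XY_commute weyl_YX)
  moreover have "weyl_X i \<odot>\<^bsub>M\<^esub> (weyl_X j \<odot>\<^bsub>M\<^esub> f) = weyl_X j \<odot>\<^bsub>M\<^esub> (weyl_X i \<odot>\<^bsub>M\<^esub> f)"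
     "weyl_Y i \<odot>\<^bsub>M\<^esub> (weyl_Y j \<odot>\<^bsub>M\<^esub> f) = weyl_Y j \<odot>\<^bsub>M\<^esub> (weyl_Y i \<odot>\<^bsub>M\<^esub> f)"
     "i \<noteq> j \<Longrightarrow> weyl_X i \<odot>\<^bsub>M\<^esub> (weyl_Y j \<odot>\<^bsub>M\<^esub> f) = weyl_Y j \<odot>\<^bsub>M\<^esub> (weyl_X i \<odot>\<^bsub>M\<^esub> f)"
     "weyl_Y i \<odot>\<^bsub>M\<^esub> (weyl_X i \<odot>\<^bsub>M\<^esub> f) = weyl_X i \<odot>\<^bsub>M\<^esub> (weyl_Y i \<odot>\<^bsub>M\<^esub> f) \<oplus>\<^bsub>M\<^esub> id \<odot>\<^bsub>M\<^esub> f"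
     if "f \<in> carrier M" for i j f
    using that by (simp_all only: smult_comp smult_sum cl eqs(1)[of i j] eqs(2)[of i j] eqs(3)[of i j] eqs(4) not_False_eq_True)
  moreover have "weyl_X i \<odot>\<^bsub>M\<^esub> (weyl_scalar c \<odot>\<^bsub>M\<^esub> f) = weyl_scalar c \<odot>\<^bsub>M\<^esub> (weyl_X i \<odot>\<^bsub>M\<^esub> f)"
     "weyl_Y i \<odot>\<^bsub>M\<^esub> (weyl_scalar c \<odot>\<^bsub>M\<^esub> f) = weyl_scalar c \<odot>\<^bsub>M\<^esub> (weyl_Y i \<odot>\<^bsub>M\<^esub> f)"
     if "f \<in> carrier M" for i c f
    using that by (simp_all only: smult_comp cl weyl_scalar_arith)
  moreover have "id \<odot>\<^bsub>M\<^esub> f = f" if "f \<in> carrier M" for f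
    using smult_one[OF that] by simp
  ultimately show "weyl_rep (scalars M) (\<lambda>i f. weyl_X i \<odot>\<^bsub>M\<^esub> f) (\<lambda>i f. weyl_Y i \<odot>\<^bsub>M\<^esub> f)"
    by (intro weyl_rep.intro weyl_rep_axioms.intro mod)
      (auto intro!: smult_closed smult_r_distr simp: cl smult_scalars)
qed

abbreviation mon where
  "mon \<equiv> ordered_monomial (\<lambda>i f. weyl_X i \<odot>\<^bsub>M\<^esub> f) (\<lambda>i f. weyl_Y i \<odot>\<^bsub>M\<^esub> f)"

lemma X_closed [simp]: "f \<in> carrier M \<Longrightarrow> weyl_X i \<odot>\<^bsub>M\<^esub> f \<in> carrier M"
  and Y_closed [simp]: "f \<in> carrier M \<Longrightarrow> weyl_Y i \<odot>\<^bsub>M\<^esub> f \<in> carrier M"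
  using rep.x_closed rep.y_closed by auto

lemma weight_space_iff: "f \<in> weight_space M q \<longleftrightarrow>
  f \<in> carrier M \<and> (\<forall>i. weyl_X i \<odot>\<^bsub>M\<^esub> (weyl_Y i \<odot>\<^bsub>M\<^esub> f) = q i \<odot>\<^bsub>scalars M\<^esub> f)"
  by (auto simp: weight_space_def smult_scalars weyl_t_def smult_comp weyl_carrier.intros)

lemma weight_space_closed: "f \<in> weight_space M q \<Longrightarrow> f \<in> carrier M"
  by (simp add: weight_space_iff)

lemma XY_weight: "f \<in> weight_space M q \<Longrightarrow> weyl_X i \<odot>\<^bsub>M\<^esub> (weyl_Y i \<odot>\<^bsub>M\<^esub> f) = q i \<odot>\<^bsub>scalars M\<^esub> f"
  by (simp add: weight_space_iff)

lemma YX_weight: "f \<in> weight_space M q \<Longrightarrow> weyl_Y i \<odot>\<^bsub>M\<^esub> (weyl_X i \<odot>\<^bsub>M\<^esub> f) = (q i + 1) \<odot>\<^bsub>scalars M\<^esub> f"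
  using rep.yx[of f i] by (simp add: XY_weight weight_space_closed rep.smult_add_left rep.smult_1[simplified])

lemma weight_space_zero: "\<zero>\<^bsub>M\<^esub> \<in> weight_space M q"
  using rep.x_smult[of "\<zero>\<^bsub>M\<^esub>" _ 0] rep.y_smult[of "\<zero>\<^bsub>M\<^esub>" _ 0] rep.smult_0_right rep.smult_0_left
  by (simp add: weight_space_iff)

lemma weight_space_add:
  "\<lbrakk>f \<in> weight_space M q; g \<in> weight_space M q\<rbrakk> \<Longrightarrow> f \<oplus>\<^bsub>M\<^esub> g \<in> weight_space M q"
  using rep.x_add rep.y_add rep.smult_add_right by (auto simp: weight_space_iff)

lemma weight_space_smult: "f \<in> weight_space M q \<Longrightarrow> c \<odot>\<^bsub>scalars M\<^esub> f \<in> weight_space M q"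
  using rep.x_smult rep.y_smult rep.smult_smult rep.smult_closed'
  by (auto simp: weight_space_iff mult.commute)

lemma X_weight:
  assumes f: "f \<in> weight_space M q"
  shows "weyl_X i \<odot>\<^bsub>M\<^esub> f \<in> weight_space M (q(i := q i + 1))"
  unfolding weight_space_iff
proof (intro conjI allI)
  fix j
  show "weyl_X j \<odot>\<^bsub>M\<^esub> (weyl_Y j \<odot>\<^bsub>M\<^esub> (weyl_X i \<odot>\<^bsub>M\<^esub> f)) =
    (q(i := q i + 1)) j \<odot>\<^bsub>scalars M\<^esub> (weyl_X i \<odot>\<^bsub>M\<^esub> f)"
  proof (cases "j = i")
    case True
    then show ?thesis using f rep.x_smult by (simp add: YX_weight weight_space_closed)
  next
    case False
    then have "weyl_X j \<odot>\<^bsub>M\<^esub> (weyl_Y j \<odot>\<^bsub>M\<^esub> (weyl_X i \<odot>\<^bsub>M\<^esub> f)) = weyl_X i \<odot>\<^bsub>M\<^esub> (weyl_X j \<odot>\<^bsub>M\<^esub> (weyl_Y j \<odot>\<^bsub>M\<^esub> f))"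
      using rep.xy[of f i j] rep.xx[of "weyl_Y j \<odot>\<^bsub>M\<^esub> f" i j] f by (simp add: weight_space_closed)
    then show ?thesis using f rep.x_smult False by (simp add: XY_weight weight_space_closed)
  qed
qed (use f in \<open>simp add: weight_space_closed\<close>)

lemma Y_weight:
  assumes f: "f \<in> weight_space M q"
  shows "weyl_Y i \<odot>\<^bsub>M\<^esub> f \<in> weight_space M (q(i := q i - 1))"
  unfolding weight_space_iff
proof (intro conjI allI)
  fix j
  let ?g = "weyl_Y i \<odot>\<^bsub>M\<^esub> f"
  have g: "?g \<in> carrier M" using f by (simp add: weight_space_closed)
  show "weyl_X j \<odot>\<^bsub>M\<^esub> (weyl_Y j \<odot>\<^bsub>M\<^esub> ?g) = (q(i := q i - 1)) j \<odot>\<^bsub>scalars M\<^esub> ?g"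
  proof (cases "j = i")
    case True
    \<comment> \<open>The Weyl relation gives \<open>X Y\<close> on \<open>Y f\<close> only after
      \<open>Y f\<close> has been added. Comparing with \<open>Y\<close> applied to
      \<open>X Y f\<close> and cancelling lowers the eigenvalue by one.\<close>
    have "weyl_X i \<odot>\<^bsub>M\<^esub> (weyl_Y i \<odot>\<^bsub>M\<^esub> ?g) \<oplus>\<^bsub>M\<^esub> ?g = q i \<odot>\<^bsub>scalars M\<^esub> ?g"
      using rep.yx[of ?g i] g rep.y_smult[of f] f by (simp add: XY_weight weight_space_closed)
    also have "\<dots> = (q i - 1) \<odot>\<^bsub>scalars M\<^esub> ?g \<oplus>\<^bsub>M\<^esub> ?g"
      using rep.smult_add_left[of ?g "q i - 1" 1] rep.smult_1[of ?g] g by simp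
    finally show ?thesis using g rep.smult_closed' True by (simp add: M.add.right_cancel)
  next
    case False
    then have "weyl_X j \<odot>\<^bsub>M\<^esub> (weyl_Y j \<odot>\<^bsub>M\<^esub> ?g) = weyl_Y i \<odot>\<^bsub>M\<^esub> (weyl_X j \<odot>\<^bsub>M\<^esub> (weyl_Y j \<odot>\<^bsub>M\<^esub> f))"
      using rep.yy[of f i j] rep.xy[of "weyl_Y j \<odot>\<^bsub>M\<^esub> f" j i] f by (simp add: weight_space_closed)
    then show ?thesis using f rep.y_smult False by (simp add: XY_weight weight_space_closed)
  qed
qed (use f in \<open>simp add: weight_space_closed\<close>)

lemma mon_weight:
  assumes f: "f \<in> weight_space M q"
  shows "mon \<alpha> \<beta> f \<in> weight_space M
    (\<lambda>j. q j + of_nat (Poly_Mapping.lookup \<alpha> j) - of_nat (Poly_Mapping.lookup \<beta> j))"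
proof -
  have y: "foldr (\<lambda>i f. weyl_Y i \<odot>\<^bsub>M\<^esub> f) l f \<in> weight_space M (\<lambda>j. q j - of_nat (count (mset l) j))" for l
  proof (induction l)
    case (Cons a l)
    have eq: "(\<lambda>j. q j - of_nat (count (mset l) j))(a := q a - of_nat (count (mset l) a) - 1) =
      (\<lambda>j. q j - of_nat (count (mset (a # l)) j))" by (auto simp: fun_eq_iff)
    show ?case using Y_weight[OF Cons, of a] unfolding eq by simp
  qed (use f in simp)
  have x: "foldr (\<lambda>i f. weyl_X i \<odot>\<^bsub>M\<^esub> f) l g \<in> weight_space M (\<lambda>j. q' j + of_nat (count (mset l) j))"
    if g: "g \<in> weight_space M q'" for l g q'
  proof (induction l)
    case (Cons a l)
    have eq: "(\<lambda>j. q' j + of_nat (count (mset l) j))(a := q' a + of_nat (count (mset l) a) + 1) =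
      (\<lambda>j. q' j + of_nat (count (mset (a # l)) j))" by (auto simp: fun_eq_iff)
    show ?case using X_weight[OF Cons, of a] unfolding eq by simp
  qed (use g in simp)
  from x[OF y, of "exponent_list \<alpha>" "exponent_list \<beta>"] show ?thesis
    by (simp add: ordered_monomial_def algebra_simps)
qed

end

definition pos_part :: "('i \<Rightarrow>\<^sub>0 int) \<Rightarrow> ('i \<Rightarrow>\<^sub>0 nat)" where
  "pos_part d = Poly_Mapping.map nat d"

lemma lookup_pos_part [simp]: "Poly_Mapping.lookup (pos_part d) i = nat (Poly_Mapping.lookup d i)"
  by (simp add: pos_part_def Poly_Mapping.map.rep_eq when_def)

text \<open>In each coordinate only one of \<open>X\<close> and \<open>Y\<close> occurs, so all
  factors commute and the monomial is a shortest route from \<open>v\<close> to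
  \<open>w\<close>.\<close>

definition shift :: "('i, 'k::field_char_0, 'm) weyl_module \<Rightarrow> ('i \<Rightarrow>\<^sub>0 int) \<Rightarrow> ('i \<Rightarrow>\<^sub>0 int) \<Rightarrow> 'm \<Rightarrow> 'm" where
  "shift M v w = ordered_monomial (\<lambda>i f. weyl_X i \<odot>\<^bsub>M\<^esub> f) (\<lambda>i f. weyl_Y i \<odot>\<^bsub>M\<^esub> f)
     (pos_part (w - v)) (pos_part (v - w))"

definition weight :: "('i \<Rightarrow> 'k::ring_1) \<Rightarrow> ('i \<Rightarrow>\<^sub>0 int) \<Rightarrow> 'i \<Rightarrow> 'k" where
  "weight p v = (\<lambda>i. p i + of_int (Poly_Mapping.lookup v i))"

lemma weight_eq_iff [simp]: "weight (p :: 'i \<Rightarrow> 'k::ring_char_0) v = weight p w \<longleftrightarrow> v = w"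
  by (auto simp: weight_def fun_eq_iff intro: poly_mapping_eqI)

locale weyl_module_at = weyl_left_module M for M :: "('i, 'k::field_char_0, 'm) weyl_module" +
  fixes p :: "'i \<Rightarrow> 'k"
begin

abbreviation W where "W v \<equiv> weight_space M (weight p v)"

lemma shift_closed: "f \<in> carrier M \<Longrightarrow> shift M v w f \<in> carrier M"
  using rep.mon_closed by (simp add: shift_def)

lemma shift_weight:
  assumes "f \<in> W v"
  shows "shift M v w f \<in> W w"
proof -
  have "weight p v j + of_nat (Poly_Mapping.lookup (pos_part (w - v)) j) -
     of_nat (Poly_Mapping.lookup (pos_part (v - w)) j) = weight p w j" for j
  proof -
    let ?a = "Poly_Mapping.lookup v j" and ?b = "Poly_Mapping.lookup w j"
    have "int (nat (?b - ?a)) - int (nat (?a - ?b)) = ?b - ?a" by simp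
    then have "(of_int (int (nat (?b - ?a)) - int (nat (?a - ?b))) :: 'k) = of_int (?b - ?a)"
      by (rule arg_cong)
    then have "of_nat (nat (?b - ?a)) - of_nat (nat (?a - ?b)) = (of_int ?b - of_int ?a :: 'k)"
      unfolding of_int_diff of_int_of_nat_eq .
    then show ?thesis unfolding weight_def lookup_minus lookup_pos_part by (simp only: add_diff_eq[symmetric]) simp
  qed
  with mon_weight[OF assms, of "pos_part (w - v)" "pos_part (v - w)"] show ?thesis
    by (simp add: shift_def)
qed

lemma shift_same [simp]: "shift M v v f = f"
proof -
  have "pos_part (0 :: 'i \<Rightarrow>\<^sub>0 int) = 0" by (intro poly_mapping_eqI) simp
  then show ?thesis by (simp add: shift_def rep.mon_0_0)
qed

lemma shift_add: "\<lbrakk>f \<in> carrier M; g \<in> carrier M\<rbrakk> \<Longrightarrow> shift M v w (f \<oplus>\<^bsub>M\<^esub> g) = shift M v w f \<oplus>\<^bsub>M\<^esub> shift M v w g"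
  using rep.mon_add by (simp add: shift_def)

lemma shift_smult: "f \<in> carrier M \<Longrightarrow> shift M v w (c \<odot>\<^bsub>scalars M\<^esub> f) = c \<odot>\<^bsub>scalars M\<^esub> shift M v w f"
  using rep.mon_smult by (simp add: shift_def)

text \<open>A step away from \<open>v\<close> lengthens the monomial by one factor and creates no
  scalar. A step back towards \<open>v\<close> meets a factor \<open>Y\<close> in the monomial, and
  \<open>X Y\<close> acts on the weight space at the new point by its weight.\<close>

lemma X_shift:
  assumes f: "f \<in> W v"
  shows "weyl_X i \<odot>\<^bsub>M\<^esub> shift M v w f =
    backtrack p v w (w + Poly_Mapping.single i 1) \<odot>\<^bsub>scalars M\<^esub> shift M v (w + Poly_Mapping.single i 1) f"
proof -
  let ?w = "w + Poly_Mapping.single i 1"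
  have fM: "f \<in> carrier M" using f by (rule weight_space_closed)
  show ?thesis
  proof (cases "Poly_Mapping.lookup w i < Poly_Mapping.lookup v i")
    case False
    then have "pos_part (?w - v) = pos_part (w - v) + Poly_Mapping.single i 1" "pos_part (v - ?w) = pos_part (v - w)"
      by (intro poly_mapping_eqI; auto simp: lookup_add lookup_minus lookup_single when_def)+
    then show ?thesis
      using False fM rep.x_mon[of f i] rep.smult_1 rep.mon_closed
      by (simp add: shift_def backtrack_plus)
  next
    case True
    then have eq: "pos_part (?w - v) = pos_part (w - v)" "pos_part (v - w) = pos_part (v - ?w) + Poly_Mapping.single i 1"
      by (intro poly_mapping_eqI; auto simp: lookup_add lookup_minus lookup_single when_def)+
    \<comment> \<open>No \<open>X\<close> occurs in direction \<open>i\<close>, so the commutator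
      term of \<open>y_mon\<close> has coefficient 0.\<close>
    have "Poly_Mapping.lookup (pos_part (w - v)) i = 0" using True by (simp add: lookup_minus)
    then have "shift M v w f = weyl_Y i \<odot>\<^bsub>M\<^esub> shift M v ?w f"
      using fM rep.y_mon[of f i "pos_part (w - v)" "pos_part (v - ?w)"] rep.smult_0_left rep.mon_closed
      by (simp add: shift_def eq del: lookup_pos_part)
    moreover have "weight p ?w i = p i + of_int (Poly_Mapping.lookup w i) + 1"
      by (simp add: weight_def lookup_add)
    ultimately show ?thesis
      using XY_weight[OF shift_weight[OF f, of ?w], of i] True by (simp add: backtrack_plus)
  qed
qed

text \<open>Mirror image of \<open>X_shift\<close>: a step back now meets a factor \<open>X\<close>,
  and \<open>Y X\<close> acts by the weight plus one.\<close>

lemma Y_shift: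
  assumes f: "f \<in> W v"
  shows "weyl_Y i \<odot>\<^bsub>M\<^esub> shift M v w f =
    backtrack p v w (w - Poly_Mapping.single i 1) \<odot>\<^bsub>scalars M\<^esub> shift M v (w - Poly_Mapping.single i 1) f"
proof -
  let ?w = "w - Poly_Mapping.single i 1"
  have fM: "f \<in> carrier M" using f by (rule weight_space_closed)
  show ?thesis
  proof (cases "Poly_Mapping.lookup v i < Poly_Mapping.lookup w i")
    case False
    then have eq: "pos_part (?w - v) = pos_part (w - v)" "pos_part (v - ?w) = pos_part (v - w) + Poly_Mapping.single i 1"
      by (intro poly_mapping_eqI; auto simp: lookup_add lookup_minus lookup_single when_def)+
    have "Poly_Mapping.lookup (pos_part (w - v)) i = 0" using False by (simp add: lookup_minus)
    then show ?thesis
      using False fM rep.y_mon[of f i "pos_part (w - v)" "pos_part (v - w)"] rep.smult_0_left rep.smult_1 rep.mon_closed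
      by (simp add: shift_def eq backtrack_minus del: lookup_pos_part)
  next
    case True
    then have "pos_part (w - v) = pos_part (?w - v) + Poly_Mapping.single i 1" "pos_part (v - ?w) = pos_part (v - w)"
      by (intro poly_mapping_eqI; auto simp: lookup_add lookup_minus lookup_single when_def)+
    then have "shift M v w f = weyl_X i \<odot>\<^bsub>M\<^esub> shift M v ?w f"
      using fM rep.x_mon[of f i] by (simp add: shift_def)
    moreover have "weight p ?w i + 1 = p i + of_int (Poly_Mapping.lookup w i)"
      by (simp add: weight_def lookup_minus)
    ultimately show ?thesis
      using YX_weight[OF shift_weight[OF f, of ?w], of i] True by (simp add: backtrack_minus)
  qed
qed

text \<open>Induction on \<open>w\<close> along a monotone path from \<open>v\<close>. Each step
  applies one generator, with factor 1 on the left and a \<open>backtrack\<close> scalar on the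
  right; as \<open>backtrack p v w\<close> of the step is 1, the cocycle identity merges the scalars
  into the claimed one.\<close>

lemma shift_shift:
  assumes f: "f \<in> W u"
  shows "shift M v w (shift M u v f) = backtrack p u v w \<odot>\<^bsub>scalars M\<^esub> shift M u w f"
proof (induction w rule: monotone_path_induct[where v = v])
  case base
  then show ?case using f by (simp add: rep.smult_1[simplified] shift_closed weight_space_closed)
next
  case (plus w i)
  let ?w = "w + Poly_Mapping.single i 1"
  note g = shift_weight[OF f, of v]
  have c: "backtrack p v w ?w = 1" using plus by (intro backtrack_disjoint)
  have "shift M v ?w (shift M u v f) = weyl_X i \<odot>\<^bsub>M\<^esub> shift M v w (shift M u v f)"
    using X_shift[OF g, of i w] rep.smult_1 shift_closed weight_space_closed[OF g] by (simp add: c)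
  also have "\<dots> = (backtrack p u v w * backtrack p u w ?w) \<odot>\<^bsub>scalars M\<^esub> shift M u ?w f"
    using plus.IH rep.x_smult rep.smult_smult X_shift[OF f, of i w] shift_closed weight_space_closed[OF f] by simp
  also have "backtrack p u v w * backtrack p u w ?w = backtrack p u v ?w"
    using backtrack_cocycle[of p u v w ?w] c by simp
  finally show ?case .
next
  case (minus w i)
  let ?w = "w - Poly_Mapping.single i 1"
  note g = shift_weight[OF f, of v]
  have c: "backtrack p v w ?w = 1" using minus by (intro backtrack_disjoint)
  have "shift M v ?w (shift M u v f) = weyl_Y i \<odot>\<^bsub>M\<^esub> shift M v w (shift M u v f)"
    using Y_shift[OF g, of i w] rep.smult_1 shift_closed weight_space_closed[OF g] by (simp add: c)
  also have "\<dots> = (backtrack p u v w * backtrack p u w ?w) \<odot>\<^bsub>scalars M\<^esub> shift M u ?w f"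
    using minus.IH rep.y_smult rep.smult_smult Y_shift[OF f, of i w] shift_closed weight_space_closed[OF f] by simp
  also have "backtrack p u v w * backtrack p u w ?w = backtrack p u v ?w"
    using backtrack_cocycle[of p u v w ?w] c by simp
  finally show ?case .
qed

end

section \<open>Arrows of the path category\<close>

text \<open>Counterpart on vertices of the nonvanishing of \<open>backtrack\<close>; the link is
  \<open>backtrack_nonzero_iff\<close>.\<close>

definition no_backtrack :: "'i set \<Rightarrow> 'i set \<Rightarrow> 'i set \<Rightarrow> bool" where
  "no_backtrack U W Z \<longleftrightarrow> sym_diff U W \<inter> sym_diff W Z = {}"

text \<open>Either side says that the symmetric differences of consecutive members of
  \<open>U\<close>, \<open>W\<close>, \<open>L\<close>, \<open>Z\<close> are pairwise disjoint. It
  is the cocycle identity with truth values.\<close>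

lemma no_backtrack_cocycle:
  "no_backtrack U W L \<and> no_backtrack U L Z \<longleftrightarrow> no_backtrack W L Z \<and> no_backtrack U W Z"
  unfolding no_backtrack_def by blast

lemma no_backtrack_same [simp]: "no_backtrack U U W" "no_backtrack U W W"
  by (auto simp: no_backtrack_def)

text \<open>For paths of the quiver this means shortest: each arrow flips an element in which the
  current vertex still differs from the endpoint. Comparing with the endpoint, not with the other
  arrows, makes concatenation an instance of the cocycle identity.\<close>

fun reduced_path :: "'i set list \<Rightarrow> bool" where
  "reduced_path (U # W # us) \<longleftrightarrow> reduced_path (W # us) \<and> no_backtrack U W (last (W # us))"
| "reduced_path _ \<longleftrightarrow> True"

text \<open>After concatenation the arrows of \<open>us\<close> must be tested against the endpoint
  of \<open>ws\<close>; \<open>no_backtrack_cocycle\<close> at each vertex trades this for the test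
  against the endpoint of \<open>us\<close>.\<close>

lemma reduced_path_append:
  assumes "us \<noteq> []" "ws \<noteq> []" "last us = hd ws"
  shows "reduced_path (us @ tl ws) \<longleftrightarrow>
    reduced_path us \<and> reduced_path ws \<and> no_backtrack (hd us) (last us) (last ws)"
  using assms
proof (induction us rule: reduced_path.induct)
  case (1 U W us)
  have "last (W # us @ tl ws) = last ws"
    using 1 by (cases ws) (auto split: if_splits)
  moreover have "reduced_path (W # us @ tl ws) \<longleftrightarrow>
      reduced_path (W # us) \<and> reduced_path ws \<and> no_backtrack W (last (W # us)) (last ws)"
    using 1 by simp
  ultimately show ?case
    using no_backtrack_cocycle[of U W "last (W # us)" "last ws"] by auto
next
  case ("2_2" U)
  then show ?case by (cases ws) auto
qed simp

text \<open>A linear functional designed to have the ideal of relations as its kernel on each space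
  of paths; it thus becomes the coordinate of an arrow.\<close>

definition path_value :: "('i set list \<Rightarrow>\<^sub>0 'k::comm_ring_1) \<Rightarrow> 'k" where
  "path_value f = (\<Sum>us\<in>Poly_Mapping.keys f. Poly_Mapping.lookup f us * of_bool (reduced_path us))"

lemma path_value_superset:
  assumes "finite S" "Poly_Mapping.keys f \<subseteq> S"
  shows "path_value f = (\<Sum>us\<in>S. Poly_Mapping.lookup f us * of_bool (reduced_path us))"
  unfolding path_value_def by (rule sum.mono_neutral_left) (use assms in \<open>auto simp: in_keys_iff\<close>)

lemma path_value_add: "path_value (f + g) = path_value f + path_value g"
proof -
  let ?S = "Poly_Mapping.keys f \<union> Poly_Mapping.keys g"
  have "Poly_Mapping.keys (f + g) \<subseteq> ?S" by (rule Poly_Mapping.keys_add)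
  then show ?thesis
    by (simp add: path_value_superset[of ?S] lookup_add distrib_right sum.distrib)
qed

lemma lookup_path_scale [simp]: "Poly_Mapping.lookup (path_scale c f) us = c * Poly_Mapping.lookup f us"
  by (simp add: path_scale_def Poly_Mapping.map.rep_eq when_def)

lemma keys_path_scale: "Poly_Mapping.keys (path_scale c f) \<subseteq> Poly_Mapping.keys f"
  by (auto simp: in_keys_iff)

lemma path_value_scale: "path_value (path_scale c f) = c * path_value f"
  using keys_path_scale[of c f]
  by (simp add: path_value_superset[of "Poly_Mapping.keys f"] sum_distrib_left mult.assoc del: sum_mult_of_bool_eq)

lemma path_value_single [simp]: "path_value (Poly_Mapping.single us c) = c * of_bool (reduced_path us)"
  by (subst path_value_superset[of "{us}"]) auto

lemma path_value_0 [simp]: "path_value 0 = 0"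
  by (simp add: path_value_def)

lemma path_value_diff: "path_value (f - g) = path_value f - path_value g"
  using path_value_add[of "f - g" g] by simp

lemma path_value_sum: "path_value (sum h S) = (\<Sum>x\<in>S. path_value (h x))"
  by (induction S rule: infinite_finite_induct) (auto simp: path_value_add)

lemma path_scale_single [simp]: "path_scale c (Poly_Mapping.single us b) = Poly_Mapping.single us (c * b)"
  by (intro poly_mapping_eqI) (simp add: lookup_single when_def)

lemma path_scale_arith:
  "path_scale c (f + g) = path_scale c f + path_scale c g"
  "path_scale c (f - g) = path_scale c f - path_scale c g"
  "path_scale (c + d) f = path_scale c f + path_scale d f"
  "path_scale (c * d) f = path_scale c (path_scale d f)"
  "path_scale 1 f = f" "path_scale 0 f = 0" "path_scale (-1) f = - f"
  by (intro poly_mapping_eqI; simp add: lookup_add lookup_minus algebra_simps)+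

lemma path_comp_superset:
  assumes "finite S" "Poly_Mapping.keys f \<subseteq> S" "finite T" "Poly_Mapping.keys g \<subseteq> T"
  shows "path_comp g f = (\<Sum>us\<in>S. \<Sum>ws\<in>T.
     Poly_Mapping.single (us @ tl ws) (Poly_Mapping.lookup g ws * Poly_Mapping.lookup f us))"
proof -
  have "path_comp g f = (\<Sum>us\<in>Poly_Mapping.keys f. \<Sum>ws\<in>T.
     Poly_Mapping.single (us @ tl ws) (Poly_Mapping.lookup g ws * Poly_Mapping.lookup f us))"
    unfolding path_comp_def using assms
    by (intro sum.cong sum.mono_neutral_left) (auto simp: in_keys_iff)
  also have "\<dots> = (\<Sum>us\<in>S. \<Sum>ws\<in>T.
     Poly_Mapping.single (us @ tl ws) (Poly_Mapping.lookup g ws * Poly_Mapping.lookup f us))"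
    using assms by (intro sum.mono_neutral_left) (auto simp: in_keys_iff)
  finally show ?thesis .
qed

lemma path_comp_add_right: "path_comp g (f + f') = path_comp g f + path_comp g f'"
proof -
  let ?S = "Poly_Mapping.keys f \<union> Poly_Mapping.keys f'"
  have "Poly_Mapping.keys (f + f') \<subseteq> ?S" by (rule Poly_Mapping.keys_add)
  then show ?thesis
    by (simp add: path_comp_superset[of ?S _ "Poly_Mapping.keys g"] lookup_add distrib_left single_add sum.distrib)
qed

lemma path_comp_add_left: "path_comp (g + g') f = path_comp g f + path_comp g' f"
proof -
  let ?S = "Poly_Mapping.keys g \<union> Poly_Mapping.keys g'"
  have "Poly_Mapping.keys (g + g') \<subseteq> ?S" by (rule Poly_Mapping.keys_add)
  then show ?thesis
    by (simp add: path_comp_superset[of "Poly_Mapping.keys f" _ ?S] lookup_add distrib_right single_add sum.distrib)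
qed

lemma path_comp_diff_right: "path_comp g (f - f') = path_comp g f - path_comp g f'"
  using path_comp_add_right[of g "f - f'" f'] by simp

lemma path_comp_diff_left: "path_comp (g - g') f = path_comp g f - path_comp g' f"
  using path_comp_add_left[of "g - g'" g' f] by simp

lemma path_comp_single [simp]:
  "path_comp (Poly_Mapping.single ws c) (Poly_Mapping.single us b) = Poly_Mapping.single (us @ tl ws) (c * b)"
  by (subst path_comp_superset[of "{us}" _ "{ws}"]) auto

lemma quiver_arrow_commute: "quiver_arrow E U W \<longleftrightarrow> quiver_arrow E W U"
  by (auto simp: quiver_arrow_def Un_commute)

lemma quiver_paths_append:
  assumes "us \<in> quiver_paths E U W" "ws \<in> quiver_paths E W Z"
  shows "us @ tl ws \<in> quiver_paths E U Z"
proof -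
  obtain ws' where ws: "ws = W # ws'" using assms(2) by (cases ws) (auto simp: quiver_paths_def)
  show ?thesis using assms
    by (cases ws') (auto simp: ws quiver_paths_def successively_append_iff)
qed

lemma quiver_paths_ends: "us \<in> quiver_paths E U W \<Longrightarrow> U \<in> Fpow E \<and> W \<in> Fpow E"
  using hd_in_set last_in_set by (fastforce simp: quiver_paths_def)

lemma quiver_paths_Cons:
  assumes "quiver_arrow E U W" "ws \<in> quiver_paths E W Z"
  shows "U # ws \<in> quiver_paths E U Z"
  using assms by (cases ws) (auto simp: quiver_paths_def quiver_arrow_def)

lemma path_space_add: "f \<in> path_space E U W \<Longrightarrow> g \<in> path_space E U W \<Longrightarrow> f + g \<in> path_space E U W"
  using Poly_Mapping.keys_add[of f g] by (auto simp: path_space_def)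

lemma path_space_scale: "f \<in> path_space E U W \<Longrightarrow> path_scale c f \<in> path_space E U W"
  using keys_path_scale[of c f] by (auto simp: path_space_def)

lemma path_space_single: "us \<in> quiver_paths E U W \<Longrightarrow> Poly_Mapping.single us c \<in> path_space E U W"
  by (simp add: path_space_def)

lemma path_space_0: "0 \<in> path_space E U W"
  by (simp add: path_space_def)

lemma path_space_sum: "(\<And>x. x \<in> S \<Longrightarrow> h x \<in> path_space E U W) \<Longrightarrow> sum h S \<in> path_space E U W"
  by (induction S rule: infinite_finite_induct) (auto simp: path_space_0 path_space_add)

lemma path_space_comp:
  "f \<in> path_space E U W \<Longrightarrow> g \<in> path_space E W Z \<Longrightarrow> path_comp g f \<in> path_space E U Z"
  unfolding path_comp_def
  by (intro path_space_sum path_space_single quiver_paths_append[where W = W]) (auto simp: path_space_def)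

text \<open>The composition law on the path side: two reduced paths compose to a reduced path or to
  one of value 0, and \<open>no_backtrack\<close> decides which.\<close>

lemma path_value_comp:
  assumes "f \<in> path_space E U W" "g \<in> path_space E W Z"
  shows "path_value (path_comp g f) = of_bool (no_backtrack U W Z) * path_value g * path_value f"
proof -
  have "path_value (Poly_Mapping.single (us @ tl ws) (Poly_Mapping.lookup g ws * Poly_Mapping.lookup f us)) =
     of_bool (no_backtrack U W Z) * (Poly_Mapping.lookup f us * of_bool (reduced_path us)) *
       (Poly_Mapping.lookup g ws * of_bool (reduced_path ws))"
    if "us \<in> Poly_Mapping.keys f" "ws \<in> Poly_Mapping.keys g" for us ws
  proof -
    have "us \<in> quiver_paths E U W" "ws \<in> quiver_paths E W Z" using that assms by (auto simp: path_space_def)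
    then have "reduced_path (us @ tl ws) \<longleftrightarrow> reduced_path us \<and> reduced_path ws \<and> no_backtrack U W Z"
      using reduced_path_append[of us ws] by (auto simp: quiver_paths_def)
    then show ?thesis by simp
  qed
  then have "path_value (path_comp g f) =
     (\<Sum>us\<in>Poly_Mapping.keys f. \<Sum>ws\<in>Poly_Mapping.keys g.
       of_bool (no_backtrack U W Z) * (Poly_Mapping.lookup f us * of_bool (reduced_path us)) *
       (Poly_Mapping.lookup g ws * of_bool (reduced_path ws)))"
    unfolding path_comp_def path_value_sum by (intro sum.cong refl)
  also have "\<dots> = of_bool (no_backtrack U W Z) * path_value f * path_value g"
    unfolding path_value_def sum_distrib_left[symmetric] sum_distrib_right[symmetric] by (rule refl)
  finally show ?thesis by (simp only: mult.commute mult.left_commute)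
qed

lemma quiver_arrowE:
  assumes "quiver_arrow E U W"
  obtains i where "sym_diff U W = {i}" "U \<in> Fpow E" "W \<in> Fpow E"
  using assms by (auto simp: quiver_arrow_def is_singleton_def)

lemma quiver_arrow_not_backtrack:
  assumes "quiver_arrow E U W"
  shows "\<not> no_backtrack U W U"
  using assms by (elim quiver_arrowE) (auto simp: no_backtrack_def)

lemma square_no_backtrack:
  assumes "quiver_arrow E U W" "quiver_arrow E W Z" "U \<noteq> Z"
  shows "no_backtrack U W Z"
proof -
  obtain i where i: "sym_diff U W = {i}" using assms(1) by (elim quiver_arrowE)
  obtain j where j: "sym_diff W Z = {j}" using assms(2) by (elim quiver_arrowE)
  have "i \<noteq> j" using i j assms(3) by blast
  then show ?thesis unfolding no_backtrack_def i j by simp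
qed

section \<open>The ideal of relations and shortest paths\<close>

lemma rel_ideal_path_space:
  "rel_ideal E U W f \<Longrightarrow> f \<in> path_space E U W \<and> U \<in> Fpow E \<and> W \<in> Fpow E"
proof (induction rule: rel_ideal.induct)
  case (loop U W)
  then show ?case
    by (auto intro!: path_space_single simp: quiver_paths_def) (auto simp: quiver_arrow_def)
next
  case (square U W U' W')
  then have "U \<in> Fpow E" "W \<in> Fpow E" "U' \<in> Fpow E" "W' \<in> Fpow E" by (auto simp: quiver_arrow_def)
  moreover have "Poly_Mapping.single [U, W, W'] 1 + path_scale (-1) (Poly_Mapping.single [U, U', W'] 1) \<in> path_space E U W'"
    using square calculation by (intro path_space_add path_space_scale path_space_single) (auto simp: quiver_paths_def)
  ultimately show ?case by (simp add: path_scale_arith del: path_scale_single)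
qed (auto intro: path_space_0 path_space_add path_space_scale path_space_comp)

text \<open>A loop is not reduced, while both routes around a square are reduced and cancel.
  Composition preserves value 0 by the product formula \<open>path_value_comp\<close>.\<close>

lemma rel_ideal_path_value: "rel_ideal E U W f \<Longrightarrow> path_value f = 0"
proof (induction rule: rel_ideal.induct)
  case (loop U W)
  then show ?case by (simp add: quiver_arrow_not_backtrack)
next
  case (square U W U' W')
  then show ?case by (simp add: path_value_diff square_no_backtrack[of E])
next
  case (comp_left U W f Z g)
  then show ?case using rel_ideal_path_space[OF comp_left(1)] by (simp add: path_value_comp[of f E U W g Z])
next
  case (comp_right W Z g U f)
  then show ?case using rel_ideal_path_space[OF comp_right(1)] by (simp add: path_value_comp[of f E U W g Z])
qed (auto simp: path_value_add path_value_scale)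

lemma rel_ideal_minus: "rel_ideal E U W f \<Longrightarrow> rel_ideal E U W (- f)"
  using rel_ideal.scale[of E U W f "-1"] by (simp add: path_scale_arith)

lemma rel_ideal_commute: "rel_ideal E U W (f - g) \<Longrightarrow> rel_ideal E U W (g - f)"
  using rel_ideal_minus by fastforce

lemma rel_ideal_trans:
  "rel_ideal E U W (f - g) \<Longrightarrow> rel_ideal E U W (g - h) \<Longrightarrow> rel_ideal E U W (f - h)"
  using rel_ideal.add[of E U W "f - g" "g - h"] by simp

lemma quiver_pathsE:
  assumes "us \<in> quiver_paths E U W"
  obtains "us = [U]" "U = W" "U \<in> Fpow E"
  | V us' where "us = U # V # us'" "quiver_arrow E U V" "V # us' \<in> quiver_paths E V W"
proof (cases us)
  case Nil
  then show ?thesis using assms by (simp add: quiver_paths_def)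
next
  case (Cons a us')
  show ?thesis
    by (cases us') (use assms Cons that in \<open>auto simp: quiver_paths_def\<close>)
qed

lemma rel_ideal_Cons:
  assumes "rel_ideal E W Z (Poly_Mapping.single us 1 - Poly_Mapping.single ws 1 :: 'i set list \<Rightarrow>\<^sub>0 'k::comm_ring_1)"
    and "quiver_arrow E U W" and "us \<in> quiver_paths E W Z" "ws \<in> quiver_paths E W Z"
  shows "rel_ideal E U Z (Poly_Mapping.single (U # us) 1 - Poly_Mapping.single (U # ws) 1 :: 'i set list \<Rightarrow>\<^sub>0 'k)"
proof -
  have UW: "[U, W] \<in> quiver_paths E U W" "U \<in> Fpow E" using assms(2) by (auto simp: quiver_paths_def quiver_arrow_def)
  have "[U, W] @ tl us = U # us" "[U, W] @ tl ws = U # ws"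
    using assms(3,4) by (cases us; cases ws; auto simp: quiver_paths_def)+
  then show ?thesis
    using rel_ideal.comp_right[OF assms(1) UW(2) path_space_single[OF UW(1)], of 1]
    by (simp add: path_comp_diff_left)
qed

text \<open>The elements of the symmetric difference are flipped one at a time. Intermediate
  vertices remain finite subsets of \<open>E\<close>, as every flipped element comes from
  \<open>U\<close> or \<open>W\<close>.\<close>

lemma ex_reduced_path:
  assumes "U \<in> Fpow E" "W \<in> Fpow E"
  shows "\<exists>us. us \<in> quiver_paths E U W \<and> reduced_path us"
  using assms(1)
proof (induction "card (sym_diff U W)" arbitrary: U rule: less_induct)
  case less
  show ?case
  proof (cases "U = W")
    case True
    then show ?thesis using less by (intro exI[of _ "[U]"]) (simp add: quiver_paths_def)
  next
    case False
    then obtain i where i: "i \<in> sym_diff U W" by blast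
    define V where "V = sym_diff U {i}"
    have V: "V \<in> Fpow E" using less(2) assms(2) i by (auto simp: V_def Fpow_def)
    have UV: "sym_diff U V = {i}" by (auto simp: V_def)
    have VW: "sym_diff V W = sym_diff U W - {i}" using i by (auto simp: V_def)
    have "finite (sym_diff U W)" using less(2) assms(2) by (auto simp: Fpow_def)
    with i have "card (sym_diff V W) < card (sym_diff U W)" unfolding VW by (rule card_Diff1_less[rotated -1])
    from less(1)[OF this V] obtain us where us: "us \<in> quiver_paths E V W" "reduced_path us" by blast
    have "quiver_arrow E U V" using V less(2) UV by (simp add: quiver_arrow_def is_singleton_def)
    moreover obtain us' where us': "us = V # us'" using us by (cases us) (auto simp: quiver_paths_def)
    moreover have "last us = W" using us by (simp add: quiver_paths_def)
    ultimately show ?thesis using us quiver_paths_Cons[of E U V us W] VW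
      by (intro exI[of _ "U # us"]) (auto simp: no_backtrack_def UV)
  qed
qed

lemma sym_diff_singletonD:
  assumes "sym_diff U V = {i}"
  shows "x \<in> V \<longleftrightarrow> (x \<in> U \<longleftrightarrow> x \<noteq> i)"
proof -
  have "x \<in> sym_diff U V \<longleftrightarrow> x = i" using assms by simp
  then show ?thesis by auto
qed

lemma no_backtrack_arrow:
  assumes "sym_diff U V = {i}"
  shows "no_backtrack U V W \<longleftrightarrow> i \<in> sym_diff U W"
proof -
  have "i \<in> U \<longleftrightarrow> i \<notin> V" using assms by blast
  then show ?thesis unfolding no_backtrack_def assms by blast
qed

text \<open>If two shortest paths begin with different flips \<open>i\<close> and \<open>j\<close>,
  a square performing both flips, continued by a common shortest path \<open>r\<close>, joins them.
  The square relation exchanges the two beginnings and the induction hypothesis compares the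
  remainders.\<close>

lemma reduced_paths_equal:
  assumes "us \<in> quiver_paths E U W" "ws \<in> quiver_paths E U W" "reduced_path us" "reduced_path ws"
  shows "rel_ideal E U W (Poly_Mapping.single us 1 - Poly_Mapping.single ws 1 :: 'i set list \<Rightarrow>\<^sub>0 'k::comm_ring_1)"
  using assms
proof (induction "length us" arbitrary: U us ws rule: less_induct)
  case less
  have last: "last us = W" "last ws = W" using less by (auto simp: quiver_paths_def)
  from \<open>us \<in> quiver_paths E U W\<close> show ?case
  proof (cases rule: quiver_pathsE)
    case 1
    have "ws = [U]"
      using less(3)
    proof (cases rule: quiver_pathsE)
      case (2 V ws')
      then show ?thesis using less.prems(4) last(2) quiver_arrow_not_backtrack[of E U V] 1 by auto
    qed
    then show ?thesis using 1 by (auto intro: rel_ideal.zero)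
  next
    case us: (2 V us')
    from less(3) show ?thesis
    proof (cases rule: quiver_pathsE)
      case 1
      then show ?thesis using less.prems(3) last(1) quiver_arrow_not_backtrack[of E U V] us by auto
    next
      case ws: (2 V' ws')
      have lu: "last (V # us') = W" and lw: "last (V' # ws') = W" using us ws last by auto
      obtain i where i: "sym_diff U V = {i}" and Fp: "U \<in> Fpow E" "V \<in> Fpow E" using us by (auto elim: quiver_arrowE)
      obtain j where j: "sym_diff U V' = {j}" and V': "V' \<in> Fpow E" using ws by (auto elim: quiver_arrowE)
      have W: "W \<in> Fpow E" using quiver_paths_ends[OF us(3)] by blast
      have red: "reduced_path (V # us')" "reduced_path (V' # ws')"
         "no_backtrack U V W" "no_backtrack U V' W"
        using less.prems us ws lu lw by auto
      then have ij: "i \<in> sym_diff U W" "j \<in> sym_diff U W" by (simp_all add: no_backtrack_arrow i j)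
      show ?thesis
      proof (cases "V = V'")
        case True
        then show ?thesis
          using less(1)[OF _ us(3), of "V # ws'"] ws us red rel_ideal_Cons[OF _ us(2), of W "V # us'" "V # ws'"] by simp
      next
        case False
        then have "i \<noteq> j" using i j by blast
        \<comment> \<open>The vertex opposite to \<open>U\<close> in the square spanned by the two
          first arrows.\<close>
        define X where "X = sym_diff V {j}"
        have X: "X \<in> Fpow E" using Fp V' j by (auto simp: X_def Fpow_def)
        have VX: "sym_diff V X = {j}" by (auto simp: X_def)
        have "X = sym_diff V' {i}" using i j \<open>i \<noteq> j\<close> unfolding X_def by blast
        then have V'X: "sym_diff V' X = {i}" by auto
        obtain r where r: "r \<in> quiver_paths E X W" "reduced_path r" using ex_reduced_path[OF X W] by blast
        obtain r' where r': "r = X # r'" using r by (cases r) (auto simp: quiver_paths_def)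
        have lr: "last (X # r') = W" using r r' by (auto simp: quiver_paths_def)
        have arr: "quiver_arrow E V X" "quiver_arrow E V' X"
          using X Fp V' VX V'X by (auto simp: quiver_arrow_def is_singleton_def)
        have "j \<in> sym_diff V W" "i \<in> sym_diff V' W" 
          using ij \<open>i \<noteq> j\<close> by (auto simp: sym_diff_singletonD[OF i] sym_diff_singletonD[OF j])
        then have redV: "reduced_path (V # r)" "reduced_path (V' # r)"
          using r r' lr VX V'X by (auto simp: no_backtrack_arrow)
        have paths: "V # r \<in> quiver_paths E V W" "V' # r \<in> quiver_paths E V' W"
          using arr r by (auto intro: quiver_paths_Cons)
        \<comment> \<open>The second use of the induction hypothesis starts from
          \<open>V' # r\<close>, which is not a tail of \<open>us\<close>. Its length is controlled
          because a reduced path has exactly as many arrows as its end vertices have elements in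
          which they differ.\<close>
        have len: "length (V' # r) < length us"
        proof -
          have "length q = Suc (card (sym_diff A W))" if "q \<in> quiver_paths E A W" "reduced_path q" for q A
            using that
          proof (induction q arbitrary: A)
            case (Cons a q)
            from Cons.prems(1) show ?case
            proof (cases rule: quiver_pathsE)
              case (2 B q')
              obtain k where k: "sym_diff A B = {k}" and "A \<in> Fpow E" using 2(2) by (elim quiver_arrowE)
              moreover have "last q = W" using 2 by (auto simp: quiver_paths_def)
              ultimately have "k \<in> sym_diff A W" using Cons.prems 2 by (auto simp: no_backtrack_arrow)
              moreover have "sym_diff B W = sym_diff A W - {k}" using calculation by (auto simp: sym_diff_singletonD[OF k])
              moreover have "finite (sym_diff A W)" using \<open>A \<in> Fpow E\<close> W by (auto simp: Fpow_def)
              ultimately have "card (sym_diff A W) = Suc (card (sym_diff B W))"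
                by (metis card.remove)
              then show ?thesis using Cons 2 by auto
            qed auto
          qed (simp add: quiver_paths_def)
          from this[OF us(3) red(1)] this[OF paths(1) redV(1)] us show ?thesis by simp
        qed
        have 1: "rel_ideal E U W (Poly_Mapping.single us 1 - Poly_Mapping.single (U # V # r) 1 :: 'i set list \<Rightarrow>\<^sub>0 'k)"
          using less(1)[OF _ us(3) paths(1) red(1) redV(1)] rel_ideal_Cons[OF _ us(2) us(3) paths(1)] us by simp
        have 2: "rel_ideal E U W (Poly_Mapping.single (U # V' # r) 1 - Poly_Mapping.single ws 1 :: 'i set list \<Rightarrow>\<^sub>0 'k)"
          using less(1)[OF len paths(2) ws(3) redV(2) red(2)] rel_ideal_Cons[OF _ ws(2) paths(2) ws(3)] ws by simp
        have "distinct [U, V, V', X]" using i j VX V'X \<open>i \<noteq> j\<close> False by auto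
        from rel_ideal.square[OF this us(2) arr(1) ws(2) arr(2)]
        have "rel_ideal E U W (path_comp (Poly_Mapping.single r 1)
           (Poly_Mapping.single [U, V, X] 1 - Poly_Mapping.single [U, V', X] 1 :: 'i set list \<Rightarrow>\<^sub>0 'k))"
          by (rule rel_ideal.comp_left[OF _ W path_space_single[OF r(1)]])
        then have 3: "rel_ideal E U W (Poly_Mapping.single (U # V # r) 1 - Poly_Mapping.single (U # V' # r) 1 :: 'i set list \<Rightarrow>\<^sub>0 'k)"
          by (simp add: path_comp_diff_right r')
        show ?thesis by (rule rel_ideal_trans[OF rel_ideal_trans[OF 1 3] 2])
      qed
    qed
  qed
qed

text \<open>At the last offending arrow, from \<open>U\<close> to \<open>V\<close>, the remaining
  path is reduced and its endpoint agrees with \<open>U\<close> at the flipped element. The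
  remainder may be exchanged for one that returns to \<open>U\<close> at once, and then the loop
  relation applies.\<close>

lemma unreduced_path_zero:
  assumes "us \<in> quiver_paths E U W" "\<not> reduced_path us"
  shows "rel_ideal E U W (Poly_Mapping.single us 1 :: 'i set list \<Rightarrow>\<^sub>0 'k::comm_ring_1)"
  using assms
proof (induction us arbitrary: U)
  case (Cons a us)
  from Cons.prems(1) show ?case
  proof (cases rule: quiver_pathsE)
    case 1
    then show ?thesis using Cons.prems by simp
  next
    case (2 V us')
    then have a: "a = U" "us = V # us'" by auto
    have lu: "last us = W" using 2 a by (auto simp: quiver_paths_def)
    have W: "W \<in> Fpow E" using quiver_paths_ends[OF 2(3)] by blast
    obtain i where i: "sym_diff U V = {i}" and U: "U \<in> Fpow E" "V \<in> Fpow E" using 2(2) by (elim quiver_arrowE)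
    have UV: "[U, V] \<in> quiver_paths E U V" using 2 U by (simp add: quiver_paths_def)
    show ?thesis
    proof (cases "reduced_path us")
      case False
      with Cons.IH 2 a have "rel_ideal E V W (Poly_Mapping.single us 1 :: 'i set list \<Rightarrow>\<^sub>0 'k)" by simp
      from rel_ideal.comp_right[OF this U(1) path_space_single[OF UV], of 1] show ?thesis by (simp add: a)
    next
      case True
      then have "i \<notin> sym_diff U W" using Cons.prems(2) a lu i by (auto simp: no_backtrack_arrow)
      moreover have "sym_diff V U = {i}" using i by (simp add: Un_commute)
      ultimately have "no_backtrack V U W" by (auto simp: no_backtrack_arrow sym_diff_singletonD[OF i])
      obtain r where r: "r \<in> quiver_paths E U W" "reduced_path r" using ex_reduced_path[OF U(1) W] by blast
      obtain r' where r': "r = U # r'" using r by (cases r) (auto simp: quiver_paths_def)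
      have "last r = W" using r by (auto simp: quiver_paths_def)
      have VU: "quiver_arrow E V U" using 2 quiver_arrow_commute by blast
      have "V # r \<in> quiver_paths E V W" using quiver_paths_Cons[OF VU r(1)] .
      moreover have "reduced_path (V # r)" using r r' \<open>last r = W\<close> \<open>no_backtrack V U W\<close> by simp
      ultimately have "rel_ideal E V W (Poly_Mapping.single us 1 - Poly_Mapping.single (V # r) 1 :: 'i set list \<Rightarrow>\<^sub>0 'k)"
        using True 2 a by (intro reduced_paths_equal) auto
      then have 1: "rel_ideal E U W (Poly_Mapping.single (U # us) 1 - Poly_Mapping.single (U # V # r) 1 :: 'i set list \<Rightarrow>\<^sub>0 'k)"
        using 2 a \<open>V # r \<in> _\<close> by (intro rel_ideal_Cons) auto
      have "rel_ideal E U W (path_comp (Poly_Mapping.single r 1) (Poly_Mapping.single [U, V, U] 1 :: 'i set list \<Rightarrow>\<^sub>0 'k))"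
        by (rule rel_ideal.comp_left[OF rel_ideal.loop[OF 2(2) VU] W path_space_single[OF r(1)]])
      then have "rel_ideal E U W (Poly_Mapping.single (U # V # r) 1 :: 'i set list \<Rightarrow>\<^sub>0 'k)" by (simp add: r')
      from rel_ideal.add[OF 1 this] show ?thesis using a by simp
    qed
  qed
qed (simp add: quiver_paths_def)

section \<open>Arrows are determined by one coordinate\<close>

definition geodesic :: "'i set \<Rightarrow> 'i set \<Rightarrow> 'i set \<Rightarrow> 'i set list" where
  "geodesic E U W = (SOME us. us \<in> quiver_paths E U W \<and> reduced_path us)"

lemma geodesic:
  assumes "U \<in> Fpow E" "W \<in> Fpow E"
  shows "geodesic E U W \<in> quiver_paths E U W" "reduced_path (geodesic E U W)"
  using someI_ex[OF ex_reduced_path[OF assms]] by (auto simp: geodesic_def)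

text \<open>Applying the two preceding results path by path reduces every combination to a multiple
  of one chosen shortest path, so each space of arrows is spanned by a single class.\<close>

lemma rel_ideal_geodesic:
  assumes U: "U \<in> Fpow E" and W: "W \<in> Fpow E" and f: "f \<in> path_space E U W"
  shows "rel_ideal E U W (f - Poly_Mapping.single (geodesic E U W) (path_value f))"
  using f
proof (induction f rule: update_induct)
  case const
  then show ?case using U W by (simp add: rel_ideal.zero)
next
  case (update f us b)
  let ?\<gamma> = "geodesic E U W"
  have f: "Poly_Mapping.update us b f = f + Poly_Mapping.single us b"
    using update(1) by (intro poly_mapping_eqI) (auto simp: lookup_update lookup_add lookup_single in_keys_iff when_def)
  have "Poly_Mapping.keys (Poly_Mapping.update us b f) = insert us (Poly_Mapping.keys f)"
    using update by (simp add: keys_update)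
  with update.prems have us: "us \<in> quiver_paths E U W" and "f \<in> path_space E U W"
    by (auto simp: path_space_def)
  have "rel_ideal E U W (Poly_Mapping.single us 1 - Poly_Mapping.single ?\<gamma> (of_bool (reduced_path us)))"
    using reduced_paths_equal[OF us geodesic(1)[OF U W]] unreduced_path_zero[OF us] geodesic(2)[OF U W] by auto
  from rel_ideal.scale[OF this, of b]
  have 1: "rel_ideal E U W (Poly_Mapping.single us b - Poly_Mapping.single ?\<gamma> (b * of_bool (reduced_path us)))"
    by (simp add: path_scale_arith)
  from rel_ideal.add[OF update.IH[OF \<open>f \<in> _\<close>] 1] show ?case
    by (simp add: f path_value_add single_add algebra_simps)
qed

text \<open>The value is an invariant because the ideal has value 0, and a complete one because both
  combinations reduce to multiples of the same geodesic.\<close>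

lemma path_class_eq_iff:
  assumes U: "U \<in> Fpow E" and W: "W \<in> Fpow E" and f: "f \<in> path_space E U W" and g: "g \<in> path_space E U W"
  shows "path_class E U W f = path_class E U W g \<longleftrightarrow> path_value f = path_value g"
proof
  assume "path_class E U W f = path_class E U W g"
  moreover have "f \<in> path_class E U W f" using U W by (simp add: path_class_def rel_ideal.zero)
  ultimately have "rel_ideal E U W (f - g)" by (simp add: path_class_def)
  then show "path_value f = path_value g"
    using rel_ideal_path_value[of E U W "f - g"] by (simp add: path_value_diff)
next
  assume "path_value f = path_value g"
  with rel_ideal_geodesic[OF U W f] rel_ideal_geodesic[OF U W g]
  have "rel_ideal E U W (f - g)" by (metis rel_ideal_commute rel_ideal_trans)
  then show "path_class E U W f = path_class E U W g"
    unfolding path_class_def using rel_ideal_trans rel_ideal_commute by blast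
qed

lemma path_class_mem:
  assumes U: "U \<in> Fpow E" and W: "W \<in> Fpow E" and f: "f \<in> path_space E U W"
  shows "g \<in> path_class E U W f \<longleftrightarrow> g \<in> path_space E U W \<and> path_value g = path_value f"
proof
  assume "g \<in> path_class E U W f"
  then have "rel_ideal E U W (g - f)" by (simp add: path_class_def)
  then have "g - f \<in> path_space E U W" "path_value g - path_value f = 0"
    using rel_ideal_path_space[of E U W "g - f"] rel_ideal_path_value[of E U W "g - f"]
    by (simp_all add: path_value_diff)
  then show "g \<in> path_space E U W \<and> path_value g = path_value f"
    using path_space_add[OF _ f, of "g - f"] by simp
next
  assume "g \<in> path_space E U W \<and> path_value g = path_value f"
  then have "path_class E U W g = path_class E U W f" using path_class_eq_iff[OF U W _ f] by blast
  moreover have "g \<in> path_class E U W g" using U W by (simp add: path_class_def rel_ideal.zero)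
  ultimately show "g \<in> path_class E U W f" by simp
qed

definition arrow_value :: "('i set list \<Rightarrow>\<^sub>0 'k::comm_ring_1) set \<Rightarrow> 'k" where
  "arrow_value a = path_value (SOME f. f \<in> a)"

lemma arrow_value_class:
  assumes "U \<in> Fpow E" "W \<in> Fpow E" "f \<in> path_space E U W"
  shows "arrow_value (path_class E U W f) = path_value f"
proof -
  have "(SOME g. g \<in> path_class E U W f) \<in> path_class E U W f"
    by (rule someI[of _ f]) (simp add: path_class_mem assms)
  then show ?thesis by (simp add: arrow_value_def path_class_mem assms)
qed

lemma path_category_simps:
  shows Obj_path_category [simp]: "Obj (path_category E) = Fpow E"
    and Hom_path_category: "Hom (path_category E) U W = path_class E U W ` path_space E U W"
    and Ident_path_category: "Ident (path_category E) U = path_class E U U (Poly_Mapping.single [U] 1)"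
  by (simp_all add: path_category_def)

context
  fixes E :: "'i set" and U W :: "'i set"
  assumes U: "U \<in> Fpow E" and W: "W \<in> Fpow E"
begin

lemma path_category_Hom_eqI:
  assumes "a \<in> Hom (path_category E) U W" "b \<in> Hom (path_category E) U W" "arrow_value a = arrow_value b"
  shows "a = b"
proof -
  obtain f g where "f \<in> path_space E U W" "a = path_class E U W f"
    "g \<in> path_space E U W" "b = path_class E U W g"
    using assms(1,2) by (auto simp: Hom_path_category)
  moreover from this have "path_value f = path_value g"
    using assms(3) arrow_value_class[OF U W, of f] arrow_value_class[OF U W, of g] by simp
  ultimately show ?thesis using path_class_eq_iff[OF U W, of f g] by simp
qed

text \<open>Operations on cosets are unions over representatives; this collapses such a union once
  the result is seen to depend only on the value.\<close>

lemma UN_path_class: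
  assumes f: "f \<in> path_space E U W"
    and h: "\<And>f'. f' \<in> path_space E U W \<Longrightarrow> path_value f' = path_value f \<Longrightarrow> h f' = h f"
  shows "(\<Union>f'\<in>path_class E U W f. h f') = h f"
proof -
  have "f \<in> path_class E U W f" using f by (simp add: path_class_mem[OF U W])
  then have ne: "path_class E U W f \<noteq> {}" by blast
  have "h f' = h f" if "f' \<in> path_class E U W f" for f'
    by (rule h) (use that in \<open>simp_all add: path_class_mem[OF U W f]\<close>)
  with ne show ?thesis by (rule SUP_eq_const)
qed

lemma HAdd_path_class:
  assumes f: "f \<in> path_space E U W" and g: "g \<in> path_space E U W"
  shows "HAdd (path_category E) U W (path_class E U W f) (path_class E U W g) = path_class E U W (f + g)"
proof -
  have "(\<Union>g'\<in>path_class E U W g. path_class E U W (f' + g')) = path_class E U W (f + g)"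
    if f': "f' \<in> path_class E U W f" for f'
  proof -
    from f' have "f' \<in> path_space E U W" "path_value f' = path_value f"
      by (simp_all add: path_class_mem[OF U W f])
    then have "path_class E U W (f' + g') = path_class E U W (f + g)"
      if "g' \<in> path_space E U W" "path_value g' = path_value g" for g'
      using that f g by (simp add: path_class_eq_iff[OF U W] path_space_add path_value_add)
    then show ?thesis using UN_path_class[OF g, of "\<lambda>g'. path_class E U W (f' + g')"] g by simp
  qed
  moreover have "f \<in> path_class E U W f" using f by (simp add: path_class_mem[OF U W])
  ultimately show ?thesis unfolding path_category_def by auto
qed

lemma HScale_path_class:
  assumes f: "f \<in> path_space E U W"
  shows "HScale (path_category E) U W c (path_class E U W f) = path_class E U W (path_scale c f)"
proof -
  have "HScale (path_category E) U W c (path_class E U W f) =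
     (\<Union>f'\<in>path_class E U W f. path_class E U W (path_scale c f'))"
    by (simp add: path_category_def)
  also have "\<dots> = path_class E U W (path_scale c f)"
    using U W f by (intro UN_path_class) (auto simp: path_class_eq_iff path_space_scale path_value_scale)
  finally show ?thesis .
qed

end

lemma Comp_path_class:
  assumes U: "U \<in> Fpow E" and W: "W \<in> Fpow E" and Z: "Z \<in> Fpow E"
    and f: "f \<in> path_space E U W" and g: "g \<in> path_space E W Z"
  shows "Comp (path_category E) U W Z (path_class E W Z g) (path_class E U W f) = path_class E U Z (path_comp g f)"
proof -
  have "(\<Union>g'\<in>path_class E W Z g. path_class E U Z (path_comp g' f')) = path_class E U Z (path_comp g f)"
    if f': "f' \<in> path_class E U W f" for f'
  proof -
    from f' have f'': "f' \<in> path_space E U W" "path_value f' = path_value f"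
      by (simp_all add: path_class_mem[OF U W f])
    have "path_class E U Z (path_comp g' f') = path_class E U Z (path_comp g f)"
      if "g' \<in> path_space E W Z" "path_value g' = path_value g" for g'
      using that f g f''
      by (simp add: path_class_eq_iff[OF U Z] path_space_comp[of _ E U W] path_value_comp[of _ E U W])
    then show ?thesis using UN_path_class[OF W Z g, of "\<lambda>g'. path_class E U Z (path_comp g' f')"] g by simp
  qed
  moreover have "f \<in> path_class E U W f" using f by (simp add: path_class_mem[OF U W])
  ultimately show ?thesis unfolding path_category_def by auto
qed

lemma path_category_arrows:
  assumes U: "U \<in> Fpow E" and W: "W \<in> Fpow E"
    and a: "a \<in> Hom (path_category E) U W"
  shows HScale_Hom: "HScale (path_category E) U W c a \<in> Hom (path_category E) U W"
    and arrow_value_HScale: "arrow_value (HScale (path_category E) U W c a) = c * arrow_value a"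
    and arrow_value_HAdd: "b \<in> Hom (path_category E) U W \<Longrightarrow>
      arrow_value (HAdd (path_category E) U W a b) = arrow_value a + arrow_value b"
    and Comp_Hom_path: "b \<in> Hom (path_category E) W Z \<Longrightarrow> Z \<in> Fpow E \<Longrightarrow>
      Comp (path_category E) U W Z b a \<in> Hom (path_category E) U Z"
    and arrow_value_Comp: "b \<in> Hom (path_category E) W Z \<Longrightarrow> Z \<in> Fpow E \<Longrightarrow>
      arrow_value (Comp (path_category E) U W Z b a) = of_bool (no_backtrack U W Z) * arrow_value b * arrow_value a"
  using a U W
  by (auto simp: Hom_path_category HScale_path_class HAdd_path_class Comp_path_class arrow_value_class path_space_scale
      path_space_add path_value_scale path_value_add path_space_comp path_value_comp)

lemma Ident_path_Hom: "U \<in> Fpow E \<Longrightarrow> Ident (path_category E) U \<in> Hom (path_category E) U U"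
  by (auto intro!: imageI path_space_single simp: quiver_paths_def Hom_path_category Ident_path_category)

lemma arrow_value_Ident: "U \<in> Fpow E \<Longrightarrow> arrow_value (Ident (path_category E) U) = 1"
  by (simp add: arrow_value_class path_space_single quiver_paths_def Ident_path_category)

text \<open>The class is independent of the choice of geodesic and spans the arrows from
  \<open>U\<close> to \<open>W\<close>: it is the arrow of value 1.\<close>

definition basic_arrow :: "'i set \<Rightarrow> 'i set \<Rightarrow> 'i set \<Rightarrow> ('i set list \<Rightarrow>\<^sub>0 'k::comm_ring_1) set" where
  "basic_arrow E U W = path_class E U W (Poly_Mapping.single (geodesic E U W) 1)"

lemma basic_arrow:
  assumes U: "U \<in> Fpow E" and W: "W \<in> Fpow E"
  shows basic_arrow_Hom: "basic_arrow E U W \<in> Hom (path_category E) U W"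
    and arrow_value_basic: "arrow_value (basic_arrow E U W) = (1 :: 'k::comm_ring_1)"
  using geodesic[OF assms] U W by (auto simp: basic_arrow_def path_space_single arrow_value_class Hom_path_category)

lemma arrow_eq_HScale_basic:
  assumes U: "U \<in> Fpow E" and W: "W \<in> Fpow E" and a: "a \<in> Hom (path_category E) U W"
  shows "a = HScale (path_category E) U W (arrow_value a) (basic_arrow E U W)"
  by (intro path_category_Hom_eqI[OF U W a] HScale_Hom[OF U W basic_arrow_Hom[OF U W]])
    (simp add: arrow_value_HScale[OF U W basic_arrow_Hom[OF U W]] arrow_value_basic[OF U W])

lemma basic_arrow_Ident: "U \<in> Fpow E \<Longrightarrow> basic_arrow E U U = Ident (path_category E) U"
  by (intro path_category_Hom_eqI[of U E U] basic_arrow_Hom Ident_path_Hom)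
    (simp_all add: arrow_value_basic arrow_value_Ident)

section \<open>Weight modules and corners\<close>

lemma lmod_homD:
  assumes "f \<in> lmod_hom R M N"
  shows lmod_hom_closed: "x \<in> carrier M \<Longrightarrow> f x \<in> carrier N"
    and lmod_hom_add: "x \<in> carrier M \<Longrightarrow> y \<in> carrier M \<Longrightarrow> f (x \<oplus>\<^bsub>M\<^esub> y) = f x \<oplus>\<^bsub>N\<^esub> f y"
    and lmod_hom_smult: "a \<in> carrier R \<Longrightarrow> x \<in> carrier M \<Longrightarrow> f (a \<odot>\<^bsub>M\<^esub> x) = a \<odot>\<^bsub>N\<^esub> f x"
    and lmod_hom_extensional: "f \<in> extensional (carrier M)"
  using assms by (auto simp: lmod_hom_def PiE_def)

lemma lmod_homI:
  assumes "f \<in> extensional (carrier M)" "\<And>x. x \<in> carrier M \<Longrightarrow> f x \<in> carrier N"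
    "\<And>x y. x \<in> carrier M \<Longrightarrow> y \<in> carrier M \<Longrightarrow> f (x \<oplus>\<^bsub>M\<^esub> y) = f x \<oplus>\<^bsub>N\<^esub> f y"
    "\<And>a x. a \<in> carrier R \<Longrightarrow> x \<in> carrier M \<Longrightarrow> f (a \<odot>\<^bsub>M\<^esub> x) = a \<odot>\<^bsub>N\<^esub> f x"
  shows "f \<in> lmod_hom R M N"
  using assms by (auto simp: lmod_hom_def PiE_def)

text \<open>The closure properties shared by left modules and vector spaces, so that the category
  axioms for linear maps are verified once for both.\<close>

definition lmod_stable :: "('r, 'z) ring_scheme \<Rightarrow> ('r, 'm) module \<Rightarrow> bool" where
  "lmod_stable R M \<longleftrightarrow> (\<forall>x\<in>carrier M. \<forall>y\<in>carrier M. x \<oplus>\<^bsub>M\<^esub> y \<in> carrier M) \<and>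
     (\<forall>a\<in>carrier R. \<forall>x\<in>carrier M. a \<odot>\<^bsub>M\<^esub> x \<in> carrier M)"

lemma lmod_stable_left_module: "left_module R M \<Longrightarrow> lmod_stable R M"
  unfolding lmod_stable_def
  by (auto intro: left_module.smult_closed abelian_groupE(1)[OF left_module.axioms(2)])

lemma lmod_stable_module: "Module.module R M \<Longrightarrow> lmod_stable R M"
  unfolding lmod_stable_def
  by (auto intro: module.smult_closed abelian_groupE(1)[OF module.axioms(2)])

lemma lmod_hom_id: "lmod_stable R M \<Longrightarrow> (\<lambda>x\<in>carrier M. x) \<in> lmod_hom R M M"
  by (rule lmod_homI) (auto simp: lmod_stable_def)

lemma lmod_hom_compose:
  assumes "lmod_stable R M" "f \<in> lmod_hom R M N" "g \<in> lmod_hom R N P"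
  shows "compose (carrier M) g f \<in> lmod_hom R M P"
  by (rule lmod_homI)
    (use assms in \<open>auto simp: compose_def lmod_stable_def lmod_hom_closed lmod_hom_add lmod_hom_smult\<close>)

lemma is_category_lmod_hom:
  assumes "\<And>M. M \<in> Obj C \<Longrightarrow> lmod_stable R M"
    and "Hom C = lmod_hom R" "Ident C = (\<lambda>M. \<lambda>x\<in>carrier M. x)"
    "Comp C = (\<lambda>M N P g f. compose (carrier M) g f)"
  shows "is_category C"
proof -
  have "compose (carrier M) f (\<lambda>x\<in>carrier M. x) = f" "compose (carrier M) (\<lambda>x\<in>carrier N. x) f = f"
    if "f \<in> lmod_hom R M N" for f M N
    using that by (auto simp: compose_def fun_eq_iff lmod_hom_closed
        extensional_arb[OF lmod_hom_extensional[OF that]])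
  moreover have "compose (carrier M) h (compose (carrier M) g f) = compose (carrier M) (compose (carrier N) h g) f"
    if "f \<in> lmod_hom R M N" for f g h M N
    using that by (auto simp: compose_def fun_eq_iff lmod_hom_closed)
  ultimately show ?thesis
    unfolding is_category_def using assms by (auto intro: lmod_hom_id lmod_hom_compose)
qed

lemma is_category_lmod_category: "is_category (lmod_category R)"
  by (rule is_category_lmod_hom[where R = R]) (auto simp: lmod_category_def lmod_stable_left_module)

lemma is_category_vect_category: "is_category vect_category"
  by (rule is_category_lmod_hom[where R = scalar_ring]) (auto simp: vect_category_def lmod_stable_module)

lemma is_category_full_subcategory: "is_category C \<Longrightarrow> is_category (full_subcategory C P)"
  unfolding is_category_def full_subcategory_def by simp

lemma is_category_lin_functor_category:
  assumes D: "is_category D"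
  shows "is_category (lin_functor_category C D)"
proof -
  have F: "is_functor C D F" if "is_lin_functor C D F" for F
    using that by (simp add: is_lin_functor_def)
  have comp: "is_nat_trans C D F H (\<lambda>X\<in>Obj C. Comp D (fobj F X) (fobj G X) (fobj H X) (\<theta> X) (\<eta> X))"
    if "is_functor C D F" "is_functor C D G" "is_functor C D H" "is_nat_trans C D F G \<eta>" "is_nat_trans C D G H \<theta>"
    for F G H \<eta> \<theta>
    unfolding is_nat_trans_def
  proof (intro conjI ballI)
    fix X Y f assume X: "X \<in> Obj C" and Y: "Y \<in> Obj C" and f: "f \<in> Hom C X Y"
    note o = fobj_Obj[OF that(1) X] fobj_Obj[OF that(2) X] fobj_Obj[OF that(3) X]
      fobj_Obj[OF that(1) Y] fobj_Obj[OF that(2) Y] fobj_Obj[OF that(3) Y]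
    note m = fmap_Hom[OF that(1) f X Y] fmap_Hom[OF that(2) f X Y] fmap_Hom[OF that(3) f X Y]
    have n: "\<eta> X \<in> Hom D (fobj F X) (fobj G X)" "\<theta> X \<in> Hom D (fobj G X) (fobj H X)"
      "\<eta> Y \<in> Hom D (fobj F Y) (fobj G Y)" "\<theta> Y \<in> Hom D (fobj G Y) (fobj H Y)"
      using that X Y by (auto simp: is_nat_trans_def)
    have e: "Comp D (fobj F X) (fobj F Y) (fobj G Y) (\<eta> Y) (fmap F X Y f)
          = Comp D (fobj F X) (fobj G X) (fobj G Y) (fmap G X Y f) (\<eta> X)"
      "Comp D (fobj G X) (fobj G Y) (fobj H Y) (\<theta> Y) (fmap G X Y f)
          = Comp D (fobj G X) (fobj H X) (fobj H Y) (fmap H X Y f) (\<theta> X)"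
      using that X Y f by (auto simp: is_nat_trans_def)
    show "Comp D (fobj F X) (fobj F Y) (fobj H Y)
        ((\<lambda>X\<in>Obj C. Comp D (fobj F X) (fobj G X) (fobj H X) (\<theta> X) (\<eta> X)) Y) (fmap F X Y f) =
       Comp D (fobj F X) (fobj H X) (fobj H Y) (fmap H X Y f)
        ((\<lambda>X\<in>Obj C. Comp D (fobj F X) (fobj G X) (fobj H X) (\<theta> X) (\<eta> X)) X)"
      using Comp_assoc[OF D m(1) n(3) n(4) o(1) o(4) o(5) o(6)] Comp_assoc[OF D n(1) m(2) n(4) o(1) o(2) o(5) o(6)]
        Comp_assoc[OF D n(1) n(2) m(3) o(1) o(2) o(3) o(6)]
      by (simp add: X Y e)
  qed (use that in \<open>auto simp: is_nat_trans_def intro!: Comp_Hom[OF D] dest: fobj_Obj\<close>)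
  have hom: "\<eta> X \<in> Hom D (fobj F X) (fobj G X)" if "is_nat_trans C D F G \<eta>" "X \<in> Obj C" for F G \<eta> X
    using that by (simp add: is_nat_trans_def)
  show ?thesis
    unfolding is_category_def
  proof (intro conjI ballI)
    fix F assume "F \<in> Obj (lin_functor_category C D)"
    then have FF: "is_functor C D F" by (simp add: lin_functor_category_def F)
    show "Ident (lin_functor_category C D) F \<in> Hom (lin_functor_category C D) F F"
      using FF by (auto simp: lin_functor_category_def is_nat_trans_def Ident_Hom[OF D] fobj_Obj
          Comp_Ident_left[OF D] Comp_Ident_right[OF D] fmap_Hom)
    fix G \<eta> assume "G \<in> Obj (lin_functor_category C D)" "\<eta> \<in> Hom (lin_functor_category C D) F G"
    then have FG: "is_functor C D G" and e: "\<eta> \<in> extensional (Obj C)" and nt: "is_nat_trans C D F G \<eta>"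
      by (simp_all add: lin_functor_category_def F)
    note h = hom[OF nt] 
    show "Comp (lin_functor_category C D) F F G \<eta> (Ident (lin_functor_category C D) F) = \<eta>"
      "Comp (lin_functor_category C D) F G G (Ident (lin_functor_category C D) G) \<eta> = \<eta>"
      using h Comp_Ident_left[OF D h] Comp_Ident_right[OF D h] fobj_Obj[OF FF] fobj_Obj[OF FG]
      by (auto simp: lin_functor_category_def fun_eq_iff extensional_arb[OF e])
    fix H \<theta> assume "H \<in> Obj (lin_functor_category C D)" "\<theta> \<in> Hom (lin_functor_category C D) G H"
    then have FH: "is_functor C D H" and e': "\<theta> \<in> extensional (Obj C)" and nt': "is_nat_trans C D G H \<theta>"
      by (simp_all add: lin_functor_category_def F)
    show "Comp (lin_functor_category C D) F G H \<theta> \<eta> \<in> Hom (lin_functor_category C D) F H"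
      using comp[OF FF FG FH nt nt'] by (simp add: lin_functor_category_def)
    fix K \<kappa> assume "K \<in> Obj (lin_functor_category C D)" "\<kappa> \<in> Hom (lin_functor_category C D) H K"
    then have FK: "is_functor C D K" and nt'': "is_nat_trans C D H K \<kappa>"
      by (simp_all add: lin_functor_category_def F)
    show "Comp (lin_functor_category C D) F H K \<kappa> (Comp (lin_functor_category C D) F G H \<theta> \<eta>) =
      Comp (lin_functor_category C D) F G K (Comp (lin_functor_category C D) G H K \<kappa> \<theta>) \<eta>"
      using Comp_assoc[OF D hom[OF nt] hom[OF nt'] hom[OF nt'']] fobj_Obj[OF FF] fobj_Obj[OF FG]
        fobj_Obj[OF FH] fobj_Obj[OF FK]
      by (auto simp: lin_functor_category_def fun_eq_iff)
  qed
qed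

text \<open>Replaces field-valued integral vectors by integer exponents, chosen coordinatewise;
  injectivity of \<open>of_int\<close> keeps the support finite.\<close>

lemma weight_image:
  "{\<lambda>i. p i + v i |v. v \<in> finite_integral_vectors} = range (weight (p :: 'i \<Rightarrow> 'k::ring_char_0))"
proof (intro equalityI subsetI)
  fix q assume "q \<in> {\<lambda>i. p i + v i |v. v \<in> finite_integral_vectors}"
  then obtain v where v: "q = (\<lambda>i. p i + v i)" "\<And>i. v i \<in> \<int>" "finite {i. v i \<noteq> 0}"
    by (auto simp: finite_integral_vectors_def)
  then have "\<forall>i. \<exists>n. v i = of_int n" by (auto elim: Ints_cases)
  then obtain n where n: "\<And>i. v i = of_int (n i)" by metis
  with v(3) have "finite {i. n i \<noteq> 0}" by simp
  then have "q = weight p (Abs_poly_mapping n)" by (simp add: v(1) weight_def n)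
  then show "q \<in> range (weight p)" by blast
next
  fix q assume "q \<in> range (weight p)"
  then obtain v where v: "q = weight p v" by blast
  then show "q \<in> {\<lambda>i. p i + v i |v. v \<in> finite_integral_vectors}"
    unfolding mem_Collect_eq
    by (intro exI[of _ "\<lambda>i. of_int (Poly_Mapping.lookup v i)"]) (simp add: weight_def finite_integral_vectors_def)
qed

text \<open>For integral \<open>p i\<close> this is the integer \<open>- p i - 1\<close>. For other
  \<open>i\<close> no such \<open>n\<close> exists and the value is unspecified, so its uses are
  confined to integral indices.\<close>

definition zero_wall :: "('i \<Rightarrow> 'k::ring_char_0) \<Rightarrow> 'i \<Rightarrow> int" where
  "zero_wall p i = (THE n. p i + of_int n + 1 = 0)"

lemma wall_weight_zero_iff:
  "wall_weight p (i, n) = 0 \<longleftrightarrow> i \<in> integral_indices p \<and> n = zero_wall p i"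
proof -
  have uniq: "n = m" if "p i + of_int n + 1 = 0" "p i + of_int m + 1 = 0" for n m
    using that by (metis add_left_cancel add_right_cancel of_int_eq_iff)
  have ex: "\<exists>n. p i + of_int n + 1 = 0" if "i \<in> integral_indices p"
  proof -
    from that obtain m where "p i = of_int m" by (auto simp: integral_indices_def elim: Ints_cases)
    then show ?thesis by (intro exI[of _ "- m - 1"]) simp
  qed
  have "i \<in> integral_indices p" if "p i + of_int n + 1 = 0"
  proof -
    have "p i = of_int (- n - 1)" using that by (simp add: algebra_simps eq_neg_iff_add_eq_0)
    then show ?thesis by (simp only: integral_indices_def mem_Collect_eq Ints_of_int)
  qed
  moreover have zw: "zero_wall p i = n" if "p i + of_int n + 1 = 0" for n
    unfolding zero_wall_def using that uniq by blast
  moreover have "p i + of_int (zero_wall p i) + 1 = 0" if "i \<in> integral_indices p"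
    using ex[OF that] zw by metis
  ultimately show ?thesis by (auto simp: wall_weight_def)
qed

section \<open>Vertices and their corner weights\<close>

definition vertex :: "('i \<Rightarrow> 'k::ring_char_0) \<Rightarrow> ('i \<Rightarrow>\<^sub>0 int) \<Rightarrow> 'i set" where
  "vertex p v = {i \<in> integral_indices p. (i, zero_wall p i) \<in> walls 0 v}"

text \<open>
  The weights \<open>corner p U\<close> represent the vertices; each of their coordinates takes only two values,
  so that \<open>backtrack\<close> is \<open>0\<close> or \<open>1\<close> on them.
\<close>

definition corner :: "('i \<Rightarrow> 'k::ring_char_0) \<Rightarrow> 'i set \<Rightarrow> 'i \<Rightarrow>\<^sub>0 int" where
  "corner p U = Abs_poly_mapping (\<lambda>i. if i \<in> U then
     (if 0 \<le> zero_wall p i then zero_wall p i + 1 else zero_wall p i) else 0)"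

text \<open>The nonzero choice is the lattice point next to the zero wall on the side away from 0. A
  wall \<open>n\<close> with \<open>0 \<le> n\<close> is crossed upwards, ending at
  \<open>n + 1\<close>; a wall with negative \<open>n\<close> is crossed downwards, ending at
  \<open>n\<close>, which lies below the wall.\<close>

lemma lookup_corner:
  assumes "U \<in> Fpow (integral_indices p)"
  shows "Poly_Mapping.lookup (corner p U) i = (if i \<in> U then
     (if 0 \<le> zero_wall p i then zero_wall p i + 1 else zero_wall p i) else 0)"
proof -
  have "finite {i. (if i \<in> U then (if 0 \<le> zero_wall p i then zero_wall p i + 1 else zero_wall p i) else 0) \<noteq> 0}"
    by (rule finite_subset[of _ U]) (use assms in \<open>auto simp: Fpow_def\<close>)
  then show ?thesis by (simp add: corner_def)
qed

lemma vertex_Fpow: "vertex p v \<in> Fpow (integral_indices p)"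
proof -
  have "vertex p v \<subseteq> fst ` walls 0 v" by (force simp: vertex_def)
  then have "finite (vertex p v)" by (rule finite_subset) (intro finite_imageI finite_walls)
  then show ?thesis by (auto simp: Fpow_def vertex_def)
qed

lemma vertex_corner: "U \<in> Fpow (integral_indices p) \<Longrightarrow> vertex p (corner p U) = U"
  by (auto simp: vertex_def walls_def lookup_corner Fpow_def split: if_splits)

lemma sym_diff_vertex:
  "sym_diff (vertex p u) (vertex p v) = {i \<in> integral_indices p. (i, zero_wall p i) \<in> walls u v}"
  by (auto simp: vertex_def walls_def)

text \<open>A finite product vanishes exactly when a factor does, and a wall weight vanishes only at
  the zero wall of an integral index; these are the walls that vertices record.\<close>

lemma backtrack_nonzero_iff:
  "backtrack (p :: 'i \<Rightarrow> 'k::field_char_0) u v w \<noteq> 0 \<longleftrightarrow> no_backtrack (vertex p u) (vertex p v) (vertex p w)"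
proof -
  have "backtrack p u v w = 0 \<longleftrightarrow> (\<exists>e\<in>walls u v \<inter> walls v w. wall_weight p e = 0)"
    by (simp add: backtrack_def finite_walls)
  also have "\<dots> \<longleftrightarrow> (\<exists>i. (i, zero_wall p i) \<in> walls u v \<inter> walls v w \<and> i \<in> integral_indices p)"
    using wall_weight_zero_iff[of p] by fastforce
  also have "\<dots> \<longleftrightarrow> \<not> no_backtrack (vertex p u) (vertex p v) (vertex p w)"
    unfolding no_backtrack_def sym_diff_vertex by blast
  finally show ?thesis by blast
qed

text \<open>Corners differ only in coordinates where their vertices differ. If no flip is undone,
  the two legs therefore share no wall at all, so the product is empty and equals 1, not merely
  nonzero.\<close>

lemma backtrack_corner:
  fixes p :: "'i \<Rightarrow> 'k::field_char_0"
  assumes U: "U \<in> Fpow (integral_indices p)" and W: "W \<in> Fpow (integral_indices p)" and Z: "Z \<in> Fpow (integral_indices p)"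
  shows "backtrack p (corner p U) (corner p W) (corner p Z) = of_bool (no_backtrack U W Z)"
proof (cases "no_backtrack U W Z")
  case True
  have "i \<in> sym_diff U W" if "(i, n) \<in> walls (corner p U) (corner p W)" "U \<in> Fpow (integral_indices p)" "W \<in> Fpow (integral_indices p)" for i n U W
    using that by (auto simp: walls_def lookup_corner split: if_splits)
  with U W Z True have "walls (corner p U) (corner p W) \<inter> walls (corner p W) (corner p Z) = {}"
    unfolding no_backtrack_def by fast
  then show ?thesis using True by (simp add: backtrack_disjoint)
next
  case False
  then show ?thesis using backtrack_nonzero_iff[of p "corner p U" "corner p W" "corner p Z"] vertex_corner[OF U] vertex_corner[OF W] vertex_corner[OF Z]
    by simp
qed

abbreviation base :: "('i \<Rightarrow> 'k::ring_char_0) \<Rightarrow> ('i \<Rightarrow>\<^sub>0 int) \<Rightarrow> 'i \<Rightarrow>\<^sub>0 int" where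
  "base p v \<equiv> corner p (vertex p v)"

abbreviation base_factor :: "('i \<Rightarrow> 'k::field_char_0) \<Rightarrow> ('i \<Rightarrow>\<^sub>0 int) \<Rightarrow> 'k" where
  "base_factor p v \<equiv> backtrack p (base p v) v (base p v)"

text \<open>A weight and its corner lie over the same vertex, so the round trip crosses no zero
  wall.\<close>

lemma base_factor_nonzero: "base_factor p v \<noteq> 0"
  unfolding backtrack_nonzero_iff vertex_corner[OF vertex_Fpow] by simp

locale weight_module_at = weyl_module_at M p
  for M :: "('i, 'k::field_char_0, 'm) weyl_module" and p :: "'i \<Rightarrow> 'k" +
  assumes weight_module: "is_weight_module M"
    and weight_supp: "weight_supp M \<subseteq> range (weight p)"

lemma weight_category_at_Obj:
  "M \<in> Obj (weight_category_at p) \<longleftrightarrow> weight_module_at M p"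
  by (auto simp: weight_category_at_def weight_category_def full_subcategory_def lmod_category_def weight_image
      weight_module_at_def weyl_module_at_def weyl_left_module_def weight_module_at_axioms_def)

lemma weight_category_at_simps [simp]:
  "Hom (weight_category_at p) = lmod_hom weyl_algebra"
  "Ident (weight_category_at p) = (\<lambda>M. \<lambda>x\<in>carrier M. x)"
  "Comp (weight_category_at p) = (\<lambda>M N P g f. compose (carrier M) g f)"
  by (simp_all add: weight_category_at_def weight_category_def full_subcategory_def lmod_category_def)

lemma vect_category_simps [simp]:
  "Obj vect_category = {V. Module.module scalar_ring V}"
  "Hom vect_category = lmod_hom scalar_ring"
  "Ident vect_category = (\<lambda>V. \<lambda>x\<in>carrier V. x)"
  "Comp vect_category = (\<lambda>V W Z g f. compose (carrier V) g f)"
  "HAdd vect_category = (\<lambda>V W f g. \<lambda>x\<in>carrier V. f x \<oplus>\<^bsub>W\<^esub> g x)"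
  "HScale vect_category = (\<lambda>V W c f. \<lambda>x\<in>carrier V. c \<odot>\<^bsub>W\<^esub> f x)"
  by (simp_all add: vect_category_def)

lemma is_category_weight_category_at: "is_category (weight_category_at p)"
  unfolding weight_category_at_def weight_category_def
  by (intro is_category_full_subcategory is_category_lmod_category)

lemma is_category_path_module_category: "is_category (path_module_category E)"
  unfolding path_module_category_def
  by (intro is_category_lin_functor_category is_category_vect_category)

section \<open>Decomposition into weight components\<close>

context weight_module_at
begin

definition component :: "'m \<Rightarrow> ('i \<Rightarrow>\<^sub>0 int) \<Rightarrow> 'm" where
  "component x v = (THE f. (\<forall>q. f q \<in> weight_space M q) \<and> finite {q. f q \<noteq> \<zero>\<^bsub>M\<^esub>} \<and>
        x = finsum M f {q. f q \<noteq> \<zero>\<^bsub>M\<^esub>}) (weight p v)"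

text \<open>Uniqueness in the definition of a weight module concerns families over all weights,
  summed over their exact support. The finite family \<open>g\<close>, which may take the value
  zero, is therefore extended by zero and moved to weights along the injective map
  \<open>weight p\<close>.\<close>

lemma component_eqI:
  assumes S: "finite S" and g: "\<And>v. v \<in> S \<Longrightarrow> g v \<in> W v" and x: "x = finsum M g S"
  shows "component x v = (if v \<in> S then g v else \<zero>\<^bsub>M\<^esub>)"
proof -
  define f where "f q = (if q \<in> weight p ` S then g (the_inv (weight p) q) else \<zero>\<^bsub>M\<^esub>)" for q
  have inj: "inj (weight p)" by (auto intro: injI)
  have f: "f (weight p v) = (if v \<in> S then g v else \<zero>\<^bsub>M\<^esub>)" for v
    using inj by (auto simp: f_def the_inv_f_f)
  have fW: "f q \<in> weight_space M q" for q
    using g inj by (auto simp: f_def the_inv_f_f weight_space_zero)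
  have sub: "{q. f q \<noteq> \<zero>\<^bsub>M\<^esub>} \<subseteq> weight p ` S" by (auto simp: f_def)
  have fin: "finite {q. f q \<noteq> \<zero>\<^bsub>M\<^esub>}" using sub S by (auto intro: finite_subset)
  have "finsum M f {q. f q \<noteq> \<zero>\<^bsub>M\<^esub>} = finsum M f (weight p ` S)"
    by (rule M.add.finprod_mono_neutral_cong_left) (use sub S fW weight_space_closed in auto)
  also have "\<dots> = finsum M (\<lambda>v. f (weight p v)) S"
    by (rule M.finsum_reindex) (use fW weight_space_closed in \<open>auto intro: inj_onI\<close>)
  also have "\<dots> = finsum M g S"
    by (rule M.finsum_cong') (use g weight_space_closed in \<open>auto simp: f\<close>)
  finally have xf: "x = finsum M f {q. f q \<noteq> \<zero>\<^bsub>M\<^esub>}" by (simp add: x)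
  have "x \<in> carrier M" unfolding x by (rule M.finsum_closed) (use g weight_space_closed in auto)
  then have ex1: "\<exists>!f. (\<forall>q. f q \<in> weight_space M q) \<and> finite {q. f q \<noteq> \<zero>\<^bsub>M\<^esub>} \<and>
        x = finsum M f {q. f q \<noteq> \<zero>\<^bsub>M\<^esub>}"
    using weight_module by (simp add: is_weight_module_def)
  have "(THE f. (\<forall>q. f q \<in> weight_space M q) \<and> finite {q. f q \<noteq> \<zero>\<^bsub>M\<^esub>} \<and>
        x = finsum M f {q. f q \<noteq> \<zero>\<^bsub>M\<^esub>}) = f"
    using fW fin xf by (intro the1_equality[OF ex1]) auto
  then show ?thesis by (simp add: component_def f)
qed

lemma ex_decomposition:
  assumes "x \<in> carrier M"
  shows "\<exists>S g. finite S \<and> (\<forall>v\<in>S. g v \<in> W v) \<and> x = finsum M g S"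
proof -
  obtain f where f: "\<And>q. f q \<in> weight_space M q" "finite {q. f q \<noteq> \<zero>\<^bsub>M\<^esub>}" "x = finsum M f {q. f q \<noteq> \<zero>\<^bsub>M\<^esub>}"
    using weight_module assms unfolding is_weight_module_def by blast
  let ?Q = "{q. f q \<noteq> \<zero>\<^bsub>M\<^esub>}"
  define S where "S = {v. weight p v \<in> ?Q}"
  have inj: "inj (weight p)" by (auto intro: injI)
  have "?Q \<subseteq> weight_supp M" using f(1) by (auto simp: weight_supp_def)
  then have Q: "?Q = weight p ` S" using weight_supp by (auto simp: S_def)
  have "finite S" using f(2) unfolding Q by (rule finite_imageD) (use inj in \<open>auto intro: inj_on_subset\<close>)
  moreover have "x = finsum M (\<lambda>v. f (weight p v)) S"
    unfolding f(3) Q by (rule M.finsum_reindex) (use f(1) weight_space_closed in \<open>auto intro: inj_onI\<close>)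
  ultimately show ?thesis
    using f(1) by (intro exI[of _ S] exI[of _ "\<lambda>v. f (weight p v)"]) simp
qed

lemma component:
  assumes "x \<in> carrier M"
  shows component_weight: "component x v \<in> W v"
    and finite_component: "finite {v. component x v \<noteq> \<zero>\<^bsub>M\<^esub>}"
    and component_sum: "finite S \<Longrightarrow> {v. component x v \<noteq> \<zero>\<^bsub>M\<^esub>} \<subseteq> S \<Longrightarrow> x = finsum M (component x) S"
proof -
  obtain T g where T: "finite T" "\<And>v. v \<in> T \<Longrightarrow> g v \<in> W v" "x = finsum M g T"
    using ex_decomposition[OF assms] by blast
  note c = component_eqI[OF T]
  show W: "component x v \<in> W v" for v using T(2) by (simp add: c weight_space_zero)
  show "finite {v. component x v \<noteq> \<zero>\<^bsub>M\<^esub>}" by (rule finite_subset[OF _ T(1)]) (auto simp: c)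
  assume S: "finite S" "{v. component x v \<noteq> \<zero>\<^bsub>M\<^esub>} \<subseteq> S"
  have off: "component x v = \<zero>\<^bsub>M\<^esub>" if "v \<notin> T" for v using that by (simp add: c)
  have cl: "component x v \<in> carrier M" for v using W by (rule weight_space_closed)
  have "x = finsum M (component x) T"
    unfolding T(3) by (rule M.finsum_cong') (use weight_space_closed[OF T(2)] c in \<open>auto simp flip: T(3)\<close>)
  also have "\<dots> = finsum M (component x) (S \<union> T)"
    by (rule M.add.finprod_mono_neutral_cong_left) (use S T(1) off cl in auto)
  also have "\<dots> = finsum M (component x) S"
    by (rule M.add.finprod_mono_neutral_cong_right) (use S T(1) off cl in auto)
  finally show "x = finsum M (component x) S" .
qed

lemma component_of_weight:
  assumes "x \<in> W v"
  shows "component x w = (if w = v then x else \<zero>\<^bsub>M\<^esub>)"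
  using component_eqI[of "{v}" "\<lambda>_. x" x w] assms weight_space_closed by simp

lemma component_add:
  assumes "x \<in> carrier M" "y \<in> carrier M"
  shows "component (x \<oplus>\<^bsub>M\<^esub> y) v = component x v \<oplus>\<^bsub>M\<^esub> component y v"
proof -
  let ?S = "{v. component x v \<noteq> \<zero>\<^bsub>M\<^esub>} \<union> {v. component y v \<noteq> \<zero>\<^bsub>M\<^esub>}"
  have S: "finite ?S" using assms by (simp add: finite_component)
  have cl: "component x v \<in> carrier M" "component y v \<in> carrier M" for v
    using component_weight weight_space_closed assms by blast+
  have "x \<oplus>\<^bsub>M\<^esub> y = finsum M (\<lambda>v. component x v \<oplus>\<^bsub>M\<^esub> component y v) ?S"
    using component_sum[OF assms(1) S] component_sum[OF assms(2) S] cl by (simp add: M.finsum_addf)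
  from component_eqI[OF S _ this, of v] show ?thesis
    using assms by (auto simp: component_weight weight_space_add)
qed

text \<open>Weight vectors generate \<open>M\<close> as an abelian group. This reduces both
  faithfulness and the linearity of extended maps to weight spaces.\<close>

lemma additive_maps_eq:
  assumes N: "abelian_group N"
    and F: "\<And>x. x \<in> carrier M \<Longrightarrow> F x \<in> carrier N" "\<And>x y. x \<in> carrier M \<Longrightarrow> y \<in> carrier M \<Longrightarrow> F (x \<oplus>\<^bsub>M\<^esub> y) = F x \<oplus>\<^bsub>N\<^esub> F y"
    and G: "\<And>x y. x \<in> carrier M \<Longrightarrow> y \<in> carrier M \<Longrightarrow> G (x \<oplus>\<^bsub>M\<^esub> y) = G x \<oplus>\<^bsub>N\<^esub> G y"
    and eq: "\<And>v x. x \<in> W v \<Longrightarrow> F x = G x"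
    and x: "x \<in> carrier M"
  shows "F x = G x"
proof -
  have "F (finsum M g S) = G (finsum M g S)" if "finite S" "\<forall>v\<in>S. g v \<in> W v" for S g
    using that
  proof (induction S)
    case empty
    then show ?case using eq[OF weight_space_zero] by simp
  next
    case (insert v S)
    have "g w \<in> carrier M" if "w \<in> insert v S" for w using insert weight_space_closed that by auto
    then show ?case using insert F G eq by (auto simp: M.finsum_insert Pi_def M.finsum_closed)
  qed
  with ex_decomposition[OF x] show ?thesis by blast
qed

end

text \<open>
  The weight spaces at all \<open>v\<close> are recovered from those at the corners: on \<open>W v\<close> the two shifts to
  and from \<open>base p v\<close> are inverse to each other up to the nonzero factor \<open>base_factor p v\<close>.
\<close>

lemma (in weyl_module_at) shift_base:
  assumes "x \<in> W v"
  shows "shift M (base p v) v (shift M v (base p v) x) = base_factor p v \<odot>\<^bsub>scalars M\<^esub> x"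
  using shift_shift[OF assms, of "base p v" v] by (simp add: backtrack_swap)

lemma hom_shift:
  assumes M: "weyl_left_module M" and f: "f \<in> lmod_hom weyl_algebra M N" and x: "x \<in> carrier M"
  shows "f (shift M v w x) = shift N v w (f x)"
proof -
  interpret M: weyl_left_module M by fact
  have Y: "foldr (\<lambda>i. (\<odot>\<^bsub>M\<^esub>) (weyl_Y i)) l x \<in> carrier M \<and>
      f (foldr (\<lambda>i. (\<odot>\<^bsub>M\<^esub>) (weyl_Y i)) l x) = foldr (\<lambda>i. (\<odot>\<^bsub>N\<^esub>) (weyl_Y i)) l (f x)"
    if "x \<in> carrier M" for x l
    using that by (induction l) (auto simp: lmod_hom_smult[OF f] weyl_carrier.Y)
  have X: "foldr (\<lambda>i. (\<odot>\<^bsub>M\<^esub>) (weyl_X i)) l x \<in> carrier M \<and>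
      f (foldr (\<lambda>i. (\<odot>\<^bsub>M\<^esub>) (weyl_X i)) l x) = foldr (\<lambda>i. (\<odot>\<^bsub>N\<^esub>) (weyl_X i)) l (f x)"
    if "x \<in> carrier M" for x l
    using that by (induction l) (auto simp: lmod_hom_smult[OF f] weyl_carrier.X)
  show ?thesis using X Y x by (simp add: shift_def ordered_monomial_def)
qed

lemma hom_scalars:
  assumes "f \<in> lmod_hom weyl_algebra M N" and "x \<in> carrier M"
  shows "f (c \<odot>\<^bsub>scalars M\<^esub> x) = c \<odot>\<^bsub>scalars N\<^esub> f x"
  using lmod_hom_smult[OF assms(1) _ assms(2), of "weyl_scalar c"] by (simp add: smult_scalars weyl_scalar_closed)

lemma hom_weight_space:
  fixes M N :: "('i, 'k::field_char_0, 'm) weyl_module"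
  assumes M: "weyl_left_module M" and N: "weyl_left_module N"
    and f: "f \<in> lmod_hom weyl_algebra M N" and x: "x \<in> weight_space M q"
  shows "f x \<in> weight_space N q"
proof -
  have t: "(weyl_t i :: ('i, 'k) polys \<Rightarrow> ('i, 'k) polys) \<in> weyl_carrier" for i
    unfolding weyl_t_def by (intro weyl_carrier.intros)
  have xM: "x \<in> carrier M" and tx: "weyl_t i \<odot>\<^bsub>M\<^esub> x = weyl_scalar (q i) \<odot>\<^bsub>M\<^esub> x" for i
    using x by (auto simp: weight_space_def)
  have "weyl_t i \<odot>\<^bsub>N\<^esub> f x = weyl_scalar (q i) \<odot>\<^bsub>N\<^esub> f x" for i
    using lmod_hom_smult[OF f _ xM, of "weyl_t i"] lmod_hom_smult[OF f _ xM, of "weyl_scalar (q i)"]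
    by (simp add: t weyl_scalar_closed tx)
  then show ?thesis using lmod_hom_closed[OF f xM] by (simp add: weight_space_def)
qed

section \<open>The functor to path modules\<close>

definition weight_vect :: "('i, 'k::field, 'm) weyl_module \<Rightarrow> ('i \<Rightarrow> 'k) \<Rightarrow> ('k, 'm) module" where
  "weight_vect M q = scalars M\<lparr>carrier := weight_space M q\<rparr>"

lemma weight_vect_simps [simp]:
  "carrier (weight_vect M q) = weight_space M q" "\<zero>\<^bsub>weight_vect M q\<^esub> = \<zero>\<^bsub>M\<^esub>"
  "x \<oplus>\<^bsub>weight_vect M q\<^esub> y = x \<oplus>\<^bsub>M\<^esub> y" "c \<odot>\<^bsub>weight_vect M q\<^esub> x = c \<odot>\<^bsub>scalars M\<^esub> x"
  by (simp_all add: weight_vect_def scalars_def)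

text \<open>Arrows are cosets of path combinations, yet their value alone has to enter, because it
  is a complete invariant of the coset.\<close>

definition vertex_functor :: "('i \<Rightarrow> 'k::field_char_0) \<Rightarrow> ('i, 'k, 'm) weyl_module \<Rightarrow>
    ('i set, ('i set list \<Rightarrow>\<^sub>0 'k) set, ('k, 'm) module, 'm \<Rightarrow> 'm) cat_functor" where
  "vertex_functor p M =
     \<lparr>fobj = (\<lambda>U. weight_vect M (weight p (corner p U))),
      fmap = (\<lambda>U W a. \<lambda>x\<in>weight_space M (weight p (corner p U)).
        arrow_value a \<odot>\<^bsub>scalars M\<^esub> shift M (corner p U) (corner p W) x)\<rparr>"

definition weight_functor :: "('i \<Rightarrow> 'k::field_char_0) \<Rightarrow> (('i, 'k, 'm) weyl_module, 'm \<Rightarrow> 'm,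
    ('i set, ('i set list \<Rightarrow>\<^sub>0 'k) set, ('k, 'm) module, 'm \<Rightarrow> 'm) cat_functor,
    'i set \<Rightarrow> 'm \<Rightarrow> 'm) cat_functor" where
  "weight_functor p =
     \<lparr>fobj = vertex_functor p,
      fmap = (\<lambda>M N f. \<lambda>U\<in>Fpow (integral_indices p). restrict f (weight_space M (weight p (corner p U))))\<rparr>"

lemma (in weyl_left_module) module_weight_vect: "Module.module scalar_ring (weight_vect M q)"
proof (rule moduleI[OF cring_scalar_ring])
  show "abelian_group (weight_vect M q)"
  proof (rule abelian_groupI)
    fix x assume x: "x \<in> carrier (weight_vect M q)"
    have "(-1) \<odot>\<^bsub>scalars M\<^esub> x \<oplus>\<^bsub>M\<^esub> x = \<zero>\<^bsub>M\<^esub>"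
      using rep.smult_add_left[of x "-1" 1] rep.smult_1[of x] rep.smult_0_left[of x] weight_space_closed x by simp
    then show "\<exists>y\<in>carrier (weight_vect M q). y \<oplus>\<^bsub>weight_vect M q\<^esub> x = \<zero>\<^bsub>weight_vect M q\<^esub>"
      using x by (intro bexI[of _ "(-1) \<odot>\<^bsub>scalars M\<^esub> x"]) (auto intro: weight_space_smult)
  qed (auto simp: weight_space_add weight_space_zero M.add.m_ac dest!: weight_space_closed)
qed (use rep.smult_add_left rep.smult_add_right rep.smult_smult rep.smult_1 in
    \<open>auto simp: weight_space_smult weight_space_closed\<close>)

text \<open>Functoriality is the agreement of two composition laws: arrows compose with the factor
  of \<open>arrow_value_Comp\<close>, shifts between corners with that of
  \<open>backtrack_corner\<close>, and both test \<open>no_backtrack\<close>.\<close>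

lemma (in weyl_module_at) is_lin_functor_vertex_functor:
  "is_lin_functor (path_category (integral_indices p)) vect_category (vertex_functor p M)"
  unfolding is_lin_functor_def is_functor_def
proof (intro conjI ballI allI)
  let ?C = "path_category (integral_indices p) :: ('i set, ('i set list \<Rightarrow>\<^sub>0 'k) set, 'k) lin_category"
  let ?F = "vertex_functor p M" and ?c = "corner p"
  fix U assume U': "U \<in> Obj ?C"
  then have U: "U \<in> Fpow (integral_indices p)" by simp
  show "fobj ?F U \<in> Obj vect_category" by (simp add: vertex_functor_def module_weight_vect)
  show "fmap ?F U U (Ident ?C U) = Ident vect_category (fobj ?F U)"
    using U rep.smult_1 by (auto simp: vertex_functor_def arrow_value_Ident fun_eq_iff weight_space_closed)
  fix W assume W': "W \<in> Obj ?C"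
  then have W: "W \<in> Fpow (integral_indices p)" by simp
  fix a assume a: "a \<in> Hom ?C U W"
  show "fmap ?F U W a \<in> Hom vect_category (fobj ?F U) (fobj ?F W)"
    unfolding vect_category_simps
  proof (rule lmod_homI)
    fix x y assume "x \<in> carrier (fobj ?F U)" "y \<in> carrier (fobj ?F U)"
    then show "fmap ?F U W a (x \<oplus>\<^bsub>fobj ?F U\<^esub> y) = fmap ?F U W a x \<oplus>\<^bsub>fobj ?F W\<^esub> fmap ?F U W a y"
      using rep.smult_add_right
      by (simp add: vertex_functor_def weight_space_add shift_add weight_space_closed shift_closed)
  next
    fix c x assume "x \<in> carrier (fobj ?F U)"
    then show "fmap ?F U W a (c \<odot>\<^bsub>fobj ?F U\<^esub> x) = c \<odot>\<^bsub>fobj ?F W\<^esub> fmap ?F U W a x"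
      using rep.smult_smult
      by (simp add: vertex_functor_def weight_space_smult shift_smult weight_space_closed shift_closed mult.commute)
  qed (auto simp: vertex_functor_def weight_space_smult shift_weight)
  show "fmap ?F U W (HScale ?C U W c a) = HScale vect_category (fobj ?F U) (fobj ?F W) c (fmap ?F U W a)" for c
    using rep.smult_smult
    by (auto simp: vertex_functor_def arrow_value_HScale[OF U W a] fun_eq_iff weight_space_closed shift_closed)
  show "fmap ?F U W (HAdd ?C U W a b) = HAdd vect_category (fobj ?F U) (fobj ?F W) (fmap ?F U W a) (fmap ?F U W b)"
    if b: "b \<in> Hom ?C U W" for b
    using rep.smult_add_left
    by (auto simp: vertex_functor_def arrow_value_HAdd[OF U W a b] fun_eq_iff weight_space_closed shift_closed)
  fix Z b assume Z': "Z \<in> Obj ?C" and b: "b \<in> Hom ?C W Z"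
  then have Z: "Z \<in> Fpow (integral_indices p)" by simp
  have "(arrow_value b * arrow_value a * of_bool (no_backtrack U W Z)) \<odot>\<^bsub>scalars M\<^esub> shift M (?c U) (?c Z) x =
    arrow_value b \<odot>\<^bsub>scalars M\<^esub> shift M (?c W) (?c Z) (arrow_value a \<odot>\<^bsub>scalars M\<^esub> shift M (?c U) (?c W) x)"
    if x: "x \<in> weight_space M (weight p (?c U))" for x
    using rep.smult_smult shift_shift[OF x] shift_smult weight_space_closed[OF x] shift_closed rep.smult_closed'
    by (simp add: backtrack_corner[OF U W Z] mult.assoc)
  then show "fmap ?F U Z (Comp ?C U W Z b a) =
     Comp vect_category (fobj ?F U) (fobj ?F W) (fobj ?F Z) (fmap ?F W Z b) (fmap ?F U W a)"
    by (auto simp: vertex_functor_def arrow_value_Comp[OF U W a b Z] compose_def fun_eq_iff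
        weight_space_smult shift_weight mult.commute mult.left_commute)
qed

lemma path_module_category_simps:
  "F \<in> Obj (path_module_category E) \<longleftrightarrow> is_lin_functor (path_category E) vect_category F"
  "\<eta> \<in> Hom (path_module_category E) F G \<longleftrightarrow> \<eta> \<in> extensional (Fpow E) \<and> is_nat_trans (path_category E) vect_category F G \<eta>"
  "Ident (path_module_category E) F = (\<lambda>U\<in>Fpow E. \<lambda>x\<in>carrier (fobj F U). x)"
  "Comp (path_module_category E) F G H \<theta> \<eta> = (\<lambda>U\<in>Fpow E. compose (carrier (fobj F U)) (\<theta> U) (\<eta> U))"
  by (simp_all add: path_module_category_def lin_functor_category_def)

lemma is_functor_weight_functor:
  fixes p :: "'i \<Rightarrow> 'k::field_char_0"
  shows "is_functor (weight_category_at p :: (('i, 'k, 'm) weyl_module, 'm \<Rightarrow> 'm) category) (path_module_category (integral_indices p)) (weight_functor p)"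
  unfolding is_functor_def weight_category_at_simps
proof (intro conjI ballI)
  let ?C = "path_category (integral_indices p) :: ('i set, ('i set list \<Rightarrow>\<^sub>0 'k) set, 'k) lin_category"
  fix M :: "('i, 'k, 'm) weyl_module"
  assume "M \<in> Obj (weight_category_at p)"
  then interpret M: weight_module_at M p by (simp add: weight_category_at_Obj)
  show "fobj (weight_functor p) M \<in> Obj (path_module_category (integral_indices p))"
    by (simp add: weight_functor_def path_module_category_simps M.is_lin_functor_vertex_functor)
  show "fmap (weight_functor p) M M (\<lambda>x\<in>carrier M. x) =
    Ident (path_module_category (integral_indices p)) (fobj (weight_functor p) M)"
    by (auto simp: weight_functor_def path_module_category_simps vertex_functor_def fun_eq_iff dest: M.weight_space_closed)
  fix N :: "('i, 'k, 'm) weyl_module" and f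
  assume "N \<in> Obj (weight_category_at p)"
  then interpret N: weight_module_at N p by (simp add: weight_category_at_Obj)
  assume f: "f \<in> lmod_hom weyl_algebra M N"
  note fM = hom_weight_space[OF M.weyl_left_module_axioms N.weyl_left_module_axioms f]
  have "is_nat_trans ?C vect_category (vertex_functor p M) (vertex_functor p N)
     (\<lambda>U\<in>Fpow (integral_indices p). restrict f (weight_space M (weight p (corner p U))))"
    unfolding is_nat_trans_def
  proof (intro conjI ballI)
    fix U assume "U \<in> Obj ?C"
    then have U: "U \<in> Fpow (integral_indices p)" by simp
    show "(\<lambda>U\<in>Fpow (integral_indices p). restrict f (weight_space M (weight p (corner p U)))) U
        \<in> Hom vect_category (fobj (vertex_functor p M) U) (fobj (vertex_functor p N) U)"
      using U lmod_hom_add[OF f] hom_scalars[OF f]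
      by (auto intro!: lmod_homI simp: vertex_functor_def fM M.weight_space_add M.weight_space_smult M.weight_space_closed)
    fix W a assume "W \<in> Obj ?C" and a: "a \<in> Hom ?C U W"
    then have W: "W \<in> Fpow (integral_indices p)" by simp
    show "Comp vect_category (fobj (vertex_functor p M) U) (fobj (vertex_functor p M) W) (fobj (vertex_functor p N) W)
        ((\<lambda>U\<in>Fpow (integral_indices p). restrict f (weight_space M (weight p (corner p U)))) W)
        (fmap (vertex_functor p M) U W a) =
      Comp vect_category (fobj (vertex_functor p M) U) (fobj (vertex_functor p N) U) (fobj (vertex_functor p N) W)
        (fmap (vertex_functor p N) U W a)
        ((\<lambda>U\<in>Fpow (integral_indices p). restrict f (weight_space M (weight p (corner p U)))) U)"
      using U W
      by (auto simp: vertex_functor_def compose_def fun_eq_iff fM M.weight_space_smult M.shift_weight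
          hom_scalars[OF f] hom_shift[OF M.weyl_left_module_axioms f] M.weight_space_closed M.shift_closed)
  qed
  then show "fmap (weight_functor p) M N f \<in> Hom (path_module_category (integral_indices p))
       (fobj (weight_functor p) M) (fobj (weight_functor p) N)"
    by (simp add: weight_functor_def path_module_category_simps)
  fix P :: "('i, 'k, 'm) weyl_module" and g
  show "fmap (weight_functor p) M P (compose (carrier M) g f) =
      Comp (path_module_category (integral_indices p)) (fobj (weight_functor p) M) (fobj (weight_functor p) N)
        (fobj (weight_functor p) P) (fmap (weight_functor p) N P g) (fmap (weight_functor p) M N f)"
    by (auto simp: weight_functor_def path_module_category_simps vertex_functor_def compose_def fun_eq_iff fM
        M.weight_space_closed)
qed

lemma weight_functor_faithful:
  fixes p :: "'i \<Rightarrow> 'k::field_char_0"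
  assumes M: "weight_module_at M p" and N: "weight_module_at N p"
    and f: "f \<in> lmod_hom weyl_algebra M N" and g: "g \<in> lmod_hom weyl_algebra M N"
    and eq: "fmap (weight_functor p) M N f = fmap (weight_functor p) M N g"
  shows "f = g"
proof -
  interpret M: weight_module_at M p by fact
  interpret N: weight_module_at N p by fact
  have corner: "f x = g x" if "U \<in> Fpow (integral_indices p)" "x \<in> M.W (corner p U)" for U x
    using fun_cong[OF fun_cong[OF eq], of U x] that by (simp add: weight_functor_def)
  have "f x = g x" if x: "x \<in> carrier M" for x
  proof (rule M.additive_maps_eq[OF N.M.abelian_group_axioms _ _ _ _ x])
    fix v x assume x: "x \<in> M.W v"
    \<comment> \<open>A preimage of \<open>x\<close> under the shift from the corner, where the two
      maps are known to agree; the round trip costs \<open>base_factor\<close>, hence the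
      inverse.\<close>
    let ?y = "inverse (base_factor p v) \<odot>\<^bsub>scalars M\<^esub> shift M v (base p v) x"
    have xM: "x \<in> carrier M" by (rule M.weight_space_closed[OF x])
    have y: "?y \<in> M.W (base p v)" by (intro M.weight_space_smult M.shift_weight x)
    have "x = shift M (base p v) v ?y"
      using M.shift_base[OF x] M.shift_smult M.shift_closed M.rep.smult_smult M.rep.smult_1 xM base_factor_nonzero[of p v]
      by simp
    then show "f x = g x"
      using hom_shift[OF M.weyl_left_module_axioms f] hom_shift[OF M.weyl_left_module_axioms g]
        corner[OF vertex_Fpow y] M.weight_space_closed[OF y] by metis
  qed (simp_all add: lmod_hom_closed[OF f] lmod_hom_add[OF f] lmod_hom_add[OF g])
  then show ?thesis
    using lmod_hom_extensional[OF f] lmod_hom_extensional[OF g] by (auto intro: extensionalityI)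
qed

text \<open>On weight spaces the generators are shifts by unit vectors, so a family compatible with
  all shifts commutes with the generators, and therefore with the whole algebra.\<close>

lemma ex_hom_extending:
  fixes p :: "'i \<Rightarrow> 'k::field_char_0"
  assumes M: "weight_module_at M p" and N: "weight_module_at N p"
    and closed: "\<And>v x. x \<in> weight_space M (weight p v) \<Longrightarrow> l v x \<in> weight_space N (weight p v)"
    and add: "\<And>v x y. x \<in> weight_space M (weight p v) \<Longrightarrow> y \<in> weight_space M (weight p v) \<Longrightarrow>
       l v (x \<oplus>\<^bsub>M\<^esub> y) = l v x \<oplus>\<^bsub>N\<^esub> l v y"
    and smult: "\<And>v x c. x \<in> weight_space M (weight p v) \<Longrightarrow>
       l v (c \<odot>\<^bsub>scalars M\<^esub> x) = c \<odot>\<^bsub>scalars N\<^esub> l v x"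
    and shift: "\<And>v w x. x \<in> weight_space M (weight p v) \<Longrightarrow> l w (shift M v w x) = shift N v w (l v x)"
  shows "\<exists>h\<in>lmod_hom weyl_algebra M N. \<forall>v. \<forall>x\<in>weight_space M (weight p v). h x = l v x"
proof -
  interpret M: weight_module_at M p by fact
  interpret N: weight_module_at N p by fact
  have zero: "l v \<zero>\<^bsub>M\<^esub> = \<zero>\<^bsub>N\<^esub>" for v
    using smult[OF M.weight_space_zero, of v 0] closed[OF M.weight_space_zero, of v] M.rep.smult_0_right[of 0]
      N.rep.smult_0_left[of "l v \<zero>\<^bsub>M\<^esub>"] N.weight_space_closed by simp
  define h where "h = (\<lambda>x\<in>carrier M. finsum N (\<lambda>v. l v (M.component x v)) {v. M.component x v \<noteq> \<zero>\<^bsub>M\<^esub>})"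
  have lc: "l v (M.component x v) \<in> carrier N" if "x \<in> carrier M" for x v
    using N.weight_space_closed closed M.component_weight that by blast
  have h_sum: "h x = finsum N (\<lambda>v. l v (M.component x v)) S"
    if "finite S" "{v. M.component x v \<noteq> \<zero>\<^bsub>M\<^esub>} \<subseteq> S" "x \<in> carrier M" for x S
  proof -
    have "finsum N (\<lambda>v. l v (M.component x v)) {v. M.component x v \<noteq> \<zero>\<^bsub>M\<^esub>} =
        finsum N (\<lambda>v. l v (M.component x v)) S"
      by (rule N.M.add.finprod_mono_neutral_cong_left) (use that lc in \<open>auto simp: zero\<close>)
    then show ?thesis using that by (simp add: h_def)
  qed
  have h_closed: "h x \<in> carrier N" if "x \<in> carrier M" for x
    using that lc by (simp add: h_def N.M.finsum_closed Pi_def)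
  have h_add: "h (x \<oplus>\<^bsub>M\<^esub> y) = h x \<oplus>\<^bsub>N\<^esub> h y" if x: "x \<in> carrier M" and y: "y \<in> carrier M" for x y
  proof -
    let ?S = "{v. M.component x v \<noteq> \<zero>\<^bsub>M\<^esub>} \<union> {v. M.component y v \<noteq> \<zero>\<^bsub>M\<^esub>}"
    have S: "finite ?S" using x y by (simp add: M.finite_component)
    have "h (x \<oplus>\<^bsub>M\<^esub> y) = finsum N (\<lambda>v. l v (M.component (x \<oplus>\<^bsub>M\<^esub> y) v)) ?S"
      by (rule h_sum[OF S]) (use x y in \<open>auto simp: M.component_add\<close>)
    also have "\<dots> = finsum N (\<lambda>v. l v (M.component x v) \<oplus>\<^bsub>N\<^esub> l v (M.component y v)) ?S"
      by (rule N.M.finsum_cong') (use x y lc in \<open>auto simp: M.component_add add M.component_weight\<close>)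
    also have "\<dots> = h x \<oplus>\<^bsub>N\<^esub> h y"
      using x y lc by (simp add: h_sum[OF S] N.M.finsum_addf Pi_def)
    finally show ?thesis .
  qed
  have h_weight: "h x = l v x" if x: "x \<in> M.W v" for v x
  proof -
    have "h x = finsum N (\<lambda>w. l w (M.component x w)) {v}"
      by (rule h_sum) (auto simp: M.component_of_weight[OF x] M.weight_space_closed[OF x])
    then show ?thesis using closed[OF x] N.weight_space_closed by (simp add: M.component_of_weight[OF x])
  qed
  have shift_unit: "shift M v (v + Poly_Mapping.single i 1) x = weyl_X i \<odot>\<^bsub>M\<^esub> x"
      "shift M v (v - Poly_Mapping.single i 1) x = weyl_Y i \<odot>\<^bsub>M\<^esub> x"
    if "x \<in> weight_space M (weight p v)" "weight_module_at M p" for M :: "('i, 'k, 'm) weyl_module" and v i x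
  proof -
    interpret weight_module_at M p by fact
    show "shift M v (v + Poly_Mapping.single i 1) x = weyl_X i \<odot>\<^bsub>M\<^esub> x"
      "shift M v (v - Poly_Mapping.single i 1) x = weyl_Y i \<odot>\<^bsub>M\<^esub> x"
      using X_shift[OF that(1), of i v] Y_shift[OF that(1), of i v] rep.smult_1 shift_closed weight_space_closed[OF that(1)]
      by simp_all
  qed
  have hX: "h (weyl_X i \<odot>\<^bsub>M\<^esub> x) = weyl_X i \<odot>\<^bsub>N\<^esub> h x" if x: "x \<in> carrier M" for i x
  proof (rule M.additive_maps_eq[OF N.M.abelian_group_axioms _ _ _ _ x])
    fix v x assume x: "x \<in> M.W v"
    show "h (weyl_X i \<odot>\<^bsub>M\<^esub> x) = weyl_X i \<odot>\<^bsub>N\<^esub> h x"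
      using h_weight[OF x] h_weight[OF M.shift_weight[OF x]] shift[OF x]
      by (simp flip: shift_unit(1)[OF x M] shift_unit(1)[OF closed[OF x] N])
  qed (use M.rep.x_add N.rep.x_add in \<open>simp_all add: h_closed h_add\<close>)
  have hY: "h (weyl_Y i \<odot>\<^bsub>M\<^esub> x) = weyl_Y i \<odot>\<^bsub>N\<^esub> h x" if x: "x \<in> carrier M" for i x
  proof (rule M.additive_maps_eq[OF N.M.abelian_group_axioms _ _ _ _ x])
    fix v x assume x: "x \<in> M.W v"
    show "h (weyl_Y i \<odot>\<^bsub>M\<^esub> x) = weyl_Y i \<odot>\<^bsub>N\<^esub> h x"
      using h_weight[OF x] h_weight[OF M.shift_weight[OF x]] shift[OF x]
      by (simp flip: shift_unit(2)[OF x M] shift_unit(2)[OF closed[OF x] N])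
  qed (use M.rep.y_add N.rep.y_add in \<open>simp_all add: h_closed h_add\<close>)
  have hc: "h (c \<odot>\<^bsub>scalars M\<^esub> x) = c \<odot>\<^bsub>scalars N\<^esub> h x" if x: "x \<in> carrier M" for c x
  proof (rule M.additive_maps_eq[OF N.M.abelian_group_axioms _ _ _ _ x])
    fix v x assume x: "x \<in> M.W v"
    show "h (c \<odot>\<^bsub>scalars M\<^esub> x) = c \<odot>\<^bsub>scalars N\<^esub> h x"
      using h_weight[OF x] h_weight[OF M.weight_space_smult[OF x]] smult[OF x] by simp
  qed (use M.rep.smult_add_right N.rep.smult_add_right M.rep.smult_closed' in \<open>simp_all add: h_closed h_add\<close>)
  \<comment> \<open>Compatibility spreads from the generators along the inductive generation of the
    algebra.\<close>
  have "h (a \<odot>\<^bsub>M\<^esub> x) = a \<odot>\<^bsub>N\<^esub> h x" if "a \<in> weyl_carrier" "x \<in> carrier M" for a x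
    using that
  proof (induction a arbitrary: x rule: weyl_carrier.induct)
    case one
    have "id \<odot>\<^bsub>M\<^esub> x = x" "id \<odot>\<^bsub>N\<^esub> h x = h x"
      using M.smult_one[of x] N.smult_one[of "h x"] h_closed one by simp_all
    then show ?case by (simp only:)
  next
    case (add a b)
    then show ?case
      using M.smult_closed[of a x] M.smult_closed[of b x] by (simp add: M.smult_sum N.smult_sum h_closed h_add)
  next
    case (scale a c)
    have eq: "(\<lambda>u. const_poly c * a u) = weyl_scalar c \<circ> a" by (auto simp: weyl_scalar_def)
    have "(weyl_scalar c \<circ> a) \<odot>\<^bsub>M\<^esub> x = c \<odot>\<^bsub>scalars M\<^esub> (a \<odot>\<^bsub>M\<^esub> x)"
      "(weyl_scalar c \<circ> a) \<odot>\<^bsub>N\<^esub> h x = c \<odot>\<^bsub>scalars N\<^esub> (a \<odot>\<^bsub>N\<^esub> h x)"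
      using scale M.smult_comp[of "weyl_scalar c" a x] N.smult_comp[of "weyl_scalar c" a "h x"] h_closed
      by (simp_all add: smult_scalars weyl_scalar_closed)
    then show ?case using scale M.smult_closed[of a x] by (simp add: eq hc)
  next
    case (comp a b)
    have "h ((a \<circ> b) \<odot>\<^bsub>M\<^esub> x) = h (a \<odot>\<^bsub>M\<^esub> (b \<odot>\<^bsub>M\<^esub> x))" using comp by (simp add: M.smult_comp)
    also have "\<dots> = a \<odot>\<^bsub>N\<^esub> (b \<odot>\<^bsub>N\<^esub> h x)" using comp M.smult_closed[of b x] by simp
    also have "\<dots> = (a \<circ> b) \<odot>\<^bsub>N\<^esub> h x" using comp h_closed by (simp add: N.smult_comp)
    finally show ?case .
  qed (auto simp: hX hY)
  moreover have "h \<in> extensional (carrier M)" by (simp add: h_def)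
  ultimately have "h \<in> lmod_hom weyl_algebra M N"
    by (intro lmod_homI) (auto simp: h_closed h_add)
  then show ?thesis using h_weight by blast
qed

text \<open>The transformation prescribes the map at the corners only. It is carried to all weights
  by shifts, and the cocycle identity shows that the resulting family commutes with every
  shift.\<close>

lemma weight_functor_full:
  fixes p :: "'i \<Rightarrow> 'k::field_char_0"
  assumes M: "weight_module_at M p" and N: "weight_module_at N p"
    and \<eta>: "\<eta> \<in> Hom (path_module_category (integral_indices p)) (vertex_functor p M) (vertex_functor p N)"
  shows "\<exists>f\<in>lmod_hom weyl_algebra M N. fmap (weight_functor p) M N f = \<eta>"
proof -
  interpret M: weight_module_at M p by fact
  interpret N: weight_module_at N p by fact
  let ?J = "integral_indices p" and ?c = "corner p"
  have ext: "\<eta> \<in> extensional (Fpow ?J)"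
    and nt: "is_nat_trans (path_category ?J) vect_category (vertex_functor p M) (vertex_functor p N) \<eta>"
    using \<eta> by (auto simp: path_module_category_simps)
  have hom: "\<eta> U \<in> lmod_hom scalar_ring (weight_vect M (weight p (?c U))) (weight_vect N (weight p (?c U)))"
    if "U \<in> Fpow ?J" for U
    using nt that by (simp add: is_nat_trans_def vertex_functor_def)
  note \<eta>_closed = lmod_hom_closed[OF hom, simplified]
    and \<eta>_add = lmod_hom_add[OF hom, simplified] and \<eta>_smult = lmod_hom_smult[OF hom, simplified]
  have nat: "\<eta> W (shift M (?c U) (?c W) x) = shift N (?c U) (?c W) (\<eta> U x)"
    if U: "U \<in> Fpow ?J" and W: "W \<in> Fpow ?J" and x: "x \<in> M.W (?c U)" for U W x
  proof -
    \<comment> \<open>This arrow has value 1, so naturality along it says that \<open>\<eta>\<close>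
      commutes with the bare shift between the two corners.\<close>
    let ?a = "basic_arrow ?J U W :: ('i set list \<Rightarrow>\<^sub>0 'k) set"
    have a: "?a \<in> Hom (path_category ?J) U W" by (rule basic_arrow_Hom[OF U W])
    have "Comp vect_category (fobj (vertex_functor p M) U) (fobj (vertex_functor p M) W) (fobj (vertex_functor p N) W)
        (\<eta> W) (fmap (vertex_functor p M) U W ?a) =
      Comp vect_category (fobj (vertex_functor p M) U) (fobj (vertex_functor p N) U) (fobj (vertex_functor p N) W)
        (fmap (vertex_functor p N) U W ?a) (\<eta> U)"
      using nt U W a unfolding is_nat_trans_def by simp
    from fun_cong[OF this, of x] show ?thesis
      using x \<eta>_closed[OF U x] M.rep.smult_1 N.rep.smult_1
        M.shift_closed[OF M.weight_space_closed[OF x]] N.shift_closed[OF N.weight_space_closed[OF \<eta>_closed[OF U x]]]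
      by (simp add: vertex_functor_def compose_def arrow_value_basic[OF U W])
  qed
  \<comment> \<open>Go to the corner, apply \<open>\<eta>\<close>, return, and divide by the scalar
    that the round trip produces.\<close>
  define l where "l v x = inverse (base_factor p v) \<odot>\<^bsub>scalars N\<^esub>
     shift N (base p v) v (\<eta> (vertex p v) (shift M v (base p v) x))" for v x
  note V = vertex_Fpow
  have "\<exists>h\<in>lmod_hom weyl_algebra M N. \<forall>v. \<forall>x\<in>M.W v. h x = l v x"
  proof (rule ex_hom_extending[OF M N])
    fix v x assume x: "x \<in> M.W v"
    note xM = M.weight_space_closed[OF x]
    show "l v x \<in> N.W v"
      unfolding l_def by (intro N.weight_space_smult N.shift_weight \<eta>_closed M.shift_weight x V)
    let ?a = "base p v"
    let ?y = "shift M v ?a x"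
    have y: "?y \<in> M.W ?a" by (intro M.shift_weight x)
    note yM = M.weight_space_closed[OF y]
    have ey: "\<eta> (vertex p v) ?y \<in> N.W ?a" by (intro \<eta>_closed V y)
    note eyN = N.weight_space_closed[OF ey]
    show "l v (c \<odot>\<^bsub>scalars M\<^esub> x) = c \<odot>\<^bsub>scalars N\<^esub> l v x" for c
      using N.rep.smult_smult
      by (simp add: l_def M.shift_smult xM \<eta>_smult V y N.shift_smult eyN N.shift_closed mult.commute)
    show "l v (x \<oplus>\<^bsub>M\<^esub> x') = l v x \<oplus>\<^bsub>N\<^esub> l v x'" if x': "x' \<in> M.W v" for x'
    proof -
      have y': "shift M v ?a x' \<in> M.W ?a" by (intro M.shift_weight x')
      show ?thesis
        using N.rep.smult_add_right N.weight_space_closed[OF \<eta>_closed[OF V y']]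
        by (simp add: l_def M.shift_add xM M.weight_space_closed[OF x'] \<eta>_add V y y' N.shift_add eyN N.shift_closed)
    qed
    fix w
    let ?b = "base p w" and ?B = "backtrack p"
    \<comment> \<open>Multiplying by \<open>base_factor p v\<close> replaces \<open>x\<close> by a
      vector shifted out of the corner \<open>?a\<close>; all shifts then start at \<open>?a\<close>
      and can be composed there.\<close>
    have "base_factor p v \<odot>\<^bsub>scalars M\<^esub> shift M w ?b (shift M v w x) = shift M w ?b (shift M v w (shift M ?a v ?y))"
      using M.shift_base[OF x] M.shift_smult xM by (simp add: M.shift_closed)
    also have "\<dots> = (?B ?a v w * ?B ?a w ?b) \<odot>\<^bsub>scalars M\<^esub> shift M ?a ?b ?y"
      using M.rep.smult_smult by (simp add: M.shift_shift[OF y] M.shift_smult M.shift_closed yM)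
    finally have "inverse (base_factor p v) \<odot>\<^bsub>scalars M\<^esub> (base_factor p v \<odot>\<^bsub>scalars M\<^esub> shift M w ?b (shift M v w x)) =
       inverse (base_factor p v) \<odot>\<^bsub>scalars M\<^esub> ((?B ?a v w * ?B ?a w ?b) \<odot>\<^bsub>scalars M\<^esub> shift M ?a ?b ?y)"
      by simp
    then have 1: "shift M w ?b (shift M v w x) =
       (inverse (base_factor p v) * (?B ?a v w * ?B ?a w ?b)) \<odot>\<^bsub>scalars M\<^esub> shift M ?a ?b ?y"
      using M.rep.smult_smult M.rep.smult_1 base_factor_nonzero[of p v] by (simp add: M.shift_closed xM yM)
    have "l w (shift M v w x) = inverse (base_factor p w) \<odot>\<^bsub>scalars N\<^esub> shift N ?b w
       ((inverse (base_factor p v) * (?B ?a v w * ?B ?a w ?b)) \<odot>\<^bsub>scalars N\<^esub> shift N ?a ?b (\<eta> (vertex p v) ?y))"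
      by (simp add: l_def 1 \<eta>_smult V M.shift_weight y nat)
    also have "\<dots> = (inverse (base_factor p w) * (inverse (base_factor p v) * (?B ?a v w * ?B ?a w ?b)) * ?B ?a ?b w)
        \<odot>\<^bsub>scalars N\<^esub> shift N ?a w (\<eta> (vertex p v) ?y)"
      using N.rep.smult_smult
      by (simp add: N.shift_smult N.shift_closed eyN N.shift_shift[OF ey] mult.assoc)
    \<comment> \<open>The cocycle identity for \<open>?a\<close>, \<open>w\<close>,
      \<open>?b\<close>, \<open>w\<close> turns the detour from \<open>w\<close> to its corner and
      back into \<open>base_factor p w\<close>, which cancels.\<close>
    also have "inverse (base_factor p w) * (inverse (base_factor p v) * (?B ?a v w * ?B ?a w ?b)) * ?B ?a ?b w =
      inverse (base_factor p v) * ?B ?a v w"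
      using backtrack_cocycle[of p ?a w ?b w] base_factor_nonzero[of p w] backtrack_swap[of p w ?b]
      by (simp add: field_simps)
    also have "(inverse (base_factor p v) * ?B ?a v w) \<odot>\<^bsub>scalars N\<^esub> shift N ?a w (\<eta> (vertex p v) ?y) = shift N v w (l v x)"
      using N.rep.smult_smult
      by (simp add: l_def N.shift_smult N.shift_closed eyN N.shift_shift[OF ey])
    finally show "l w (shift M v w x) = shift N v w (l v x)" .
  qed
  then obtain h where h: "h \<in> lmod_hom weyl_algebra M N" and hl: "\<And>v x. x \<in> M.W v \<Longrightarrow> h x = l v x"
    by blast
  have "h x = \<eta> U x" if U: "U \<in> Fpow ?J" and x: "x \<in> M.W (?c U)" for U x
    using hl[OF x] N.rep.smult_1 \<eta>_closed[OF U x] N.weight_space_closed by (simp add: l_def vertex_corner[OF U])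
  then have "fmap (weight_functor p) M N h = \<eta>"
    using extensional_arb[OF ext] lmod_hom_extensional[OF hom]
    by (auto simp: weight_functor_def fun_eq_iff extensional_def)
  then show ?thesis using h by blast
qed

section \<open>Weight modules from path modules\<close>

text \<open>The coefficient for transporting a basic arrow between the corners to one between \<open>v\<close> and \<open>w\<close>.\<close>

definition transport_factor :: "('i \<Rightarrow> 'k::field_char_0) \<Rightarrow> ('i \<Rightarrow>\<^sub>0 int) \<Rightarrow> ('i \<Rightarrow>\<^sub>0 int) \<Rightarrow> 'k" where
  "transport_factor p v w =
     backtrack p (base p v) v w * backtrack p (base p v) w (base p w) / base_factor p w"

text \<open>The formula for \<open>transport_factor\<close> is forced: in a weight module, the shift
  from \<open>v\<close> to \<open>w\<close>, read through the identifications of both weight spaces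
  with those at the corners, is this multiple of the shift between the corners. The lemma says that
  the cocycle on all weights is cohomologous to its pullback from the corners; four cocycle
  identities are interleaved.\<close>

lemma transport_factor_comp:
  "transport_factor p w u * transport_factor p v w * backtrack p (base p v) (base p w) (base p u) =
    backtrack p v w u * transport_factor p v u"
proof -
  let ?B = "backtrack p" and ?a = "base p v" and ?b = "base p w" and ?c = "base p u"
  have "(?B ?b w u * ?B ?b u ?c) * (?B ?a v w * ?B ?a w ?b) * ?B ?a ?b ?c =
      ?B ?a v w * ?B ?b w u * ?B ?a w ?b * (?B ?b u ?c * ?B ?a ?b ?c)" by (simp only: ac_simps)
  also have "?B ?b u ?c * ?B ?a ?b ?c = ?B ?a ?b u * ?B ?a u ?c" by (rule backtrack_cocycle[symmetric])
  also have "?B ?a v w * ?B ?b w u * ?B ?a w ?b * (?B ?a ?b u * ?B ?a u ?c) =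
      ?B ?a v w * ?B ?b w u * ?B ?a u ?c * (?B ?a w ?b * ?B ?a ?b u)" by (simp only: ac_simps)
  also have "?B ?a w ?b * ?B ?a ?b u = ?B w ?b u * ?B ?a w u" by (rule backtrack_cocycle)
  also have "?B ?a v w * ?B ?b w u * ?B ?a u ?c * (?B w ?b u * ?B ?a w u) =
      (?B ?b w u * ?B w ?b u) * (?B ?a v w * ?B ?a w u) * ?B ?a u ?c" by (simp only: ac_simps)
  also have "?B ?b w u * ?B w ?b u = base_factor p w"
    using backtrack_cocycle[of p w ?b w u] by (simp add: backtrack_swap[of p w ?b])
  also have "?B ?a v w * ?B ?a w u = ?B v w u * ?B ?a v u" by (rule backtrack_cocycle)
  finally have "(?B ?b w u * ?B ?b u ?c) * (?B ?a v w * ?B ?a w ?b) * ?B ?a ?b ?c =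
    base_factor p w * (?B v w u * ?B ?a v u) * ?B ?a u ?c" .
  then show ?thesis
    using base_factor_nonzero[of p w] base_factor_nonzero[of p u]
    by (simp add: transport_factor_def divide_simps ac_simps)
qed

lemma transport_factor_same: "transport_factor p v v = 1"
  using base_factor_nonzero[of p v] by (simp add: transport_factor_def)

lemma transport_factor_corner:
  "U \<in> Fpow (integral_indices p) \<Longrightarrow> W \<in> Fpow (integral_indices p) \<Longrightarrow>
    transport_factor p (corner p U) (corner p W) = 1"
  by (simp add: transport_factor_def vertex_corner)

locale path_module =
  fixes p :: "'i \<Rightarrow> 'k::field_char_0"
    and V :: "('i set, ('i set list \<Rightarrow>\<^sub>0 'k) set, ('k, 'm) module, 'm \<Rightarrow> 'm) cat_functor"
  assumes lin_functor: "is_lin_functor (path_category (integral_indices p)) vect_category V"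
begin

abbreviation J where "J \<equiv> integral_indices p"
abbreviation arr where "arr U W \<equiv> fmap V U W (basic_arrow J U W)"
abbreviation E where "E v \<equiv> fobj V (vertex p v)"

lemma is_functor: "is_functor (path_category J) vect_category V"
  using lin_functor by (simp add: is_lin_functor_def)

lemma module_fobj: "U \<in> Fpow J \<Longrightarrow> Module.module scalar_ring (fobj V U)"
  using fobj_Obj[OF is_functor, of U] by simp

lemma fmap_hom: "U \<in> Fpow J \<Longrightarrow> W \<in> Fpow J \<Longrightarrow> a \<in> Hom (path_category J) U W \<Longrightarrow>
    fmap V U W a \<in> lmod_hom scalar_ring (fobj V U) (fobj V W)"
  using fmap_Hom[OF is_functor, of a U W] by simp

text \<open>Basic arrows span, so by linearity the functor is known once the maps \<open>arr\<close>
  are.\<close>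

lemma fmap_eq_arr:
  assumes U: "U \<in> Fpow J" and W: "W \<in> Fpow J" and a: "a \<in> Hom (path_category J) U W"
    and x: "x \<in> carrier (fobj V U)"
  shows "fmap V U W a x = arrow_value a \<odot>\<^bsub>fobj V W\<^esub> arr U W x"
proof -
  have "(basic_arrow J U W :: ('i set list \<Rightarrow>\<^sub>0 'k) set) \<in> Hom (path_category J) U W"
    by (rule basic_arrow_Hom[OF U W])
  then have "fmap V U W (HScale (path_category J) U W (arrow_value a) (basic_arrow J U W)) =
      HScale vect_category (fobj V U) (fobj V W) (arrow_value a) (arr U W)"
    using lin_functor U W unfolding is_lin_functor_def by simp
  then have "fmap V U W a = HScale vect_category (fobj V U) (fobj V W) (arrow_value a) (arr U W)"
    using arrow_eq_HScale_basic[OF U W a] by simp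
  then show ?thesis using x by simp
qed

lemma arr_same: "U \<in> Fpow J \<Longrightarrow> x \<in> carrier (fobj V U) \<Longrightarrow> arr U U x = x"
  using fmap_Ident[OF is_functor, of U] by (simp add: basic_arrow_Ident)

lemma arr_arr:
  assumes U: "U \<in> Fpow J" and W: "W \<in> Fpow J" and Z: "Z \<in> Fpow J" and x: "x \<in> carrier (fobj V U)"
  shows "arr W Z (arr U W x) = of_bool (no_backtrack U W Z) \<odot>\<^bsub>fobj V Z\<^esub> arr U Z x"
proof -
  let ?c = "Comp (path_category J) U W Z (basic_arrow J W Z) (basic_arrow J U W)"
  have c: "?c \<in> Hom (path_category J) U Z"
    by (intro Comp_Hom_path basic_arrow_Hom U W Z)
  have "arr W Z (arr U W x) = fmap V U Z ?c x"
    using fmap_Comp[OF is_functor basic_arrow_Hom[OF U W] basic_arrow_Hom[OF W Z]] U W Z x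
    by (simp add: compose_def)
  also have "\<dots> = arrow_value ?c \<odot>\<^bsub>fobj V Z\<^esub> arr U Z x" by (rule fmap_eq_arr[OF U Z c x])
  also have "arrow_value ?c = of_bool (no_backtrack U W Z)"
    using arrow_value_Comp[OF U W basic_arrow_Hom[OF U W] basic_arrow_Hom[OF W Z] Z]
    by (simp add: arrow_value_basic U W Z)
  finally show ?thesis .
qed

sublocale E: Module.module scalar_ring "E v" for v
  by (rule module_fobj[OF vertex_Fpow])

lemma E_smult:
  "x \<in> carrier (E v) \<Longrightarrow> c \<odot>\<^bsub>E v\<^esub> x \<in> carrier (E v)"
  "x \<in> carrier (E v) \<Longrightarrow> c \<odot>\<^bsub>E v\<^esub> (d \<odot>\<^bsub>E v\<^esub> x) = (c * d) \<odot>\<^bsub>E v\<^esub> x"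
  "x \<in> carrier (E v) \<Longrightarrow> 1 \<odot>\<^bsub>E v\<^esub> x = x"
  "x \<in> carrier (E v) \<Longrightarrow> 0 \<odot>\<^bsub>E v\<^esub> x = \<zero>\<^bsub>E v\<^esub>"
  "c \<odot>\<^bsub>E v\<^esub> \<zero>\<^bsub>E v\<^esub> = \<zero>\<^bsub>E v\<^esub>"
  "x \<in> carrier (E v) \<Longrightarrow> (c + d) \<odot>\<^bsub>E v\<^esub> x = c \<odot>\<^bsub>E v\<^esub> x \<oplus>\<^bsub>E v\<^esub> d \<odot>\<^bsub>E v\<^esub> x"
  "x \<in> carrier (E v) \<Longrightarrow> y \<in> carrier (E v) \<Longrightarrow> c \<odot>\<^bsub>E v\<^esub> (x \<oplus>\<^bsub>E v\<^esub> y) = c \<odot>\<^bsub>E v\<^esub> x \<oplus>\<^bsub>E v\<^esub> c \<odot>\<^bsub>E v\<^esub> y"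
  using E.smult_assoc1[of c d x v] E.smult_one[of x v] E.smult_l_null[of x v] E.smult_r_null[of c v]
    E.smult_l_distr[of c d x v] E.smult_r_distr[of c x v y] by auto

lemma E_smult_cancel:
  assumes "x \<in> carrier (E v)" "c \<odot>\<^bsub>E v\<^esub> x = d \<odot>\<^bsub>E v\<^esub> x" "x \<noteq> \<zero>\<^bsub>E v\<^esub>"
  shows "c = d"
proof (rule ccontr)
  assume "c \<noteq> d"
  then have "x = (inverse (c - d) * (c - d)) \<odot>\<^bsub>E v\<^esub> x" using assms E_smult by simp
  also have "\<dots> = inverse (c - d) \<odot>\<^bsub>E v\<^esub> ((c - d) \<odot>\<^bsub>E v\<^esub> x)" using assms E_smult by simp
  also have "(c - d) \<odot>\<^bsub>E v\<^esub> x = \<zero>\<^bsub>E v\<^esub>"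
  proof -
    have "(c - d) \<odot>\<^bsub>E v\<^esub> x \<oplus>\<^bsub>E v\<^esub> d \<odot>\<^bsub>E v\<^esub> x = \<zero>\<^bsub>E v\<^esub> \<oplus>\<^bsub>E v\<^esub> d \<odot>\<^bsub>E v\<^esub> x"
      using assms E_smult(6)[of x v "c - d" d] E_smult(1)[of x v d] by simp
    then show ?thesis using assms(1) E_smult(1) by (simp add: E.M.add.right_cancel del: E.M.l_zero)
  qed
  finally show False using assms E_smult by simp
qed

text \<open>The shift to be: each weight \<open>v\<close> carries a copy \<open>E v\<close> of the
  space at its vertex, and \<open>tr\<close> must compose as shifts do.\<close>

definition tr :: "('i \<Rightarrow>\<^sub>0 int) \<Rightarrow> ('i \<Rightarrow>\<^sub>0 int) \<Rightarrow> 'm \<Rightarrow> 'm" where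
  "tr v w x = transport_factor p v w \<odot>\<^bsub>E w\<^esub> arr (vertex p v) (vertex p w) x"

lemmas arr_hom = fmap_hom[OF vertex_Fpow vertex_Fpow basic_arrow_Hom[OF vertex_Fpow vertex_Fpow]]

lemma tr_closed: "x \<in> carrier (E v) \<Longrightarrow> tr v w x \<in> carrier (E w)"
  using lmod_hom_closed[OF arr_hom] by (simp add: tr_def E_smult(1))

lemma tr_add: "x \<in> carrier (E v) \<Longrightarrow> y \<in> carrier (E v) \<Longrightarrow> tr v w (x \<oplus>\<^bsub>E v\<^esub> y) = tr v w x \<oplus>\<^bsub>E w\<^esub> tr v w y"
  using lmod_hom_closed[OF arr_hom] lmod_hom_add[OF arr_hom] by (simp add: tr_def E_smult(7))

lemma tr_smult: "x \<in> carrier (E v) \<Longrightarrow> tr v w (c \<odot>\<^bsub>E v\<^esub> x) = c \<odot>\<^bsub>E w\<^esub> tr v w x"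
  using lmod_hom_closed[OF arr_hom] lmod_hom_smult[OF arr_hom] by (simp add: tr_def E_smult(2) mult.commute)

lemma tr_zero: "tr v w \<zero>\<^bsub>E v\<^esub> = \<zero>\<^bsub>E w\<^esub>"
  using tr_smult[of "\<zero>\<^bsub>E v\<^esub>" v w 0] tr_closed[of "\<zero>\<^bsub>E v\<^esub>" v w] by (simp add: E_smult(4,5))

lemma tr_same: "x \<in> carrier (E v) \<Longrightarrow> tr v v x = x"
  by (simp add: tr_def transport_factor_same arr_same[OF vertex_Fpow] E_smult(3))

text \<open>Basic arrows compose with the cocycle of the corners;
  \<open>transport_factor_comp\<close> converts it into that of the actual weights, giving the law
  of \<open>shift_shift\<close>.\<close>

lemma tr_tr:
  assumes x: "x \<in> carrier (E v)"
  shows "tr w u (tr v w x) = backtrack p v w u \<odot>\<^bsub>E u\<^esub> tr v u x"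
proof -
  have "tr w u (tr v w x) = (transport_factor p v w * transport_factor p w u * of_bool (no_backtrack (vertex p v) (vertex p w) (vertex p u)))
      \<odot>\<^bsub>E u\<^esub> arr (vertex p v) (vertex p u) x"
    using lmod_hom_closed[OF arr_hom x] lmod_hom_closed[OF arr_hom] lmod_hom_smult[OF arr_hom]
    by (simp add: tr_def arr_arr[OF vertex_Fpow vertex_Fpow vertex_Fpow x] E_smult(1,2) mult.assoc mult.left_commute)
  also have "transport_factor p v w * transport_factor p w u * of_bool (no_backtrack (vertex p v) (vertex p w) (vertex p u)) =
    backtrack p v w u * transport_factor p v u"
    using transport_factor_comp[of p w u v] backtrack_corner[OF vertex_Fpow vertex_Fpow vertex_Fpow, of p v w u]
    by (simp add: mult.commute)
  finally show ?thesis using lmod_hom_closed[OF arr_hom x] by (simp add: tr_def E_smult(2))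
qed

text \<open>The direct sum over all weights. Each vertex space has its own zero element, so the
  default value of a section varies with \<open>v\<close>.\<close>

definition sections :: "(('i \<Rightarrow>\<^sub>0 int) \<Rightarrow> 'm) set" where
  "sections = {f. (\<forall>v. f v \<in> carrier (E v)) \<and> finite {v. f v \<noteq> \<zero>\<^bsub>E v\<^esub>}}"

definition sections_module :: "('k, ('i \<Rightarrow>\<^sub>0 int) \<Rightarrow> 'm) module" where
  "sections_module = \<lparr>carrier = sections, monoid.mult = (\<lambda>f g. f), one = (\<lambda>v. \<zero>\<^bsub>E v\<^esub>), ring.zero = (\<lambda>v. \<zero>\<^bsub>E v\<^esub>),
     add = (\<lambda>f g v. f v \<oplus>\<^bsub>E v\<^esub> g v), module.smult = (\<lambda>c f v. c \<odot>\<^bsub>E v\<^esub> f v)\<rparr>"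

lemma sections_module_simps [simp]:
  "carrier sections_module = sections" "\<zero>\<^bsub>sections_module\<^esub> = (\<lambda>v. \<zero>\<^bsub>E v\<^esub>)"
  "f \<oplus>\<^bsub>sections_module\<^esub> g = (\<lambda>v. f v \<oplus>\<^bsub>E v\<^esub> g v)" "c \<odot>\<^bsub>sections_module\<^esub> f = (\<lambda>v. c \<odot>\<^bsub>E v\<^esub> f v)"
  by (simp_all add: sections_module_def)

lemma sectionsD: "f \<in> sections \<Longrightarrow> f v \<in> carrier (E v)"
  by (simp add: sections_def)

lemma finite_support: "f \<in> sections \<Longrightarrow> finite {v. f v \<noteq> \<zero>\<^bsub>E v\<^esub>}"
  by (simp add: sections_def)

lemma sectionsI:
  assumes "\<And>v. f v \<in> carrier (E v)" "finite S" "\<And>v. v \<notin> S \<Longrightarrow> f v = \<zero>\<^bsub>E v\<^esub>"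
  shows "f \<in> sections"
proof -
  have "{v. f v \<noteq> \<zero>\<^bsub>E v\<^esub>} \<subseteq> S" using assms(3) by blast
  then show ?thesis using assms by (auto simp: sections_def intro: finite_subset)
qed

lemma smult_sections:
  assumes "f \<in> sections"
  shows "(\<lambda>v. c \<odot>\<^bsub>E v\<^esub> f v) \<in> sections"
proof (rule sectionsI[OF _ finite_support[OF assms]])
  show "c \<odot>\<^bsub>E v\<^esub> f v \<in> carrier (E v)" for v
    by (rule E_smult(1)[OF sectionsD[OF assms]])
  show "c \<odot>\<^bsub>E v\<^esub> f v = \<zero>\<^bsub>E v\<^esub>" if "v \<notin> {v. f v \<noteq> \<zero>\<^bsub>E v\<^esub>}" for v
    using that E_smult(5) by auto
qed

definition x_op :: "'i \<Rightarrow> (('i \<Rightarrow>\<^sub>0 int) \<Rightarrow> 'm) \<Rightarrow> ('i \<Rightarrow>\<^sub>0 int) \<Rightarrow> 'm" where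
  "x_op i f = (\<lambda>v. tr (v - Poly_Mapping.single i 1) v (f (v - Poly_Mapping.single i 1)))"

definition y_op :: "'i \<Rightarrow> (('i \<Rightarrow>\<^sub>0 int) \<Rightarrow> 'm) \<Rightarrow> ('i \<Rightarrow>\<^sub>0 int) \<Rightarrow> 'm" where
  "y_op i f = (\<lambda>v. tr (v + Poly_Mapping.single i 1) v (f (v + Poly_Mapping.single i 1)))"

lemma backtrack_plus': "backtrack p u (v - Poly_Mapping.single i 1) v =
    (if Poly_Mapping.lookup v i \<le> Poly_Mapping.lookup u i then p i + of_int (Poly_Mapping.lookup v i) else 1)"
  using backtrack_plus[of p u "v - Poly_Mapping.single i 1" i] by (auto simp: lookup_minus)

lemma backtrack_minus': "backtrack p u (v + Poly_Mapping.single i 1) v =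
    (if Poly_Mapping.lookup u i \<le> Poly_Mapping.lookup v i then p i + of_int (Poly_Mapping.lookup v i) + 1 else 1)"
  using backtrack_minus[of p u "v + Poly_Mapping.single i 1" i] by (auto simp: lookup_add add.assoc)

sublocale D: weyl_rep_char_0 sections_module x_op y_op
proof (intro weyl_rep_char_0.intro weyl_rep.intro weyl_rep_axioms.intro)
  show "Module.module scalar_ring sections_module"
  proof (rule moduleI[OF cring_scalar_ring])
    show "abelian_group sections_module"
    proof (rule abelian_groupI; unfold sections_module_simps)
      fix f g h assume f: "f \<in> sections" and g: "g \<in> sections" and h: "h \<in> sections"
      note cl = sectionsD[OF f] sectionsD[OF g] sectionsD[OF h]
      show "(\<lambda>v. f v \<oplus>\<^bsub>E v\<^esub> g v) \<in> sections"
        by (rule sectionsI[OF _ finite_UnI[OF finite_support[OF f] finite_support[OF g]]]) (simp_all add: cl)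
      show "(\<lambda>v. f v \<oplus>\<^bsub>E v\<^esub> g v \<oplus>\<^bsub>E v\<^esub> h v) = (\<lambda>v. f v \<oplus>\<^bsub>E v\<^esub> (g v \<oplus>\<^bsub>E v\<^esub> h v))"
        "(\<lambda>v. f v \<oplus>\<^bsub>E v\<^esub> g v) = (\<lambda>v. g v \<oplus>\<^bsub>E v\<^esub> f v)"
        "(\<lambda>v. \<zero>\<^bsub>E v\<^esub> \<oplus>\<^bsub>E v\<^esub> f v) = f"
        by (simp_all add: cl E.M.add.m_ac)
      have "(-1) \<odot>\<^bsub>E v\<^esub> f v \<oplus>\<^bsub>E v\<^esub> f v = \<zero>\<^bsub>E v\<^esub>" for v
        using E_smult(6)[of "f v" v "-1" 1] E_smult(3,4)[of "f v" v] cl(1) by simp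
      then show "\<exists>h\<in>sections. (\<lambda>v. h v \<oplus>\<^bsub>E v\<^esub> f v) = (\<lambda>v. \<zero>\<^bsub>E v\<^esub>)"
        by (intro bexI[of _ "\<lambda>v. (-1) \<odot>\<^bsub>E v\<^esub> f v"] smult_sections f) simp
    next
      show "(\<lambda>v. \<zero>\<^bsub>E v\<^esub>) \<in> sections" by (rule sectionsI[of _ "{}"]) simp_all
    qed
    fix f g c d assume "f \<in> carrier sections_module"
    then have f: "f \<in> sections" by simp
    show "c \<odot>\<^bsub>sections_module\<^esub> f \<in> carrier sections_module"
      using smult_sections[OF f] by simp
    show "(c \<oplus>\<^bsub>scalar_ring\<^esub> d) \<odot>\<^bsub>sections_module\<^esub> f = c \<odot>\<^bsub>sections_module\<^esub> f \<oplus>\<^bsub>sections_module\<^esub> d \<odot>\<^bsub>sections_module\<^esub> f"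
      "(c \<otimes>\<^bsub>scalar_ring\<^esub> d) \<odot>\<^bsub>sections_module\<^esub> f = c \<odot>\<^bsub>sections_module\<^esub> (d \<odot>\<^bsub>sections_module\<^esub> f)"
      "\<one>\<^bsub>scalar_ring\<^esub> \<odot>\<^bsub>sections_module\<^esub> f = f"
      using sectionsD[OF f] by (simp_all add: E_smult(2,3,6))
    assume "g \<in> carrier sections_module"
    then have g: "g \<in> sections" by simp
    show "c \<odot>\<^bsub>sections_module\<^esub> (f \<oplus>\<^bsub>sections_module\<^esub> g) = c \<odot>\<^bsub>sections_module\<^esub> f \<oplus>\<^bsub>sections_module\<^esub> c \<odot>\<^bsub>sections_module\<^esub> g"
      using sectionsD[OF f] sectionsD[OF g] by (simp add: E_smult(7))
  qed
next
  fix f i assume f: "f \<in> carrier sections_module"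
  then have f': "f \<in> sections" by simp
  note fE = sectionsD[OF f']
  let ?e = "Poly_Mapping.single i 1 :: 'i \<Rightarrow>\<^sub>0 int"
  have fin: "finite {v. f v \<noteq> \<zero>\<^bsub>E v\<^esub>}" using f by (simp add: sections_def)
  have "f (v - ?e) = \<zero>\<^bsub>E (v - ?e)\<^esub>" if "v \<notin> (\<lambda>w. w + ?e) ` {v. f v \<noteq> \<zero>\<^bsub>E v\<^esub>}" for v
    using that by (metis (mono_tags) diff_add_cancel image_eqI mem_Collect_eq)
  then show "x_op i f \<in> carrier sections_module"
    using f fin unfolding sections_module_simps x_op_def
    by (intro sectionsI[of _ "(\<lambda>w. w + ?e) ` {v. f v \<noteq> \<zero>\<^bsub>E v\<^esub>}"]) (simp_all add: fE tr_closed tr_zero)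
  have "f (v + ?e) = \<zero>\<^bsub>E (v + ?e)\<^esub>" if "v \<notin> (\<lambda>w. w - ?e) ` {v. f v \<noteq> \<zero>\<^bsub>E v\<^esub>}" for v
    using that by (metis (mono_tags) add_diff_cancel_right' image_eqI mem_Collect_eq)
  then show "y_op i f \<in> carrier sections_module"
    using f fin unfolding sections_module_simps y_op_def
    by (intro sectionsI[of _ "(\<lambda>w. w - ?e) ` {v. f v \<noteq> \<zero>\<^bsub>E v\<^esub>}"]) (simp_all add: fE tr_closed tr_zero)
  show "x_op i (c \<odot>\<^bsub>sections_module\<^esub> f) = c \<odot>\<^bsub>sections_module\<^esub> x_op i f"
    "y_op i (c \<odot>\<^bsub>sections_module\<^esub> f) = c \<odot>\<^bsub>sections_module\<^esub> y_op i f" for c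
    by (simp_all add: x_op_def y_op_def fE tr_smult)
  show "x_op i (f \<oplus>\<^bsub>sections_module\<^esub> g) = x_op i f \<oplus>\<^bsub>sections_module\<^esub> x_op i g"
    "y_op i (f \<oplus>\<^bsub>sections_module\<^esub> g) = y_op i f \<oplus>\<^bsub>sections_module\<^esub> y_op i g"
    if "g \<in> carrier sections_module" for g
    using sectionsD[of g] that by (simp_all add: x_op_def y_op_def fE tr_add)
  \<comment> \<open>At \<open>v\<close> the round trips upwards and downwards multiply by
    \<open>p i + v i + 1\<close> and by \<open>p i + v i\<close>, whose difference is 1.\<close>
  show "y_op i (x_op i f) = x_op i (y_op i f) \<oplus>\<^bsub>sections_module\<^esub> f"
    using fE E_smult
    by (simp add: x_op_def y_op_def tr_tr tr_same fun_eq_iff backtrack_plus' backtrack_minus' lookup_add lookup_minus)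
  fix j
  let ?d = "Poly_Mapping.single j 1 :: 'i \<Rightarrow>\<^sub>0 int"
  have comm: "v - ?e - ?d = v - ?d - ?e" "v + ?e + ?d = v + ?d + ?e" "v - ?e + ?d = v + ?d - ?e" for v
    by (simp_all add: algebra_simps)
  show "x_op i (x_op j f) = x_op j (x_op i f)"
    using fE E_smult(3) tr_closed
    by (auto simp: x_op_def tr_tr fun_eq_iff backtrack_plus' lookup_minus lookup_single comm(1) when_def)
  show "y_op i (y_op j f) = y_op j (y_op i f)"
    using fE E_smult(3) tr_closed
    by (auto simp: y_op_def tr_tr fun_eq_iff backtrack_minus' lookup_add lookup_single comm(2) when_def)
  \<comment> \<open>Steps in different directions cross different walls, so both orders give the
    direct transport with factor 1.\<close>
  show "x_op i (y_op j f) = y_op j (x_op i f)" if "i \<noteq> j"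
    using fE E_smult(3) tr_closed that
    by (auto simp: x_op_def y_op_def tr_tr fun_eq_iff backtrack_plus' backtrack_minus' lookup_add lookup_minus lookup_single comm(3) when_def)
qed

end

section \<open>Embedding into the universe\<close>

text \<open>The direct sum consists of functions with values in the universe, while objects of the
  weight category live inside it; the structure is copied along an injection.\<close>

definition transport_module :: "('x \<Rightarrow> 'm) \<Rightarrow> ('r, 'x) module \<Rightarrow> ('r, 'm) module" where
  "transport_module \<iota> N = (let g = the_inv_into (carrier N) \<iota> in
     \<lparr>carrier = \<iota> ` carrier N, monoid.mult = (\<lambda>a b. a), one = \<iota> \<zero>\<^bsub>N\<^esub>, ring.zero = \<iota> \<zero>\<^bsub>N\<^esub>,
      ring.add = (\<lambda>a b. \<iota> (g a \<oplus>\<^bsub>N\<^esub> g b)), module.smult = (\<lambda>r a. \<iota> (r \<odot>\<^bsub>N\<^esub> g a))\<rparr>)"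

lemma transport_module_simps:
  assumes "inj_on \<iota> (carrier N)"
  shows "carrier (transport_module \<iota> N) = \<iota> ` carrier N"
    "\<zero>\<^bsub>transport_module \<iota> N\<^esub> = \<iota> \<zero>\<^bsub>N\<^esub>"
    "x \<in> carrier N \<Longrightarrow> y \<in> carrier N \<Longrightarrow> \<iota> x \<oplus>\<^bsub>transport_module \<iota> N\<^esub> \<iota> y = \<iota> (x \<oplus>\<^bsub>N\<^esub> y)"
    "x \<in> carrier N \<Longrightarrow> r \<odot>\<^bsub>transport_module \<iota> N\<^esub> \<iota> x = \<iota> (r \<odot>\<^bsub>N\<^esub> x)"
  using assms by (simp_all add: transport_module_def Let_def the_inv_into_f_f)

lemma left_module_transport_module:
  assumes N: "left_module R N" and inj: "inj_on \<iota> (carrier N)"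
  shows "left_module R (transport_module \<iota> N)"
proof -
  interpret N: left_module R N by fact
  note simps = transport_module_simps[OF inj]
  show ?thesis
  proof (intro left_module.intro left_module_axioms.intro)
    show "abelian_group (transport_module \<iota> N)"
    proof (rule abelian_groupI)
      fix x assume "x \<in> carrier (transport_module \<iota> N)"
      then obtain x' where "x' \<in> carrier N" "x = \<iota> x'" by (auto simp: simps)
      then show "\<exists>y\<in>carrier (transport_module \<iota> N). y \<oplus>\<^bsub>transport_module \<iota> N\<^esub> x = \<zero>\<^bsub>transport_module \<iota> N\<^esub>"
        using N.M.l_neg[of x'] by (intro bexI[of _ "\<iota> (\<ominus>\<^bsub>N\<^esub> x')"]) (auto simp: simps)
    qed (auto simp: simps N.M.add.m_ac)
  qed (auto simp: simps N.smult_closed N.smult_l_distr N.smult_r_distr N.smult_assoc N.smult_one N.ring_axioms)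
qed

text \<open>Vertexwise inverses of a natural transformation are again linear and natural, so
  bijectivity at every vertex suffices.\<close>

lemma path_module_category_iso:
  fixes F G :: "('i set, ('i set list \<Rightarrow>\<^sub>0 'k::field) set, ('k, 'm) module, 'm \<Rightarrow> 'm) cat_functor"
  assumes F: "F \<in> Obj (path_module_category E)" and G: "G \<in> Obj (path_module_category E)"
    and \<eta>: "\<eta> \<in> Hom (path_module_category E) F G"
    and bij: "\<And>U. U \<in> Fpow E \<Longrightarrow> bij_betw (\<eta> U) (carrier (fobj F U)) (carrier (fobj G U))"
  shows "is_iso (path_module_category E) F G \<eta>"
proof -
  let ?C = "path_category E :: ('i set, ('i set list \<Rightarrow>\<^sub>0 'k) set, 'k) lin_category"
  have FF: "is_functor ?C vect_category F" and FG: "is_functor ?C vect_category G"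
    using F G by (simp_all add: path_module_category_simps is_lin_functor_def)
  have nt: "is_nat_trans ?C vect_category F G \<eta>" and ext: "\<eta> \<in> extensional (Fpow E)"
    using \<eta> by (simp_all add: path_module_category_simps)
  have hom: "\<eta> U \<in> lmod_hom scalar_ring (fobj F U) (fobj G U)" if "U \<in> Fpow E" for U
    using nt that by (simp add: is_nat_trans_def)
  have st: "lmod_stable scalar_ring (fobj F U)" "lmod_stable scalar_ring (fobj G U)" if "U \<in> Fpow E" for U
    using fobj_Obj[OF FF, of U] fobj_Obj[OF FG, of U] that by (auto intro: lmod_stable_module)
  define \<theta> where "\<theta> = (\<lambda>U\<in>Fpow E. \<lambda>y\<in>carrier (fobj G U). the_inv_into (carrier (fobj F U)) (\<eta> U) y)"
  have \<theta>\<eta>: "\<theta> U (\<eta> U x) = x" if "U \<in> Fpow E" "x \<in> carrier (fobj F U)" for U x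
    using that bij[OF that(1)] lmod_hom_closed[OF hom] by (simp add: \<theta>_def bij_betw_def the_inv_into_f_f)
  have \<eta>\<theta>: "\<eta> U (\<theta> U y) = y" and \<theta>_closed: "\<theta> U y \<in> carrier (fobj F U)" if "U \<in> Fpow E" "y \<in> carrier (fobj G U)" for U y
    using that bij[OF that(1)] by (auto simp: \<theta>_def bij_betw_def f_the_inv_into_f the_inv_into_into)
  have \<theta>I: "\<theta> U y = x" if "U \<in> Fpow E" "x \<in> carrier (fobj F U)" "y = \<eta> U x" for U x y
    using \<theta>\<eta> that by simp
  have "is_nat_trans ?C vect_category G F \<theta>"
    unfolding is_nat_trans_def
  proof (intro conjI ballI)
    fix U assume "U \<in> Obj ?C"
    then have U: "U \<in> Fpow E" by simp
    show "\<theta> U \<in> Hom vect_category (fobj G U) (fobj F U)"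
      unfolding vect_category_simps
    proof (rule lmod_homI)
      fix x y assume xy: "x \<in> carrier (fobj G U)" "y \<in> carrier (fobj G U)"
      show "\<theta> U (x \<oplus>\<^bsub>fobj G U\<^esub> y) = \<theta> U x \<oplus>\<^bsub>fobj F U\<^esub> \<theta> U y"
        by (rule \<theta>I[OF U]) (use st[OF U] xy U in \<open>simp_all add: lmod_stable_def \<theta>_closed lmod_hom_add[OF hom] \<eta>\<theta>\<close>)
    next
      fix c x assume x: "x \<in> carrier (fobj G U)"
      show "\<theta> U (c \<odot>\<^bsub>fobj G U\<^esub> x) = c \<odot>\<^bsub>fobj F U\<^esub> \<theta> U x"
        by (rule \<theta>I[OF U]) (use st[OF U] x U in \<open>simp_all add: lmod_stable_def \<theta>_closed lmod_hom_smult[OF hom] \<eta>\<theta>\<close>)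
    qed (use U in \<open>simp_all add: \<theta>_closed\<close>, simp add: \<theta>_def)
    fix W a assume "W \<in> Obj ?C" and a: "a \<in> Hom ?C U W"
    then have W: "W \<in> Fpow E" by simp
    have Fa: "fmap F U W a \<in> lmod_hom scalar_ring (fobj F U) (fobj F W)"
      using fmap_Hom[OF FF a] U W by simp
    have nat: "compose (carrier (fobj F U)) (\<eta> W) (fmap F U W a) = compose (carrier (fobj F U)) (fmap G U W a) (\<eta> U)"
      using nt U W a by (simp add: is_nat_trans_def)
    have "\<theta> W (fmap G U W a y) = fmap F U W a (\<theta> U y)" if y: "y \<in> carrier (fobj G U)" for y
      using fun_cong[OF nat, of "\<theta> U y"] \<theta>_closed[OF U y] \<eta>\<theta>[OF U y] lmod_hom_closed[OF Fa]
      by (intro \<theta>I[OF W]) (auto simp: compose_def)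
    then show "Comp vect_category (fobj G U) (fobj G W) (fobj F W) (\<theta> W) (fmap G U W a) =
       Comp vect_category (fobj G U) (fobj F U) (fobj F W) (fmap F U W a) (\<theta> U)"
      by (auto simp: compose_def fun_eq_iff)
  qed
  then have "\<theta> \<in> Hom (path_module_category E) G F" by (simp add: path_module_category_simps \<theta>_def)
  then show ?thesis
    unfolding is_iso_def using \<eta> \<theta>\<eta> \<eta>\<theta>
    by (intro conjI bexI[of _ \<theta>]) (auto simp: path_module_category_simps compose_def fun_eq_iff)
qed

section \<open>The direct sum as a weight module\<close>

locale embedded_path_module = path_module p V
  for p :: "'i \<Rightarrow> 'k::field_char_0"
    and V :: "('i set, ('i set list \<Rightarrow>\<^sub>0 'k) set, ('k, 'm) module, 'm \<Rightarrow> 'm) cat_functor" +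
  fixes \<iota> :: "(('i \<Rightarrow>\<^sub>0 int) \<Rightarrow> 'm) \<Rightarrow> 'm"
  assumes inj: "inj_on \<iota> sections"
begin

definition T :: "('i, 'k, 'm) weyl_module" where
  "T = transport_module \<iota> D.weyl_module"

abbreviation sec where "sec \<equiv> the_inv_into sections \<iota>"

lemma T_simps:
  "carrier T = \<iota> ` sections" "\<zero>\<^bsub>T\<^esub> = \<iota> (\<lambda>v. \<zero>\<^bsub>E v\<^esub>)"
  "f \<in> sections \<Longrightarrow> g \<in> sections \<Longrightarrow> \<iota> f \<oplus>\<^bsub>T\<^esub> \<iota> g = \<iota> (\<lambda>v. f v \<oplus>\<^bsub>E v\<^esub> g v)"
  "f \<in> sections \<Longrightarrow> a \<odot>\<^bsub>T\<^esub> \<iota> f = \<iota> (D.act a f)"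
  using transport_module_simps[of \<iota> D.weyl_module] inj by (simp_all add: T_def)

sublocale T: weyl_module_at T p
  using left_module_transport_module[OF D.left_module_weyl_module, of \<iota>] inj
  by (simp add: weyl_module_at_def weyl_left_module_def T_def)

lemma sec_\<iota>: "f \<in> sections \<Longrightarrow> sec (\<iota> f) = f"
  using inj by (simp add: the_inv_into_f_f)

lemma T_cases:
  assumes "x \<in> carrier T" obtains f where "f \<in> sections" "x = \<iota> f"
  using assms by (auto simp: T_simps)

lemma sec_closed: "x \<in> carrier T \<Longrightarrow> sec x v \<in> carrier (E v)"
  by (erule T_cases) (simp add: sec_\<iota> sectionsD)

lemma \<iota>_sec: "x \<in> carrier T \<Longrightarrow> \<iota> (sec x) = x"
  by (erule T_cases) (simp add: sec_\<iota>)

lemma sec_eqI: "x \<in> carrier T \<Longrightarrow> y \<in> carrier T \<Longrightarrow> (\<And>v. sec x v = sec y v) \<Longrightarrow> x = y"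
  by (metis \<iota>_sec ext)

lemma x_op_sections: "f \<in> sections \<Longrightarrow> x_op i f \<in> sections"
  and y_op_sections: "f \<in> sections \<Longrightarrow> y_op i f \<in> sections"
  using D.x_closed[of f i] D.y_closed[of f i] by simp_all

lemma T_X: "f \<in> sections \<Longrightarrow> weyl_X i \<odot>\<^bsub>T\<^esub> \<iota> f = \<iota> (x_op i f)"
  and T_Y: "f \<in> sections \<Longrightarrow> weyl_Y i \<odot>\<^bsub>T\<^esub> \<iota> f = \<iota> (y_op i f)"
  and T_scalar: "f \<in> sections \<Longrightarrow> c \<odot>\<^bsub>scalars T\<^esub> \<iota> f = \<iota> (\<lambda>v. c \<odot>\<^bsub>E v\<^esub> f v)"
  by (simp_all add: T_simps smult_scalars D.act_X D.act_Y D.act_scalar)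

lemma add_sections: "f \<in> sections \<Longrightarrow> g \<in> sections \<Longrightarrow> (\<lambda>v. f v \<oplus>\<^bsub>E v\<^esub> g v) \<in> sections"
  using D.M.add.m_closed[of f g] by simp

lemma zero_sections: "(\<lambda>v. \<zero>\<^bsub>E v\<^esub>) \<in> sections"
  using D.M.zero_closed by simp

lemma sec_add: "x \<in> carrier T \<Longrightarrow> y \<in> carrier T \<Longrightarrow> sec (x \<oplus>\<^bsub>T\<^esub> y) v = sec x v \<oplus>\<^bsub>E v\<^esub> sec y v"
  by (elim T_cases) (simp add: T_simps sec_\<iota> add_sections)

lemma sec_smult: "x \<in> carrier T \<Longrightarrow> sec (c \<odot>\<^bsub>scalars T\<^esub> x) v = c \<odot>\<^bsub>E v\<^esub> sec x v"
  by (elim T_cases) (simp add: T_scalar sec_\<iota> smult_sections)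

lemma sec_zero: "sec \<zero>\<^bsub>T\<^esub> v = \<zero>\<^bsub>E v\<^esub>"
  by (simp add: T_simps sec_\<iota> zero_sections)

lemma sec_X: "x \<in> carrier T \<Longrightarrow> sec (weyl_X i \<odot>\<^bsub>T\<^esub> x) (v + Poly_Mapping.single i 1) = tr v (v + Poly_Mapping.single i 1) (sec x v)"
  by (elim T_cases) (simp add: T_X sec_\<iota> x_op_sections, simp add: x_op_def)

lemma sec_Y: "x \<in> carrier T \<Longrightarrow> sec (weyl_Y i \<odot>\<^bsub>T\<^esub> x) (v - Poly_Mapping.single i 1) = tr v (v - Poly_Mapping.single i 1) (sec x v)"
  by (elim T_cases) (simp add: T_Y sec_\<iota> y_op_sections, simp add: y_op_def)

text \<open>On the component at \<open>v\<close> the operator \<open>X Y\<close> in direction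
  \<open>i\<close> is multiplication by \<open>weight p v i\<close>; a nonzero component therefore
  pins down the eigenvalues.\<close>

lemma T_weight_space_iff:
  "x \<in> weight_space T q \<longleftrightarrow> x \<in> carrier T \<and> (\<forall>v. sec x v \<noteq> \<zero>\<^bsub>E v\<^esub> \<longrightarrow> q = weight p v)"
proof (cases "x \<in> carrier T")
  case True
  then obtain f where f: "f \<in> sections" "x = \<iota> f" by (rule T_cases)
  note fE = sectionsD[OF f(1)]
  have xy: "x_op i (y_op i f) v = weight p v i \<odot>\<^bsub>E v\<^esub> f v" for i v
    by (simp add: x_op_def y_op_def tr_tr tr_same fE backtrack_plus' lookup_minus weight_def)
  have "weyl_X i \<odot>\<^bsub>T\<^esub> (weyl_Y i \<odot>\<^bsub>T\<^esub> x) = q i \<odot>\<^bsub>scalars T\<^esub> x \<longleftrightarrow>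
      (\<forall>v. weight p v i \<odot>\<^bsub>E v\<^esub> f v = q i \<odot>\<^bsub>E v\<^esub> f v)" for i
  proof -
    have "weyl_X i \<odot>\<^bsub>T\<^esub> (weyl_Y i \<odot>\<^bsub>T\<^esub> x) = q i \<odot>\<^bsub>scalars T\<^esub> x \<longleftrightarrow> \<iota> (x_op i (y_op i f)) = \<iota> (\<lambda>v. q i \<odot>\<^bsub>E v\<^esub> f v)"
      by (simp add: f T_Y T_X y_op_sections T_scalar)
    also have "\<dots> \<longleftrightarrow> x_op i (y_op i f) = (\<lambda>v. q i \<odot>\<^bsub>E v\<^esub> f v)"
      by (rule inj_on_eq_iff[OF inj]) (intro x_op_sections y_op_sections smult_sections f)+
    finally show ?thesis by (simp add: fun_eq_iff xy)
  qed
  moreover have "(\<forall>i. weight p v i \<odot>\<^bsub>E v\<^esub> f v = q i \<odot>\<^bsub>E v\<^esub> f v) \<longleftrightarrow> (f v \<noteq> \<zero>\<^bsub>E v\<^esub> \<longrightarrow> q = weight p v)" for v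
    using E_smult_cancel[OF fE] E_smult(5) by (metis ext)
  ultimately show ?thesis
    using f by (auto simp: T.weight_space_iff True sec_\<iota>)
qed (simp add: T.weight_space_iff)

text \<open>Weight vectors of any other weight vanish at \<open>v\<close>, so one summand alone is
  visible there.\<close>

lemma sec_finsum:
  assumes "finite S" "\<And>q. q \<in> S \<Longrightarrow> g q \<in> weight_space T q"
  shows "sec (finsum T g S) v = (if weight p v \<in> S then sec (g (weight p v)) v else \<zero>\<^bsub>E v\<^esub>)"
  using assms
proof (induction S)
  case empty
  then show ?case by (simp add: sec_zero)
next
  case (insert q S)
  have g: "g q \<in> carrier T" "g \<in> S \<rightarrow> carrier T" using insert.prems T.weight_space_closed by blast+
  have "sec (finsum T g (insert q S)) v = sec (g q) v \<oplus>\<^bsub>E v\<^esub> sec (finsum T g S) v"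
    using insert.hyps g by (simp add: T.M.finsum_insert sec_add T.M.finsum_closed)
  moreover have "sec (finsum T g S) v = (if weight p v \<in> S then sec (g (weight p v)) v else \<zero>\<^bsub>E v\<^esub>)"
    using insert by simp
  moreover have "sec (g q) v = \<zero>\<^bsub>E v\<^esub>" if "weight p v \<noteq> q"
    using insert.prems[of q] that by (auto simp: T_weight_space_iff)
  moreover have "sec (g (weight p v)) v \<in> carrier (E v)" if "weight p v \<in> insert q S"
    using insert.prems[OF that] T.weight_space_closed sec_closed by blast
  ultimately show ?case using insert.hyps by (cases "weight p v = q") auto
qed

definition point :: "('i \<Rightarrow>\<^sub>0 int) \<Rightarrow> 'm \<Rightarrow> ('i \<Rightarrow>\<^sub>0 int) \<Rightarrow> 'm" where
  "point v y = (\<lambda>w. if w = v then y else \<zero>\<^bsub>E w\<^esub>)"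

lemma point_sections: "y \<in> carrier (E v) \<Longrightarrow> point v y \<in> sections"
  by (rule sectionsI[of _ "{v}"]) (auto simp: point_def)

lemma point_weight: "y \<in> carrier (E v) \<Longrightarrow> \<iota> (point v y) \<in> T.W v"
  by (simp add: T_weight_space_iff point_sections sec_\<iota> T_simps(1)) (simp add: point_def)

lemma is_weight_module_T: "is_weight_module T"
  unfolding is_weight_module_def
proof (intro ballI ex_ex1I)
  fix x assume x: "x \<in> carrier T"
  have inj_w: "inj (weight p)" by (auto intro: injI)
  \<comment> \<open>The decomposition of \<open>x\<close>: its value at each \<open>v\<close>,
    placed as a section supported at that point, and zero for weights outside the range.\<close>
  define F where "F q = (if q \<in> range (weight p) then \<iota> (point (the_inv (weight p) q) (sec x (the_inv (weight p) q))) else \<zero>\<^bsub>T\<^esub>)" for q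
  have F: "F (weight p v) = \<iota> (point v (sec x v))" for v
    by (simp add: F_def the_inv_f_f[OF inj_w])
  have FW: "F q \<in> weight_space T q" for q
  proof (cases "q \<in> range (weight p)")
    case True
    then obtain v where "q = weight p v" by blast
    then show ?thesis using point_weight[OF sec_closed[OF x]] by (simp add: F)
  qed (simp add: F_def T.weight_space_zero)
  have F0: "F (weight p v) = \<zero>\<^bsub>T\<^esub>" if "sec x v = \<zero>\<^bsub>E v\<^esub>" for v
  proof -
    have "point v (sec x v) = (\<lambda>v. \<zero>\<^bsub>E v\<^esub>)" using that by (auto simp: point_def)
    then show ?thesis by (simp add: F T_simps)
  qed
  have "sec x \<in> sections" using x by (elim T_cases) (simp add: sec_\<iota>)
  have "{q. F q \<noteq> \<zero>\<^bsub>T\<^esub>} \<subseteq> weight p ` {v. sec x v \<noteq> \<zero>\<^bsub>E v\<^esub>}"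
  proof
    fix q assume q: "q \<in> {q. F q \<noteq> \<zero>\<^bsub>T\<^esub>}"
    then obtain v where "q = weight p v" by (auto simp: F_def split: if_splits)
    with q F0 show "q \<in> weight p ` {v. sec x v \<noteq> \<zero>\<^bsub>E v\<^esub>}" by blast
  qed
  then have fin: "finite {q. F q \<noteq> \<zero>\<^bsub>T\<^esub>}"
    by (rule finite_subset) (intro finite_imageI finite_support \<open>sec x \<in> sections\<close>)
  have "x = finsum T F {q. F q \<noteq> \<zero>\<^bsub>T\<^esub>}"
  proof (rule sec_eqI[OF x])
    show "finsum T F {q. F q \<noteq> \<zero>\<^bsub>T\<^esub>} \<in> carrier T"
      using FW T.weight_space_closed by (intro T.M.finsum_closed) blast
    fix v
    have "sec (F (weight p v)) v = sec x v"
      using point_sections[OF sec_closed[OF x]] by (simp add: F sec_\<iota> point_def)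
    then show "sec x v = sec (finsum T F {q. F q \<noteq> \<zero>\<^bsub>T\<^esub>}) v"
      using sec_finsum[OF fin FW] sec_zero[of v] by auto
  qed
  then show "\<exists>f. (\<forall>q. f q \<in> weight_space T q) \<and> finite {q. f q \<noteq> \<zero>\<^bsub>T\<^esub>} \<and> x = finsum T f {q. f q \<noteq> \<zero>\<^bsub>T\<^esub>}"
    using FW fin by blast
next
  fix x f g assume x: "x \<in> carrier T"
  assume f: "(\<forall>q. f q \<in> weight_space T q) \<and> finite {q. f q \<noteq> \<zero>\<^bsub>T\<^esub>} \<and> x = finsum T f {q. f q \<noteq> \<zero>\<^bsub>T\<^esub>}"
    and g: "(\<forall>q. g q \<in> weight_space T q) \<and> finite {q. g q \<noteq> \<zero>\<^bsub>T\<^esub>} \<and> x = finsum T g {q. g q \<noteq> \<zero>\<^bsub>T\<^esub>}"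
  \<comment> \<open>Uniqueness: evaluating the sum at every point recovers each member of the family
    from \<open>x\<close>.\<close>
  have val: "sec (h q) v = (if q = weight p v then sec x v else \<zero>\<^bsub>E v\<^esub>)"
    if h: "(\<forall>q. h q \<in> weight_space T q) \<and> finite {q. h q \<noteq> \<zero>\<^bsub>T\<^esub>} \<and> x = finsum T h {q. h q \<noteq> \<zero>\<^bsub>T\<^esub>}" for h q v
  proof (cases "q = weight p v")
    case True
    have "sec (finsum T h {q. h q \<noteq> \<zero>\<^bsub>T\<^esub>}) v = (if weight p v \<in> {q. h q \<noteq> \<zero>\<^bsub>T\<^esub>} then sec (h (weight p v)) v else \<zero>\<^bsub>E v\<^esub>)"
      by (rule sec_finsum) (use h in auto)
    moreover have "finsum T h {q. h q \<noteq> \<zero>\<^bsub>T\<^esub>} = x" using h by (simp only:)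
    ultimately show ?thesis using True sec_zero[of v] by (auto split: if_splits)
  next
    case False
    then show ?thesis using h T_weight_space_iff[of "h q" q] by auto
  qed
  show "f = g"
  proof
    fix q
    have "f q \<in> carrier T" "g q \<in> carrier T"
      using f g T.weight_space_closed[of "f q" q] T.weight_space_closed[of "g q" q] by blast+
    then show "f q = g q"
      by (rule sec_eqI) (simp only: val[OF f] val[OF g])
  qed
qed

lemma weight_supp_T: "weight_supp T \<subseteq> range (weight p)"
proof
  fix q assume "q \<in> weight_supp T"
  then obtain x where x: "x \<in> weight_space T q" "x \<noteq> \<zero>\<^bsub>T\<^esub>"
    using T.weight_space_zero[of q] by (auto simp: weight_supp_def)
  then obtain v where "sec x v \<noteq> \<zero>\<^bsub>E v\<^esub>"
    using sec_eqI[of x "\<zero>\<^bsub>T\<^esub>"] T.weight_space_closed sec_zero by (metis T.M.zero_closed)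
  then show "q \<in> range (weight p)" using x by (auto simp: T_weight_space_iff)
qed

lemma weight_module_at_T: "weight_module_at T p"
  by (intro weight_module_at.intro weight_module_at_axioms.intro T.weyl_module_at_axioms
      is_weight_module_T weight_supp_T)

text \<open>Along a monotone path both sides change by one generator at a time with factor 1, so it
  suffices that the generators act by \<open>tr\<close> on unit steps.\<close>

lemma sec_shift:
  assumes x: "x \<in> T.W v"
  shows "sec (shift T v w x) w = tr v w (sec x v)"
proof (induction w rule: monotone_path_induct[where v = v])
  note xT = T.weight_space_closed[OF x]
  note sT = T.shift_closed[OF xT]
  {
    case base
    then show ?case by (simp add: tr_same sec_closed xT)
  next
    case (plus w i)
    have c: "backtrack p v w (w + Poly_Mapping.single i 1) = 1" using plus by (intro backtrack_disjoint)
    then have "shift T v (w + Poly_Mapping.single i 1) x = weyl_X i \<odot>\<^bsub>T\<^esub> shift T v w x"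
      using T.X_shift[OF x, of i w] T.rep.smult_1 sT by simp
    then show ?case
      using plus.IH c by (simp add: sec_X[OF sT] tr_tr sec_closed xT tr_closed E_smult(3))
  next
    case (minus w i)
    have c: "backtrack p v w (w - Poly_Mapping.single i 1) = 1" using minus by (intro backtrack_disjoint)
    then have "shift T v (w - Poly_Mapping.single i 1) x = weyl_Y i \<odot>\<^bsub>T\<^esub> shift T v w x"
      using T.Y_shift[OF x, of i w] T.rep.smult_1 sT by simp
    then show ?case
      using minus.IH c by (simp add: sec_Y[OF sT] tr_tr sec_closed xT tr_closed E_smult(3))
  }
qed

lemma E_corner: "U \<in> Fpow J \<Longrightarrow> E (corner p U) = fobj V U"
  by (simp add: vertex_corner)

lemma tr_corner:
  assumes "U \<in> Fpow J" "W \<in> Fpow J" "x \<in> carrier (fobj V U)"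
  shows "tr (corner p U) (corner p W) x = arr U W x"
proof -
  have "arr U W x \<in> carrier (fobj V W)"
    using lmod_hom_closed[OF fmap_hom[OF assms(1,2) basic_arrow_Hom[OF assms(1,2)]] assms(3)] .
  then show ?thesis
    using E_smult(3)[of "arr U W x" "corner p W"] assms
    by (simp add: tr_def transport_factor_corner vertex_corner)
qed

text \<open>The isomorphism is evaluation at the corner: a vector of that weight is concentrated
  there, and the space there is the given one. It respects arrows because
  \<open>transport_factor\<close> is 1 between corners.\<close>

lemma vertex_functor_T_iso:
  "\<exists>\<eta>. is_iso (path_module_category J) (vertex_functor p T) V \<eta>"
proof -
  let ?C = "path_category J :: ('i set, ('i set list \<Rightarrow>\<^sub>0 'k) set, 'k) lin_category"
  define \<eta> where "\<eta> = (\<lambda>U\<in>Fpow J. \<lambda>x\<in>T.W (corner p U). sec x (corner p U))"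
  have \<eta>: "\<eta> U x = sec x (corner p U)" if "U \<in> Fpow J" "x \<in> T.W (corner p U)" for U x
    using that by (simp add: \<eta>_def)
  have closed: "sec x (corner p U) \<in> carrier (fobj V U)" if "U \<in> Fpow J" "x \<in> T.W (corner p U)" for U x
    using sec_closed[OF T.weight_space_closed[OF that(2)], of "corner p U"] by (simp add: vertex_corner[OF that(1)])
  have carr: "carrier (fobj (vertex_functor p T) U) = T.W (corner p U)" for U
    by (simp add: vertex_functor_def)
  have "is_nat_trans ?C vect_category (vertex_functor p T) V \<eta>"
    unfolding is_nat_trans_def
  proof (intro conjI ballI)
    fix U assume "U \<in> Obj ?C"
    then have U: "U \<in> Fpow J" by simp
    show "\<eta> U \<in> Hom vect_category (fobj (vertex_functor p T) U) (fobj V U)"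
      unfolding vect_category_simps
    proof (rule lmod_homI; (unfold carr)?)
      show "\<eta> U \<in> extensional (T.W (corner p U))" by (simp add: \<eta>_def U)
      fix x assume x: "x \<in> T.W (corner p U)"
      note xT = T.weight_space_closed[OF x]
      show "\<eta> U x \<in> carrier (fobj V U)" using closed[OF U x] by (simp add: \<eta>[OF U x])
      show "\<eta> U (x \<oplus>\<^bsub>fobj (vertex_functor p T) U\<^esub> y) = \<eta> U x \<oplus>\<^bsub>fobj V U\<^esub> \<eta> U y" if y: "y \<in> T.W (corner p U)" for y
        using sec_add[OF xT T.weight_space_closed[OF y], of "corner p U"]
        by (simp add: vertex_functor_def \<eta>[OF U] x y T.weight_space_add E_corner[OF U])
      show "\<eta> U (c \<odot>\<^bsub>fobj (vertex_functor p T) U\<^esub> x) = c \<odot>\<^bsub>fobj V U\<^esub> \<eta> U x" for c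
        using sec_smult[OF xT, of c "corner p U"]
        by (simp add: vertex_functor_def \<eta>[OF U] x T.weight_space_smult E_corner[OF U])
    qed
    fix W a assume "W \<in> Obj ?C" and a: "a \<in> Hom ?C U W"
    then have W: "W \<in> Fpow J" by simp
    have "\<eta> W (arrow_value a \<odot>\<^bsub>scalars T\<^esub> shift T (corner p U) (corner p W) x) = fmap V U W a (\<eta> U x)"
      if x: "x \<in> T.W (corner p U)" for x
      using sec_smult[OF T.weight_space_closed[OF T.shift_weight[OF x]], of "arrow_value a" "corner p W" "corner p W"]
      by (simp add: \<eta>[OF W] \<eta>[OF U] x T.weight_space_smult T.shift_weight fmap_eq_arr[OF U W a] closed[OF U x]
          sec_shift[OF x] tr_corner[OF U W] E_corner[OF W])
    then show "Comp vect_category (fobj (vertex_functor p T) U) (fobj (vertex_functor p T) W) (fobj V W) (\<eta> W)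
         (fmap (vertex_functor p T) U W a) =
        Comp vect_category (fobj (vertex_functor p T) U) (fobj V U) (fobj V W) (fmap V U W a) (\<eta> U)"
      by (auto simp: vertex_functor_def compose_def fun_eq_iff)
  qed
  then have hom: "\<eta> \<in> Hom (path_module_category J) (vertex_functor p T) V"
    by (simp add: path_module_category_simps \<eta>_def)
  have "is_iso (path_module_category J) (vertex_functor p T) V \<eta>"
  proof (rule path_module_category_iso[OF _ _ hom])
    show "vertex_functor p T \<in> Obj (path_module_category J)" "V \<in> Obj (path_module_category J)"
      by (simp_all add: path_module_category_simps T.is_lin_functor_vertex_functor lin_functor)
    fix U assume U: "U \<in> Fpow J"
    show "bij_betw (\<eta> U) (carrier (fobj (vertex_functor p T) U)) (carrier (fobj V U))"
      unfolding carr bij_betw_def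
    proof (intro conjI inj_onI equalityI subsetI)
      fix x y assume xy: "x \<in> T.W (corner p U)" "y \<in> T.W (corner p U)" "\<eta> U x = \<eta> U y"
      show "x = y"
      proof (rule sec_eqI)
        fix v show "sec x v = sec y v"
        proof (cases "v = corner p U")
          case True
          then show ?thesis using xy by (simp add: \<eta>[OF U])
        next
          case False
          then have "weight p (corner p U) \<noteq> weight p v" by simp
          then show ?thesis using xy(1,2) by (simp add: T_weight_space_iff) metis
        qed
      qed (use xy T.weight_space_closed in auto)
    next
      fix y assume y: "y \<in> carrier (fobj V U)"
      then have yE: "y \<in> carrier (E (corner p U))" by (simp add: E_corner[OF U])
      have "\<eta> U (\<iota> (point (corner p U) y)) = y"
        using \<eta>[OF U point_weight[OF yE]] sec_\<iota>[OF point_sections[OF yE]] by (simp add: point_def)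
      then show "y \<in> \<eta> U ` T.W (corner p U)" using point_weight[OF yE] by (metis imageI)
    qed (use closed U in \<open>auto simp: \<eta>\<close>)
  qed
  then show ?thesis by blast
qed

end

section \<open>Cardinality of the direct sum\<close>

lemma lepoll_Fpow:
  assumes "A \<lesssim> B"
  shows "Fpow A \<lesssim> Fpow B"
proof -
  from assms obtain f where f: "inj_on f A" "f ` A \<subseteq> B" by (auto simp: lepoll_def)
  then show ?thesis
    unfolding lepoll_def by (intro exI[of _ "image f"] conjI inj_on_image_Fpow) (auto simp: Fpow_def)
qed

text \<open>A function is encoded by the finite part of its graph where it departs from
  \<open>z\<close>. The default is a function because the zero of a section depends on the
  weight.\<close>

lemma finite_support_lepoll:
  "{f. finite {x. f x \<noteq> z x}} \<lesssim> Fpow (UNIV :: ('a \<times> 'b) set)" for z :: "'a \<Rightarrow> 'b"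
proof -
  have "inj_on (\<lambda>f. {(x, f x) |x. f x \<noteq> z x}) {f. finite {x. f x \<noteq> z x}}"
  proof (rule inj_onI)
    fix f g assume eq: "{(x, f x) |x. f x \<noteq> z x} = {(x, g x) |x. g x \<noteq> z x}"
    show "f = g"
    proof
      fix x
      have "(x, f x) \<in> {(x, f x) |x. f x \<noteq> z x} \<longleftrightarrow> (x, f x) \<in> {(x, g x) |x. g x \<noteq> z x}"
        "(x, g x) \<in> {(x, f x) |x. f x \<noteq> z x} \<longleftrightarrow> (x, g x) \<in> {(x, g x) |x. g x \<noteq> z x}"
        unfolding eq by simp_all
      then show "f x = g x" by auto
    qed
  qed
  moreover have "finite {(x, f x) |x. f x \<noteq> z x}" if "finite {x. f x \<noteq> z x}" for f
  proof -
    have "{(x, f x) |x. f x \<noteq> z x} = (\<lambda>x. (x, f x)) ` {x. f x \<noteq> z x}" by auto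
    then show ?thesis using that by simp
  qed
  ultimately show ?thesis
    unfolding lepoll_def by (intro exI conjI) (auto simp: Fpow_def)
qed

lemma lepoll_times_self:
  assumes B: "infinite (UNIV :: 'b set)" and A: "(UNIV :: 'a set) \<lesssim> (UNIV :: 'b set)"
    and A': "(UNIV :: 'c set) \<lesssim> (UNIV :: 'b set)"
  shows "Fpow (UNIV :: ('a \<times> 'c) set) \<lesssim> (UNIV :: 'b set)"
proof -
  have "(UNIV :: ('a \<times> 'c) set) \<lesssim> (UNIV :: 'b set) \<times> (UNIV :: 'b set)"
    unfolding UNIV_Times_UNIV[symmetric] by (rule times_lepoll_mono[OF A A'])
  also have "(UNIV :: 'b set) \<times> (UNIV :: 'b set) \<approx> (UNIV :: 'b set)"
    unfolding eqpoll_iff_card_of_ordIso by (rule card_of_Times_same_infinite[OF B])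
  finally have "Fpow (UNIV :: ('a \<times> 'c) set) \<lesssim> Fpow (UNIV :: 'b set)" by (rule lepoll_Fpow)
  also have "Fpow (UNIV :: 'b set) \<approx> (UNIV :: 'b set)" by (rule eqpoll_Fpow[OF B])
  finally show ?thesis .
qed

text \<open>A nonzero vector space inside \<open>'m\<close> forces \<open>'m\<close> to be at least as large as the field.\<close>

lemma (in path_module) sections_lepoll:
  assumes I: "infinite (UNIV :: 'i set)" and IK: "(UNIV :: 'i set) \<prec> (UNIV :: 'k set)"
  shows "sections \<lesssim> (UNIV :: 'm set)"
proof (cases "\<exists>v x. x \<in> carrier (E v) \<and> x \<noteq> \<zero>\<^bsub>E v\<^esub>")
  case True
  then obtain v x where x: "x \<in> carrier (E v)" "x \<noteq> \<zero>\<^bsub>E v\<^esub>" by blast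
  have "inj (\<lambda>c. c \<odot>\<^bsub>E v\<^esub> x)" using E_smult_cancel[OF x(1) _ x(2)] by (auto intro: injI)
  then have "(UNIV :: 'k set) \<lesssim> (UNIV :: 'm set)" unfolding lepoll_def by blast
  \<comment> \<open>The universe dominates the field, which dominates the index set; so it is
    infinite and absorbs finite subsets of products.\<close>
  then have im: "(UNIV :: 'i set) \<lesssim> (UNIV :: 'm set)"
    by (rule lepoll_trans[OF lesspoll_imp_lepoll[OF IK]])
  have M: "infinite (UNIV :: 'm set)"
    using lepoll_trans[OF infinite_le_lepoll[THEN iffD1, OF I] im] infinite_le_lepoll[of "UNIV :: 'm set"] by simp
  have "(UNIV :: int set) \<lesssim> (UNIV :: nat set)"
    unfolding lepoll_def by (rule exI[of _ to_nat]) auto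
  then have zm: "(UNIV :: int set) \<lesssim> (UNIV :: 'm set)"
    by (rule lepoll_trans[OF _ infinite_le_lepoll[THEN iffD1, OF M]])
  have "inj (Poly_Mapping.lookup :: ('i \<Rightarrow>\<^sub>0 int) \<Rightarrow> _)"
    by (rule injI) (simp only: poly_mapping_eq_iff)
  then have "(UNIV :: ('i \<Rightarrow>\<^sub>0 int) set) \<lesssim> {f :: 'i \<Rightarrow> int. finite {x. f x \<noteq> 0}}"
    unfolding lepoll_def by (intro exI[of _ Poly_Mapping.lookup] conjI image_subsetI) simp_all
  also have "\<dots> \<lesssim> Fpow (UNIV :: ('i \<times> int) set)" by (rule finite_support_lepoll)
  also have "\<dots> \<lesssim> (UNIV :: 'm set)" by (rule lepoll_times_self[OF M im zm])
  finally have vm: "(UNIV :: ('i \<Rightarrow>\<^sub>0 int) set) \<lesssim> (UNIV :: 'm set)" .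
  have "sections \<subseteq> {f. finite {v. f v \<noteq> \<zero>\<^bsub>E v\<^esub>}}" by (auto simp: sections_def)
  then have "sections \<lesssim> {f. finite {v. f v \<noteq> \<zero>\<^bsub>E v\<^esub>}}" by (rule subset_imp_lepoll)
  also have "\<dots> \<lesssim> Fpow (UNIV :: (('i \<Rightarrow>\<^sub>0 int) \<times> 'm) set)" by (rule finite_support_lepoll)
  also have "\<dots> \<lesssim> (UNIV :: 'm set)" by (rule lepoll_times_self[OF M vm lepoll_refl])
  finally show ?thesis .
next
  case False
  \<comment> \<open>With all spaces zero, the zero section is the only one, and no size condition on
    the universe enters.\<close>
  then have "sections \<subseteq> {\<lambda>v. \<zero>\<^bsub>E v\<^esub>}" using sectionsD by (auto simp: fun_eq_iff)
  then show ?thesis unfolding lepoll_def by (auto simp: inj_on_def)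
qed

theorem theorem12:
  fixes p :: "'i \<Rightarrow> 'k::{alg_closed_field, field_char_0}"
  assumes "infinite (UNIV :: 'i set)"
    and "(UNIV :: 'i set) \<prec> (UNIV :: 'k set)"
    and "integral_indices p \<noteq> {}"
  shows "equivalent_categories
    (weight_category_at p :: (('i, 'k, 'm) weyl_module, 'm \<Rightarrow> 'm) category)
    (path_module_category (integral_indices p) ::
      (('i set, ('i set list \<Rightarrow>\<^sub>0 'k) set, ('k, 'm) module, 'm \<Rightarrow> 'm) cat_functor,
       'i set \<Rightarrow> 'm \<Rightarrow> 'm) category)"
proof (rule equivalent_categoriesI[OF is_category_weight_category_at is_category_path_module_category
      is_functor_weight_functor])
  fix M N :: "('i, 'k, 'm) weyl_module" and f g
  assume "M \<in> Obj (weight_category_at p)" "N \<in> Obj (weight_category_at p)"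
  then have MN: "weight_module_at M p" "weight_module_at N p" by (simp_all add: weight_category_at_Obj)
  show "f = g" if "f \<in> Hom (weight_category_at p) M N" "g \<in> Hom (weight_category_at p) M N"
    "fmap (weight_functor p) M N f = fmap (weight_functor p) M N g"
    using weight_functor_faithful[OF MN] that by simp
  show "\<exists>f\<in>Hom (weight_category_at p) M N. fmap (weight_functor p) M N f = h"
    if "h \<in> Hom (path_module_category (integral_indices p)) (fobj (weight_functor p) M) (fobj (weight_functor p) N)" for h
    using weight_functor_full[OF MN, of h] that by (simp add: weight_functor_def)
next
  fix V :: "('i set, ('i set list \<Rightarrow>\<^sub>0 'k) set, ('k, 'm) module, 'm \<Rightarrow> 'm) cat_functor"
  assume "V \<in> Obj (path_module_category (integral_indices p))"
  then interpret path_module p V by unfold_locales (simp add: path_module_category_simps)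
  \<comment> \<open>An arbitrary injection suffices, since the module structure is transported along
    it.\<close>
  from sections_lepoll[OF assms(1,2)] obtain \<iota> :: "(('i \<Rightarrow>\<^sub>0 int) \<Rightarrow> 'm) \<Rightarrow> 'm" where "inj_on \<iota> sections"
    by (auto simp: lepoll_def)
  then interpret embedded_path_module p V \<iota> by unfold_locales
  show "\<exists>M\<in>Obj (weight_category_at p). \<exists>f. is_iso (path_module_category (integral_indices p)) (fobj (weight_functor p) M) V f"
    using weight_module_at_T vertex_functor_T_iso
    by (intro bexI[of _ T]) (simp_all add: weight_category_at_Obj weight_functor_def)
qed

end
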